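(* For any $f \in L^2(\mathbb{H}^1)$ that is orthogonal to the kernel of $\overline{Z}^*$ in $L^2(\mathbb{H}^1)$, there exists a solution $u \in L^4(\mathbb{H}^1)$ to the equation $\overline{Z} u = f$; that is, there exist $u \in L^4(\mathbb{H}^1)$ and a sequence $u_j \in C^{\infty}_c(\mathbb{H}^1)$ such that $u_j \to u$ in $L^4(\mathbb{H}^1)$ and $\overline{Z} u_j \to f$ in $L^2(\mathbb{H}^1)$.
   Context: The Heisenberg group $\mathbb{H}^1$ is the boundary of $\{\operatorname{Im} z_2 > |z_1|^2\}$ in $\mathbb{C}^2$, identified with $\mathbb{C} \times \mathbb{R}$ via $[z,t] \mapsto (z, t+i|z|^2)$. It carries the contact form $\theta = dt + i(z\, d\overline{z} - \overline{z}\, dz)$. The spaces $L^p(\mathbb{H}^1)$ of complex-valued functions and the inner product $\langle f,g\rangle_{\mathbb{H}^1} = \int_{\mathbb{H}^1} f \overline{g}\, \theta\wedge d\theta$ are defined with respect to the volume form $\theta \wedge d\theta$ (regarded as a positive measure; in coordinates $z=x+iy$, $t$ it is $4\,dx\,dy\,dt$). Let $\overline{Z} = \frac{\partial}{\partial \overline{z}} - i z \frac{\partial}{\partial t}$, and let $\overline{Z}^*$ be its formal adjoint, i.e. the differential operator satisfying $\langle \overline{Z} f, g\rangle_{\mathbb{H}^1} = \langle f, \overline{Z}^* g\rangle_{\mathbb{H}^1}$ for all $f,g \in C^\infty_c(\mathbb{H}^1)$. The kernel of $\overline{Z}^*$ is the closed subspace of $L^2(\mathbb{H}^1)$ consisting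 of those $v \in L^2(\mathbb{H}^1)$ for which there exists a sequence $v_j \in C^\infty_c(\mathbb{H}^1)$ with $v_j \to v$ in $L^2(\mathbb{H}^1)$ and $\overline{Z}^* v_j \to 0$ in $L^{4/3}(\mathbb{H}^1)$. *)

theory Defs
  imports "HOL-Analysis.Analysis"
begin

section \<open>Smooth functions\<close>

text \<open>\<open>Ck k f\<close>: \<open>f\<close> is \<open>k\<close> times continuously (real) differentiable on the whole space.\<close>

primrec Ck :: "nat \<Rightarrow> ('a::euclidean_space \<Rightarrow> 'b::real_normed_vector) \<Rightarrow> bool" where
  "Ck 0 f \<longleftrightarrow> continuous_on UNIV f"
| "Ck (Suc k) f \<longleftrightarrow>
     (\<forall>x. f differentiable (at x)) \<and> (\<forall>v. Ck k (\<lambda>x. frechet_derivative f (at x) v))"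

definition smooth :: "('a::euclidean_space \<Rightarrow> 'b::real_normed_vector) \<Rightarrow> bool" where
  "smooth f \<longleftrightarrow> (\<forall>k. Ck k f)"

definition test_functions :: "('a::euclidean_space \<Rightarrow> 'b::real_normed_vector) set" where
  "test_functions = {f. smooth f \<and> compact (closure {x. f x \<noteq> 0})}"


section \<open>Lebesgue spaces\<close>

text \<open>Functions, not classes of functions modulo null sets.\<close>

definition Lp :: "real \<Rightarrow> 'a measure \<Rightarrow> ('a \<Rightarrow> complex) set" where
  "Lp p M = {f \<in> borel_measurable M. integrable M (\<lambda>x. norm (f x) powr p)}"

definition Lp_norm :: "real \<Rightarrow> 'a measure \<Rightarrow> ('a \<Rightarrow> complex) \<Rightarrow> real" where
  "Lp_norm p M f = (\<integral>x. norm (f x) powr p \<partial>M) powr (1 / p)"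

text \<open>Membership in \<open>Lp\<close> is required because the integral in \<open>Lp_norm\<close> is \<open>0\<close> when it diverges.\<close>

definition Lp_converges ::
  "real \<Rightarrow> 'a measure \<Rightarrow> (nat \<Rightarrow> 'a \<Rightarrow> complex) \<Rightarrow> ('a \<Rightarrow> complex) \<Rightarrow> bool" where
  "Lp_converges p M fs f \<longleftrightarrow>
     (\<forall>j. fs j \<in> Lp p M) \<and> f \<in> Lp p M \<and>
     (\<lambda>j. Lp_norm p M (\<lambda>x. fs j x - f x)) \<longlonglongrightarrow> 0"


section \<open>The Heisenberg group\<close>

text \<open>A point \<open>[z, t]\<close> of the Heisenberg group is the pair \<open>(z, t)\<close>; it corresponds to the boundary
  point \<open>(z, t + \<i>\<bar>z\<bar>\<^sup>2)\<close> of the domain \<open>Im z\<^sub>2 > \<bar>z\<^sub>1\<bar>\<^sup>2\<close>.\<close>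

type_synonym heis = "complex \<times> real"

text \<open>For \<open>\<theta> = dt + \<i>(z dz' - z' dz)\<close>, with \<open>z'\<close> the conjugate of \<open>z = x + \<i>y\<close>, we have
  \<open>d\<theta> = 2\<i> dz \<and> dz' = 4 dx \<and> dy\<close>, so \<open>\<theta> \<and> d\<theta>\<close> has density \<open>4\<close> with respect to \<open>dx dy dt\<close>.\<close>

definition heis_vol :: "heis measure" where
  "heis_vol = density lborel (\<lambda>_. 4)"

definition heis_inner :: "(heis \<Rightarrow> complex) \<Rightarrow> (heis \<Rightarrow> complex) \<Rightarrow> complex" where
  "heis_inner f g = (\<integral>p. f p * cnj (g p) \<partial>heis_vol)"

definition d_x :: "(heis \<Rightarrow> complex) \<Rightarrow> heis \<Rightarrow> complex" where
  "d_x f p = frechet_derivative f (at p) (1, 0)"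

definition d_y :: "(heis \<Rightarrow> complex) \<Rightarrow> heis \<Rightarrow> complex" where
  "d_y f p = frechet_derivative f (at p) (\<i>, 0)"

definition d_t :: "(heis \<Rightarrow> complex) \<Rightarrow> heis \<Rightarrow> complex" where
  "d_t f p = frechet_derivative f (at p) (0, 1)"

definition d_zbar :: "(heis \<Rightarrow> complex) \<Rightarrow> heis \<Rightarrow> complex" where
  "d_zbar f p = (d_x f p + \<i> * d_y f p) / 2"

definition Zbar :: "(heis \<Rightarrow> complex) \<Rightarrow> heis \<Rightarrow> complex" where
  "Zbar f p = d_zbar f p - \<i> * fst p * d_t f p"

text \<open>Only meaningful for \<open>g \<in> test_functions\<close>. For \<open>D = Zbar\<close> the description is proper, with
  value \<open>- (\<partial>g/\<partial>z + \<i> z' \<partial>g/\<partial>t)\<close>; see \<open>Zbar_star_eq\<close> below.\<close>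

definition formal_adjoint ::
  "((heis \<Rightarrow> complex) \<Rightarrow> heis \<Rightarrow> complex) \<Rightarrow> (heis \<Rightarrow> complex) \<Rightarrow> heis \<Rightarrow> complex" where
  "formal_adjoint D g =
     (THE h. h \<in> test_functions \<and> (\<forall>f\<in>test_functions. heis_inner (D f) g = heis_inner f h))"

definition Zbar_star :: "(heis \<Rightarrow> complex) \<Rightarrow> heis \<Rightarrow> complex" where
  "Zbar_star = formal_adjoint Zbar"

definition ker_Zbar_star :: "(heis \<Rightarrow> complex) set" where
  "ker_Zbar_star =
     {v \<in> Lp 2 heis_vol. \<exists>vs. (\<forall>j. vs j \<in> test_functions) \<and>
        Lp_converges 2 heis_vol vs v \<and>
        Lp_converges (4 / 3) heis_vol (\<lambda>j. Zbar_star (vs j)) (\<lambda>_. 0)}"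


section \<open>Existence and uniqueness of the formal adjoint of \<open>Zbar\<close>\<close>

lemma Ck_cont: "Ck k f \<Longrightarrow> continuous_on UNIV f"
  by (cases k) (simp_all add: differentiable_imp_continuous_on differentiable_on_def)

lemma Ck_SucD: "Ck (Suc k) f \<Longrightarrow> Ck k f"
proof (induction k arbitrary: f)
  case 0 then show ?case using Ck_cont[OF 0] by simp
next
  case (Suc k)
  have *: "Ck (Suc m) f \<longleftrightarrow>
     (\<forall>x. f differentiable (at x)) \<and> (\<forall>v. Ck m (\<lambda>x. frechet_derivative f (at x) v))" for m
    by (rule Ck.simps(2))
  show ?case using Suc.prems unfolding * by (blast intro: Suc.IH)
qed

lemma fd_eq: "(f has_derivative f') (at x) \<Longrightarrow> frechet_derivative f (at x) = f'"
  using frechet_derivative_at by metis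

lemma Ck_const: "Ck k (\<lambda>_. c)"
  by (induction k arbitrary: c) auto

lemma Ck_linear:
  assumes "bounded_linear f" shows "Ck k f"
proof (cases k)
  case 0 then show ?thesis using assms by (simp add: linear_continuous_on)
next
  case (Suc n)
  have d: "(f has_derivative f) (at x)" for x by (rule bounded_linear_imp_has_derivative[OF assms])
  show ?thesis by (simp add: Suc fd_eq[OF d] Ck_const; use d in \<open>auto simp: differentiable_def\<close>)
qed

lemma Ck_add: "Ck k f \<Longrightarrow> Ck k g \<Longrightarrow> Ck k (\<lambda>x. f x + g x)"
proof (induction k arbitrary: f g)
  case 0 then show ?case by (auto intro!: continuous_intros)
next
  case (Suc k)
  have d: "((\<lambda>x. f x + g x) has_derivative
      (\<lambda>v. frechet_derivative f (at x) v + frechet_derivative g (at x) v)) (at x)" for x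
    using Suc.prems by (intro has_derivative_add) (auto simp: frechet_derivative_works[symmetric])
  show ?case using Suc.prems d by (auto simp: fd_eq[OF d] differentiable_def intro!: Suc.IH)
qed

lemma Ck_mult:
  fixes f g :: "_ \<Rightarrow> complex"
  shows "Ck k f \<Longrightarrow> Ck k g \<Longrightarrow> Ck k (\<lambda>x. f x * g x)"
proof (induction k arbitrary: f g)
  case 0 then show ?case by (auto intro!: continuous_intros)
next
  case (Suc k)
  have d: "((\<lambda>x. f x * g x) has_derivative
      (\<lambda>v. f x * frechet_derivative g (at x) v + frechet_derivative f (at x) v * g x)) (at x)" for x
    using Suc.prems by (intro has_derivative_mult) (auto simp: frechet_derivative_works[symmetric])
  have "Ck k f" "Ck k g" using Suc.prems Ck_SucD by blast+
  then show ?case using Suc.prems d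
    by (auto simp: fd_eq[OF d] differentiable_def intro!: Ck_add Suc.IH)
qed

lemma Ck_cnj:
  fixes f :: "_ \<Rightarrow> complex"
  shows "Ck k f \<Longrightarrow> Ck k (\<lambda>x. cnj (f x))"
proof (induction k arbitrary: f)
  case 0 then show ?case by (auto intro!: continuous_intros)
next
  case (Suc k)
  have d: "((\<lambda>x. cnj (f x)) has_derivative (\<lambda>v. cnj (frechet_derivative f (at x) v))) (at x)" for x
    using Suc.prems by (intro derivative_intros) (auto simp: frechet_derivative_works[symmetric])
  show ?case using Suc.prems d by (auto simp: fd_eq[OF d] differentiable_def intro!: Suc.IH)
qed

lemma smooth_const: "smooth (\<lambda>_. c)"
  and smooth_linear: "bounded_linear l \<Longrightarrow> smooth l"
  and smooth_add: "smooth f \<Longrightarrow> smooth g \<Longrightarrow> smooth (\<lambda>x. f x + g x)"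
  by (simp_all add: smooth_def Ck_const Ck_linear Ck_add)

lemma smooth_mult: "smooth (f :: _ \<Rightarrow> complex) \<Longrightarrow> smooth g \<Longrightarrow> smooth (\<lambda>x. f x * g x)"
  and smooth_cnj: "smooth f \<Longrightarrow> smooth (\<lambda>x. cnj (f x))"
  by (simp_all add: smooth_def Ck_mult Ck_cnj)

lemma smooth_deriv: "smooth f \<Longrightarrow> smooth (\<lambda>x. frechet_derivative f (at x) v)"
  unfolding smooth_def using Ck.simps(2) by blast

lemma smooth_cont: "smooth f \<Longrightarrow> continuous_on UNIV f"
  using Ck_cont[of 0 f] by (simp add: smooth_def del: Ck.simps)

lemma smooth_diff:
  assumes "smooth f" shows "(f has_derivative frechet_derivative f (at x)) (at x)"
proof -
  have "Ck (Suc 0) f" using assms unfolding smooth_def by (rule spec)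
  then have "f differentiable (at x)" by simp
  then show ?thesis by (rule frechet_derivative_works[THEN iffD1])
qed

lemma fd_zero:
  assumes "smooth f" "x \<notin> closure {x. f x \<noteq> 0}"
  shows "frechet_derivative f (at x) v = 0"
proof -
  have "frechet_derivative f (at x) = frechet_derivative (\<lambda>_. 0) (at x)"
  proof (rule frechet_derivative_transform_within_open)
    show "f differentiable at x" using smooth_diff[OF assms(1)] by (rule differentiableI)
    show "open (- closure {x. f x \<noteq> 0})" by blast
    show "f x = 0" if "x \<in> - closure {x. f x \<noteq> 0}" for x
      using that closure_subset[of "{x. f x \<noteq> 0}"] by blast
  qed (use assms in blast)
  then show ?thesis by simp
qed

lemma test_iff: "f \<in> test_functions \<longleftrightarrow> smooth f \<and> bounded {x. f x \<noteq> 0}"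
  by (simp add: test_functions_def compact_closure)

lemma testI:
  assumes "smooth f" "g \<in> test_functions" "\<And>x. x \<notin> closure {x. g x \<noteq> 0} \<Longrightarrow> f x = 0"
  shows "f \<in> test_functions"
proof -
  have "{x. f x \<noteq> 0} \<subseteq> closure {x. g x \<noteq> 0}" using assms(3) by blast
  moreover have "bounded (closure {x. g x \<noteq> 0})" using assms(2) by (simp add: test_iff bounded_closure)
  ultimately have "bounded {x. f x \<noteq> 0}" by (rule bounded_subset[rotated])
  with assms(1) show ?thesis unfolding test_iff by (rule conjI)
qed

lemma test_zero: "g \<in> test_functions \<Longrightarrow> x \<notin> closure {x. g x \<noteq> 0} \<Longrightarrow> g x = 0"
  using closure_subset[of "{x. g x \<noteq> 0}"] by blast

lemma test_smooth: "g \<in> test_functions \<Longrightarrow> smooth g" by (simp add: test_functions_def)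

lemma test_deriv:
  assumes g: "g \<in> test_functions"
  shows "(\<lambda>x. frechet_derivative g (at x) v) \<in> test_functions"
  by (rule testI[OF smooth_deriv[OF test_smooth[OF g]] g fd_zero[OF test_smooth[OF g]]])

lemma test_mult1:
  fixes g :: "'a::euclidean_space \<Rightarrow> complex"
  assumes g: "g \<in> test_functions" and f: "smooth f"
  shows "(\<lambda>x. f x * g x) \<in> test_functions"
proof (rule testI[OF smooth_mult[OF f test_smooth[OF g]] g])
  fix x assume "x \<notin> closure {x. g x \<noteq> 0}"
  from test_zero[OF g this] show "f x * g x = 0" by (simp only: mult_zero_right)
qed

lemma test_cnj:
  fixes g :: "'a::euclidean_space \<Rightarrow> complex"
  assumes g: "g \<in> test_functions"
  shows "(\<lambda>x. cnj (g x)) \<in> test_functions"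
proof (rule testI[OF smooth_cnj[OF test_smooth[OF g]] g])
  fix x assume "x \<notin> closure {x. g x \<noteq> 0}"
  from test_zero[OF g this] show "cnj (g x) = 0" by (simp only: complex_cnj_zero)
qed

lemma test_add:
  assumes f: "f \<in> test_functions" and g: "g \<in> test_functions"
  shows "(\<lambda>x. f x + g x) \<in> test_functions"
proof -
  have s: "{x. f x + g x \<noteq> 0} \<subseteq> {x. f x \<noteq> 0} \<union> {x. g x \<noteq> 0}" by auto
  have "bounded ({x. f x \<noteq> 0} \<union> {x. g x \<noteq> 0})" using f g unfolding test_iff bounded_Un by blast
  then have "bounded {x. f x + g x \<noteq> 0}" using s by (rule bounded_subset)
  with smooth_add[OF f[THEN test_smooth] g[THEN test_smooth]] show ?thesis unfolding test_iff by (rule conjI)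
qed

lemma test_integrable:
  fixes g :: "'a::euclidean_space \<Rightarrow> complex"
  assumes "g \<in> test_functions" shows "integrable lborel g"
proof -
  have "integrable lborel (\<lambda>x. indicator (closure {x. g x \<noteq> 0}) x *\<^sub>R g x)"
    using assms continuous_on_subset[OF smooth_cont[OF test_smooth[OF assms]] subset_UNIV]
    by (intro borel_integrable_compact) (auto simp: test_functions_def)
  also have "(\<lambda>x. indicator (closure {x. g x \<noteq> 0}) x *\<^sub>R g x) = g"
  proof
    fix x show "indicator (closure {x. g x \<noteq> 0}) x *\<^sub>R g x = g x"
      using test_zero[OF assms, of x] by (cases "x \<in> closure {x. g x \<noteq> 0}") simp_all
  qed
  finally show ?thesis .
qed

lemma integral_deriv_zero:
  fixes F :: "'a::euclidean_space \<Rightarrow> complex"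
  assumes F: "F \<in> test_functions"
  shows "(\<integral>x. frechet_derivative F (at x) v \<partial>lborel) = 0"
proof -
  define K where "K = closure {x. F x \<noteq> 0}"
  define dF where "dF = (\<lambda>x. frechet_derivative F (at x) v)"
  have K: "compact K" using F by (simp add: K_def test_functions_def)
  have dFt: "dF \<in> test_functions" unfolding dF_def using F by (rule test_deriv)
  have dFc: "continuous_on UNIV dF" using dFt smooth_cont test_smooth by blast
  have Fc: "continuous_on UNIV F" using F smooth_cont test_smooth by blast
  have [measurable]: "F \<in> borel_measurable borel" "dF \<in> borel_measurable borel"
    using Fc dFc by (auto intro: borel_measurable_continuous_onI)
  have dF0: "dF x = 0" if "x \<notin> K" for x
    using that F test_smooth fd_zero unfolding dF_def K_def by blast
  have "bounded (dF ` K)" using K dFc by (meson compact_continuous_image compact_imp_bounded continuous_on_subset subset_UNIV)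
  then obtain B where "B > 0" and B0: "\<And>x. x \<in> K \<Longrightarrow> norm (dF x) \<le> B" by (auto simp: bounded_pos)
  then have B: "norm (dF x) \<le> B" for x using dF0[of x] by (cases "x \<in> K") auto
  define h :: "nat \<Rightarrow> real" where "h n = 1 / Suc n" for n
  have h: "h n > 0" "h n \<le> 1" for n by (auto simp: h_def)
  define s where "s n x = (F (x + h n *\<^sub>R v) - F x) /\<^sub>R h n" for n x
  have der: "((\<lambda>t. F (x + t *\<^sub>R v)) has_vector_derivative dF (x + t *\<^sub>R v)) (at t)" for x t
  proof -
    have 1: "((\<lambda>t. x + t *\<^sub>R v) has_derivative (\<lambda>r. r *\<^sub>R v)) (at t)"
      by (auto intro!: derivative_eq_intros)
    have "((\<lambda>t. F (x + t *\<^sub>R v)) has_derivative (\<lambda>r. frechet_derivative F (at (x + t *\<^sub>R v)) (r *\<^sub>R v))) (at t)"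
      by (rule has_derivative_compose[OF 1 smooth_diff[OF test_smooth[OF F]]])
    moreover have "linear (frechet_derivative F (at (x + t *\<^sub>R v)))"
      using smooth_diff[OF test_smooth[OF F]] has_derivative_linear by blast
    ultimately show ?thesis by (simp add: has_vector_derivative_def dF_def linear_cmul)
  qed
  define L where "L = (\<lambda>(x, t). x - t *\<^sub>R v) ` (K \<times> {0..1})"
  have L: "compact L" unfolding L_def
    by (intro compact_continuous_image compact_Times K compact_Icc)
       (auto simp: case_prod_beta intro!: continuous_intros)
  have s_bd: "norm (s n x) \<le> B * indicator L x" for n x
  proof (cases "x \<in> L")
    case True
    have "norm (F (x + h n *\<^sub>R v) - F (x + 0 *\<^sub>R v)) \<le> B * h n - B * 0"
      by (rule differentiable_bound_general[where f'="\<lambda>t. dF (x + t *\<^sub>R v)" and \<phi>'="\<lambda>_. B"])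
         (use h der B in \<open>auto intro!: continuous_intros continuous_on_compose2[OF Fc] derivative_eq_intros
            simp flip: has_real_derivative_iff_has_vector_derivative\<close>)
    then show ?thesis using True h[of n] by (simp add: s_def divide_simps mult.commute)
  next
    case False
    have "x \<notin> K" using False by (force simp: L_def)
    moreover have "x + h n *\<^sub>R v \<notin> K"
    proof
      assume "x + h n *\<^sub>R v \<in> K"
      then have "x \<in> L" unfolding L_def using h[of n] by (intro image_eqI[where x="(x + h n *\<^sub>R v, h n)"]) auto
      with False show False by simp
    qed
    ultimately have "F x = 0" "F (x + h n *\<^sub>R v) = 0" using test_zero[OF F] by (simp_all only: K_def)
    then show ?thesis using \<open>B > 0\<close> by (simp add: s_def)
  qed
  have s_lim: "(\<lambda>n. s n x) \<longlonglongrightarrow> dF x" for x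
  proof -
    have "((\<lambda>k. norm (F (x + (0 + k) *\<^sub>R v) - F (x + 0 *\<^sub>R v) - k *\<^sub>R dF (x + 0 *\<^sub>R v)) / norm k) \<longlongrightarrow> 0) (at 0)"
      using der[of x 0] unfolding has_vector_derivative_def has_derivative_at by (rule conjunct2)
    moreover have "filterlim h (at 0) sequentially"
    proof -
      have "h = (\<lambda>n. inverse (real (Suc n)))" by (simp add: h_def fun_eq_iff inverse_eq_divide)
      then have "h \<longlonglongrightarrow> 0" using LIMSEQ_inverse_real_of_nat by (simp only:)
      then show ?thesis unfolding filterlim_at using h(1) by (simp add: less_imp_neq[symmetric] eventuallyI)
    qed
    ultimately have "(\<lambda>n. norm (F (x + (0 + h n) *\<^sub>R v) - F (x + 0 *\<^sub>R v) - h n *\<^sub>R dF (x + 0 *\<^sub>R v)) / norm (h n)) \<longlonglongrightarrow> 0"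
      by (rule filterlim_compose)
    moreover have "norm (F (x + (0 + h n) *\<^sub>R v) - F (x + 0 *\<^sub>R v) - h n *\<^sub>R dF (x + 0 *\<^sub>R v)) / norm (h n)
        = norm (s n x - dF x)" for n
    proof -
      have "s n x - dF x = (F (x + h n *\<^sub>R v) - F x - h n *\<^sub>R dF x) /\<^sub>R h n"
        using h(1)[of n] by (simp add: s_def scaleR_diff_right)
      then show ?thesis using h(1)[of n] by (simp add: divide_inverse mult.commute)
    qed
    ultimately have "(\<lambda>n. norm (s n x - dF x)) \<longlonglongrightarrow> 0" by (simp only:)
    then show ?thesis using LIM_zero_iff tendsto_norm_zero_iff by blast
  qed
  have int_s: "(\<integral>x. s n x \<partial>lborel) = 0" for n
  proof -
    have iF: "integrable lborel F" using F by (rule test_integrable)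
    have *: "(\<integral>x. F (x + h n *\<^sub>R v) \<partial>lborel) = (\<integral>x. F x \<partial>lborel)" "integrable lborel (\<lambda>x. F (x + h n *\<^sub>R v))"
      using integral_distr[of "(+) (h n *\<^sub>R v)" lborel borel F] integrable_distr_eq[of "(+) (h n *\<^sub>R v)" lborel borel F] iF
      unfolding lborel_distr_plus by (simp_all add: add.commute)
    show ?thesis unfolding s_def using * iF by simp
  qed
  have "(\<lambda>n. \<integral>x. s n x \<partial>lborel) \<longlonglongrightarrow> (\<integral>x. dF x \<partial>lborel)"
  proof (rule integral_dominated_convergence[where w="\<lambda>x. B * indicator L x"])
    show "integrable lborel (\<lambda>x. B * indicator L x)"
      using borel_integrable_compact[OF L, of "\<lambda>_. B"] by (simp add: mult.commute)
  qed (auto simp: s_lim s_bd, simp add: s_def)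
  then show ?thesis using int_s by (simp add: LIMSEQ_const_iff dF_def)
qed

lemma parts:
  fixes f g :: "'a::euclidean_space \<Rightarrow> complex"
  assumes "f \<in> test_functions" "smooth g"
  shows "(\<integral>x. frechet_derivative f (at x) v * g x \<partial>lborel) = - (\<integral>x. f x * frechet_derivative g (at x) v \<partial>lborel)"
proof -
  have t: "(\<lambda>x. f x * g x) \<in> test_functions" using test_mult1[OF assms] by (simp add: mult.commute)
  have d: "((\<lambda>x. f x * g x) has_derivative
      (\<lambda>v. f x * frechet_derivative g (at x) v + frechet_derivative f (at x) v * g x)) (at x)" for x
    using assms by (intro has_derivative_mult smooth_diff test_smooth[of f])
  have i: "integrable lborel (\<lambda>x. f x * frechet_derivative g (at x) v)"
      "integrable lborel (\<lambda>x. frechet_derivative f (at x) v * g x)"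
    using test_mult1[OF assms(1) smooth_deriv[OF assms(2)], of v] test_mult1[OF test_deriv[OF assms(1)] assms(2), of v]
    by (auto simp: mult.commute dest!: test_integrable)
  show ?thesis using integral_deriv_zero[OF t, of v] i by (simp add: fd_eq[OF d] add_eq_0_iff)
qed

lemma inner_lborel:
  assumes [measurable]: "f \<in> borel_measurable borel" "g \<in> borel_measurable borel"
  shows "heis_inner f g = 4 * (\<integral>p. f p * cnj (g p) \<partial>lborel)"
proof -
  have "(\<lambda>p. f p * cnj (g p)) \<in> borel_measurable lborel"
    using assms by (auto intro!: borel_measurable_times simp: measurable_lborel2 intro: borel_measurable_continuous_on[of cnj] continuous_intros)
  then show ?thesis
    unfolding heis_inner_def heis_vol_def
    using integral_density[of "\<lambda>p. f p * cnj (g p)" lborel "\<lambda>_. 4"] by (simp add: scaleR_conv_of_real)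
qed


lemma test_measurable: "f \<in> test_functions \<Longrightarrow> f \<in> borel_measurable borel"
  by (intro borel_measurable_continuous_onI smooth_cont test_smooth)

lemma test_eq_0:
  fixes k :: "heis \<Rightarrow> complex"
  assumes k: "k \<in> test_functions" and "heis_inner k k = 0"
  shows "k = (\<lambda>_. 0)"
proof
  fix x
  have i: "integrable lborel (\<lambda>p. k p * cnj (k p))"
    using test_mult1[OF test_cnj[OF k] test_smooth[OF k]] by (rule test_integrable)
  have "(\<integral>p. k p * cnj (k p) \<partial>lborel) = 0"
    using assms(2) inner_lborel[OF test_measurable[OF k] test_measurable[OF k]] by simp
  moreover have "k p * cnj (k p) = of_real ((norm (k p))\<^sup>2)" for p by (rule complex_norm_square[symmetric])
  ultimately have "of_real (\<integral>p. (norm (k p))\<^sup>2 \<partial>lborel) = (0::complex)" and "integrable lborel (\<lambda>p. (norm (k p))\<^sup>2)"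
    using i by (simp_all only: integral_complex_of_real complex_of_real_integrable_eq)
  then have "AE p in lborel. (norm (k p))\<^sup>2 = 0"
    by (subst (asm) of_real_eq_0_iff, subst (asm) integral_nonneg_eq_0_iff_AE) auto
  then have "AE p in lborel. p \<in> {p. k p = 0}" by simp
  then have "AE p in lebesgue. p \<in> {p. k p = 0}" by (rule AE_completion)
  moreover have "closed {p. k p = 0}"
    using smooth_cont[OF test_smooth[OF k]] by (intro closed_Collect_eq continuous_on_const)
  ultimately show "k x = 0" using mem_closed_if_AE_lebesgue by blast
qed

lemma Zbar_adjoint:
  assumes f: "f \<in> test_functions" and g: "g \<in> test_functions"
  defines "A \<equiv> \<lambda>p. - ((d_x g p - \<i> * d_y g p) / 2 + \<i> * cnj (fst p) * d_t g p)"
  shows "A \<in> test_functions" "heis_inner (Zbar f) g = heis_inner f A"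
proof -
  have z: "smooth (\<lambda>p::heis. fst p)" using bounded_linear_fst by (rule smooth_linear)
  have sg: "smooth (\<lambda>p. cnj (g p))" using test_smooth[OF g] by (rule smooth_cnj)
  define D where "D h v p = frechet_derivative h (at p) v" for h :: "heis \<Rightarrow> complex" and v p
  have D: "d_x h p = D h (1,0) p" "d_y h p = D h (\<i>,0) p" "d_t h p = D h (0,1) p" for h p
    by (simp_all add: D_def d_x_def d_y_def d_t_def)
  have tD: "D h v \<in> test_functions" if "h \<in> test_functions" for h v
    unfolding D_def using that by (rule test_deriv)
  have Dc: "D (\<lambda>p. cnj (g p)) v p = cnj (D g v p)" for v p
  proof -
    have "((\<lambda>x. cnj (g x)) has_derivative (\<lambda>v. cnj (frechet_derivative g (at p) v))) (at p)"
      by (intro derivative_intros smooth_diff test_smooth g)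
    from fd_eq[OF this] show ?thesis unfolding D_def by simp
  qed
  have Dt: "D (\<lambda>p. fst p * cnj (g p)) (0,1) p = fst p * cnj (D g (0,1) p)" for p
  proof -
    have "((\<lambda>p. fst p * cnj (g p)) has_derivative
        (\<lambda>v. fst p * cnj (frechet_derivative g (at p) v) + fst v * cnj (g p))) (at p)"
      by (intro derivative_intros smooth_diff test_smooth g)
    from fd_eq[OF this] show ?thesis unfolding D_def by simp
  qed
  have "(\<lambda>p. (- (1/2)) * D g (1,0) p + (\<i>/2) * D g (\<i>,0) p + (- \<i> * cnj (fst p)) * D g (0,1) p) \<in> test_functions"
    by (intro test_add test_mult1 tD g smooth_mult smooth_const smooth_cnj z)
  also have "(\<lambda>p. (- (1/2)) * D g (1,0) p + (\<i>/2) * D g (\<i>,0) p + (- \<i> * cnj (fst p)) * D g (0,1) p) = A"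
    by (simp add: A_def D fun_eq_iff field_simps)
  finally show A: "A \<in> test_functions" .
  have "(\<lambda>p. (1/2) * D f (1,0) p + (\<i>/2) * D f (\<i>,0) p + (- \<i> * fst p) * D f (0,1) p) \<in> test_functions"
    by (intro test_add test_mult1 tD f smooth_mult smooth_const z)
  also have "(\<lambda>p. (1/2) * D f (1,0) p + (\<i>/2) * D f (\<i>,0) p + (- \<i> * fst p) * D f (0,1) p) = Zbar f"
    by (simp add: Zbar_def d_zbar_def D fun_eq_iff field_simps)
  finally have Z: "Zbar f \<in> test_functions" .
  have P: "(\<integral>p. D f v p * G p \<partial>lborel) = - (\<integral>p. f p * D G v p \<partial>lborel)" if "smooth G" for G v
    unfolding D_def using f that by (rule parts)
  have I1: "integrable lborel (\<lambda>p. D f v p * G p)" if "smooth G" for G v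
    using test_mult1[OF tD[OF f] that] unfolding mult.commute[of "G _"] by (rule test_integrable)
  have I2: "integrable lborel (\<lambda>p. f p * D G v p)" if "smooth G" for G v
    using test_mult1[OF f smooth_deriv[OF that, of v]] unfolding D_def mult.commute[of _ "f _"] by (rule test_integrable)
  have sz: "smooth (\<lambda>p::heis. fst p * cnj (g p))" using z sg by (rule smooth_mult)
  have "(\<integral>p. Zbar f p * cnj (g p) \<partial>lborel) =
     (\<integral>p. (1/2) * (D f (1,0) p * cnj (g p)) + (\<i>/2) * (D f (\<i>,0) p * cnj (g p)) - \<i> * (D f (0,1) p * (fst p * cnj (g p))) \<partial>lborel)"
    by (rule Bochner_Integration.integral_cong) (simp_all add: Zbar_def d_zbar_def D field_simps)
  also have "\<dots> = (1/2) * (\<integral>p. D f (1,0) p * cnj (g p) \<partial>lborel) + (\<i>/2) * (\<integral>p. D f (\<i>,0) p * cnj (g p) \<partial>lborel)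
      - \<i> * (\<integral>p. D f (0,1) p * (fst p * cnj (g p)) \<partial>lborel)"
    using I1[OF sg] I1[OF sz] by simp
  also have "\<dots> = - (1/2) * (\<integral>p. f p * cnj (D g (1,0) p) \<partial>lborel) - (\<i>/2) * (\<integral>p. f p * cnj (D g (\<i>,0) p) \<partial>lborel)
      + \<i> * (\<integral>p. f p * (fst p * cnj (D g (0,1) p)) \<partial>lborel)"
    unfolding P[OF sg] P[OF sz] Dc Dt by simp
  also have "\<dots> = (\<integral>p. - (1/2) * (f p * cnj (D g (1,0) p)) - (\<i>/2) * (f p * cnj (D g (\<i>,0) p))
      + \<i> * (f p * (fst p * cnj (D g (0,1) p))) \<partial>lborel)"
    using I2[OF sg] I2[OF sz, of "(0,1)"] unfolding Dc Dt by simp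
  also have "\<dots> = (\<integral>p. f p * cnj (A p) \<partial>lborel)"
    by (rule Bochner_Integration.integral_cong) (simp_all add: A_def D field_simps)
  finally show "heis_inner (Zbar f) g = heis_inner f A"
    by (simp add: inner_lborel test_measurable f g A Z)
qed

lemma Zbar_star_eq:
  assumes g: "g \<in> test_functions"
  shows "Zbar_star g = (\<lambda>p. - ((d_x g p - \<i> * d_y g p) / 2 + \<i> * cnj (fst p) * d_t g p))"
    (is "_ = ?A")
  unfolding Zbar_star_def formal_adjoint_def
proof (rule the_equality)
  show A: "?A \<in> test_functions \<and> (\<forall>f\<in>test_functions. heis_inner (Zbar f) g = heis_inner f ?A)"
    using Zbar_adjoint[OF _ g] g by blast
  fix h assume h: "h \<in> test_functions \<and> (\<forall>f\<in>test_functions. heis_inner (Zbar f) g = heis_inner f h)"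
  have ht: "h \<in> test_functions" and At: "?A \<in> test_functions" using h A by blast+
  define k where "k = (\<lambda>p. h p + (- 1) * ?A p)"
  have k: "k \<in> test_functions" unfolding k_def
    by (intro test_add test_mult1 smooth_const ht At)
  have i: "integrable lborel (\<lambda>p. k p * cnj (a p))" if "a \<in> test_functions" for a
    using test_mult1[OF test_cnj[OF that] test_smooth[OF k]] by (rule test_integrable)
  have l: "heis_inner k a = 4 * (\<integral>p. k p * cnj (a p) \<partial>lborel)" if "a \<in> test_functions" for a
    by (rule inner_lborel[OF test_measurable[OF k] test_measurable[OF that]])
  have "heis_inner k h = heis_inner k ?A"
    using bspec[OF conjunct2[OF h] k] bspec[OF conjunct2[OF A] k] by (rule trans[OF sym])
  then have *: "(\<integral>p. k p * cnj (h p) \<partial>lborel) = (\<integral>p. k p * cnj (?A p) \<partial>lborel)"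
    unfolding l[OF ht] l[OF At] by simp
  have "x * cnj x = x * cnj b - x * cnj c" if "x = b + (- 1) * c" for x b c :: complex
    by (simp add: that algebra_simps)
  then have "(\<lambda>p. k p * cnj (k p)) = (\<lambda>p. k p * cnj (h p) - k p * cnj (?A p))"
    by (intro ext) (blast intro: k_def[THEN fun_cong])
  then have "(\<integral>p. k p * cnj (k p) \<partial>lborel) = (\<integral>p. k p * cnj (h p) - k p * cnj (?A p) \<partial>lborel)"
    by (rule arg_cong)
  also have "\<dots> = 0"
    unfolding Bochner_Integration.integral_diff[OF i[OF ht] i[OF At]] * by (rule diff_self)
  finally have "heis_inner k k = 0" unfolding l[OF k] by simp
  from test_eq_0[OF k this] have "h p + (- 1) * ?A p = 0" for p
    unfolding k_def by (rule fun_cong)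
  then have "h p - ?A p = 0" for p by (simp only: mult_minus1 diff_conv_add_uminus)
  then show "h = ?A" by (intro ext) (simp only: right_minus_eq)
qed

end

theory Submission
  imports Defs
begin

text \<open>
  The solution is given by an explicit convolution. Write \<open>p q\<close> for the group law \<open>hmul\<close>, under
  which \<open>Zbar\<close> is left invariant, and \<open>\<zeta> = t + \<i>\<bar>z\<bar>\<^sup>2\<close>, which \<open>Zbar\<close> annihilates. The kernel
  \<open>k = z' / (t\<^sup>2 + \<bar>z\<bar>\<^sup>4) = z' / \<bar>\<zeta>\<bar>\<^sup>2\<close>, \<open>z'\<close> the conjugate of \<open>z\<close>, satisfies \<open>R k = \<zeta>\<^sup>-\<^sup>2 + c \<delta>\<close>, where \<open>R\<close> is the
  right invariant field that agrees with \<open>Zbar\<close> at the origin and \<open>c \<noteq> 0\<close>. Integration by parts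
  moves \<open>Zbar\<close> from the first factor of a convolution to \<open>R\<close> on the second, so that for a test
  function \<open>w\<close>
    \<open>(Zbar w) * k = c w + w * \<zeta>\<^sup>-\<^sup>2\<close>.
  Left invariance and \<open>Zbar \<zeta>\<^sup>-\<^sup>2 = 0\<close> show that \<open>Zbar\<close> annihilates the last term, a multiple of the
  Szego projection of \<open>w\<close>. Hence \<open>g \<mapsto> c\<^sup>-\<^sup>1 g * k\<close> inverts \<open>Zbar\<close> on the right on its range
  (\<open>Zbar_hconv_kernel\<close>). The distributions are replaced by the smooth kernels obtained from
  \<open>\<zeta> + \<i>\<epsilon>\<close> in place of \<open>\<zeta>\<close>.

  The group has homogeneous dimension 4 and \<open>k\<close> has degree \<open>-3\<close>, so that convolution with \<open>k\<close> maps
  \<open>L\<^sup>2\<close> to \<open>L\<^sup>4\<close>: this is the inequality of Hardy, Littlewood and Sobolev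
  (\<open>riesz_potential_L4\<close>), proved here from one pointwise inequality, \<open>kernel_split\<close>.

  It remains to use the hypothesis on \<open>f\<close>. The best approximation of \<open>f\<close> in the \<open>L\<^sup>2\<close> closure of
  \<open>{Zbar w}\<close> leaves an error \<open>h\<close> orthogonal to every \<open>Zbar w\<close>, that is, a weak solution of
  \<open>Zbar_star h = 0\<close>. Mollification and cutoff place \<open>h\<close> in \<open>ker_Zbar_star\<close>
  (\<open>weak_kernel_imp_ker\<close>), so that \<open>f\<close> is orthogonal to \<open>h\<close> and \<open>h = 0\<close>. Therefore \<open>Zbar (w n)\<close>
  tends to \<open>f\<close> in \<open>L\<^sup>2\<close> for some test functions \<open>w n\<close> (\<open>orthogonal_imp_range_closure\<close>). The
  functions \<open>c\<^sup>-\<^sup>1 (Zbar (w n)) * k\<close> are smooth, are mapped to \<open>Zbar (w n)\<close> by \<open>Zbar\<close> and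
  converge in \<open>L\<^sup>4\<close>; cutting them off gives the sequence required.

  Both cutoffs are borderline cases of one lemma, \<open>cutoff_converges\<close>: a cutoff \<open>\<chi>\<close> at scale \<open>R\<close> has
  \<open>\<bar>Zbar \<chi>\<bar> \<le> K / R\<close> on a set of measure \<open>O(R\<^sup>4)\<close>, so the \<open>L\<^sup>4\<close> norm of \<open>Zbar \<chi>\<close> is bounded and
  Holder's inequality with \<open>1/q = 1/p + 1/4\<close> bounds the \<open>L\<^sup>q\<close> norm of \<open>v Zbar \<chi>\<close> by the \<open>L\<^sup>p\<close> norm of
  \<open>v\<close> far out. The exponents \<open>(p, q)\<close> are \<open>(2, 4/3)\<close> for \<open>h\<close> and \<open>(4, 2)\<close> for the solution.
\<close>

section \<open>The group law and invariance of Lebesgue measure\<close>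

text \<open>The sign of the last summand is the one for which the left invariant field through
  \<open>\<partial>/\<partial>z'\<close> at the origin is \<open>Zbar\<close>. The unit is \<open>0\<close> and the inverse of \<open>p\<close> is \<open>- p\<close>.\<close>

definition hmul :: "heis \<Rightarrow> heis \<Rightarrow> heis" where
  "hmul p q = (fst p + fst q, snd p + snd q + 2 * Im (fst p * cnj (fst q)))"

lemma hmul_assoc: "hmul (hmul p q) r = hmul p (hmul q r)"
  by (simp add: hmul_def algebra_simps)

lemma hmul_0 [simp]: "hmul 0 p = p" "hmul p 0 = p"
  by (simp_all add: hmul_def prod_eq_iff)

lemma hmul_minus [simp]: "hmul (- p) p = 0" "hmul p (- p) = 0"
  by (simp_all add: hmul_def prod_eq_iff)

lemma hmul_cancel [simp]: "hmul (- p) (hmul p q) = q" "hmul p (hmul (- p) q) = q"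
    "hmul (hmul q p) (- p) = q" "hmul (hmul q (- p)) p = q"
  by (simp_all add: hmul_assoc flip: hmul_assoc[of p] hmul_assoc[of "- p"])

lemma minus_hmul: "- hmul p q = hmul (- q) (- p)"
  by (simp add: hmul_def prod_eq_iff)

lemma continuous_on_hmul [continuous_intros]:
  "continuous_on S f \<Longrightarrow> continuous_on S g \<Longrightarrow> continuous_on S (\<lambda>x. hmul (f x) (g x))"
  unfolding hmul_def by (intro continuous_intros)

lemma measurable_hmul [measurable (raw)]:
  assumes "f \<in> borel_measurable M" "g \<in> borel_measurable M"
  shows "(\<lambda>x. hmul (f x) (g x)) \<in> borel_measurable M"
proof -
  have "(\<lambda>x. (f x, g x)) \<in> borel_measurable M"
    using assms by (rule borel_measurable_Pair)
  moreover have "(\<lambda>p. hmul (fst p) (snd p)) \<in> borel_measurable borel"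
    by (intro borel_measurable_continuous_onI continuous_intros)
  ultimately show ?thesis
    using measurable_compose[of "\<lambda>x. (f x, g x)" M borel "\<lambda>p. hmul (fst p) (snd p)" borel] by simp
qed

text \<open>Fubini: translation in \<open>t\<close> for each \<open>z\<close>, then translation in \<open>z\<close>. Left and
  right translations of the group both have this form.\<close>

lemma nn_integral_shear:
  fixes s :: "complex \<Rightarrow> real"
  assumes [measurable]: "f \<in> borel_measurable borel" "s \<in> borel_measurable borel"
  shows "(\<integral>\<^sup>+p. f (c + fst p, s (fst p) + snd p) \<partial>lborel) = (\<integral>\<^sup>+p. f p \<partial>(lborel :: heis measure))"
proof -
  have shift: "(\<integral>\<^sup>+x. h (b + x) \<partial>lborel) = (\<integral>\<^sup>+x. h x \<partial>lborel)"
    if "h \<in> borel_measurable borel" for h :: "'a::euclidean_space \<Rightarrow> ennreal" and b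
    using nn_integral_distr[of "(+) b" lborel borel h] that by (simp add: lborel_distr_plus)
  have [measurable]: "f \<in> borel_measurable (borel \<Otimes>\<^sub>M borel)" by (simp add: borel_prod)
  have [measurable]: "f \<in> borel_measurable (lborel \<Otimes>\<^sub>M lborel)" by (simp add: lborel_prod)
  have "(\<integral>\<^sup>+p. f (c + fst p, s (fst p) + snd p) \<partial>(lborel \<Otimes>\<^sub>M lborel))
      = (\<integral>\<^sup>+z. \<integral>\<^sup>+t. f (c + z, s z + t) \<partial>lborel \<partial>lborel)"
    by (subst lborel.nn_integral_fst[symmetric]) auto
  also have "\<dots> = (\<integral>\<^sup>+z. \<integral>\<^sup>+t. f (c + z, t) \<partial>lborel \<partial>lborel)"
    by (subst shift) auto
  also have "\<dots> = (\<integral>\<^sup>+z. \<integral>\<^sup>+t. f (z, t) \<partial>lborel \<partial>lborel)"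
    by (rule shift[of "\<lambda>z. \<integral>\<^sup>+t. f (z, t) \<partial>lborel"]) measurable
  also have "\<dots> = (\<integral>\<^sup>+p. f p \<partial>(lborel \<Otimes>\<^sub>M lborel))"
    by (rule lborel.nn_integral_fst) auto
  finally show ?thesis by (simp add: lborel_prod)
qed

lemma distr_lborel_eqI:
  fixes \<phi> :: "heis \<Rightarrow> heis"
  assumes m: "\<phi> \<in> borel_measurable borel"
    and "\<And>f. f \<in> borel_measurable borel \<Longrightarrow> (\<integral>\<^sup>+p. f (\<phi> p) \<partial>lborel) = (\<integral>\<^sup>+p. f p \<partial>lborel)"
  shows "distr lborel borel \<phi> = lborel"
proof (rule measure_eqI)
  fix A assume "A \<in> sets (distr lborel borel \<phi>)"
  then have A: "A \<in> sets borel" by simp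
  have "emeasure (distr lborel borel \<phi>) A = (\<integral>\<^sup>+p. indicator A p \<partial>distr lborel borel \<phi>)"
    using A by simp
  also have "\<dots> = (\<integral>\<^sup>+p. indicator A (\<phi> p) \<partial>lborel)"
    using A m by (subst nn_integral_distr) auto
  also have "\<dots> = (\<integral>\<^sup>+p. indicator A p \<partial>lborel)"
    using A by (intro assms) auto
  finally show "emeasure (distr lborel borel \<phi>) A = emeasure lborel A"
    using A by simp
qed simp

lemma distr_hmul_left: "distr lborel borel (hmul a) = lborel"
proof (rule distr_lborel_eqI)
  fix f :: "heis \<Rightarrow> ennreal" assume f: "f \<in> borel_measurable borel"
  have "(\<lambda>z. snd a + 2 * Im (fst a * cnj z)) \<in> borel_measurable borel"
    by (intro borel_measurable_continuous_onI continuous_intros)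
  from nn_integral_shear[OF f this, of "fst a"]
  show "(\<integral>\<^sup>+p. f (hmul a p) \<partial>lborel) = (\<integral>\<^sup>+p. f p \<partial>lborel)"
    by (simp add: hmul_def add_ac)
qed measurable

lemma distr_hmul_right: "distr lborel borel (\<lambda>p. hmul p a) = lborel"
proof (rule distr_lborel_eqI)
  fix f :: "heis \<Rightarrow> ennreal" assume f: "f \<in> borel_measurable borel"
  have "(\<lambda>z. snd a + 2 * Im (z * cnj (fst a))) \<in> borel_measurable borel"
    by (intro borel_measurable_continuous_onI continuous_intros)
  from nn_integral_shear[OF f this, of "fst a"]
  show "(\<integral>\<^sup>+p. f (hmul p a) \<partial>lborel) = (\<integral>\<^sup>+p. f p \<partial>lborel)"
    by (simp add: hmul_def add_ac)
qed measurable

lemma distr_uminus: "distr lborel borel uminus = (lborel :: heis measure)"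
  using lborel_affine[of "-1" "0 :: heis"] by (simp add: density_1)

lemma distr_inverse_hmul: "distr lborel borel (\<lambda>p. hmul (- p) a) = lborel"
proof -
  have "distr lborel borel (\<lambda>p. hmul (- p) a) = distr (distr lborel borel uminus) borel (\<lambda>p. hmul p a)"
    by (subst distr_distr) (auto simp: comp_def)
  then show ?thesis by (simp add: distr_uminus distr_hmul_right)
qed

lemma nn_integral_preserve:
  fixes \<phi> :: "heis \<Rightarrow> heis"
  assumes "distr lborel borel \<phi> = lborel" "f \<in> borel_measurable borel" "\<phi> \<in> borel_measurable borel"
  shows "(\<integral>\<^sup>+p. f (\<phi> p) \<partial>lborel) = (\<integral>\<^sup>+p. f p \<partial>lborel)"
  using nn_integral_distr[of \<phi> "lborel :: heis measure" borel f] assms by simp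

lemma integral_preserve:
  fixes f :: "heis \<Rightarrow> complex" and \<phi> :: "heis \<Rightarrow> heis"
  assumes "distr lborel borel \<phi> = lborel" "f \<in> borel_measurable borel" "\<phi> \<in> borel_measurable borel"
  shows "(\<integral>p. f (\<phi> p) \<partial>lborel) = (\<integral>p. f p \<partial>lborel)"
    "integrable lborel (\<lambda>p. f (\<phi> p)) \<longleftrightarrow> integrable lborel f"
  using integral_distr[of \<phi> "lborel :: heis measure" borel f]
    integrable_distr_eq[of \<phi> "lborel :: heis measure" borel f] assms by simp_all

section \<open>A homogeneous gauge\<close>

text \<open>Comparable to the Koranyi gauge \<open>(\<bar>z\<bar>\<^sup>4 + t\<^sup>2)\<^sup>1\<^sup>/\<^sup>4\<close>. With maxima the balls are boxes, whose
  measure is explicit.\<close>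

definition hgauge :: "heis \<Rightarrow> real" where
  "hgauge p = max (max \<bar>Re (fst p)\<bar> \<bar>Im (fst p)\<bar>) (sqrt \<bar>snd p\<bar>)"

lemma hgauge_nonneg: "0 \<le> hgauge p"
  by (simp add: hgauge_def le_max_iff_disj)

lemma continuous_on_hgauge [continuous_intros]: "continuous_on UNIV hgauge"
  unfolding hgauge_def by (intro continuous_intros)

lemma measurable_hgauge [measurable]: "hgauge \<in> borel_measurable borel"
  by (intro borel_measurable_continuous_onI continuous_intros)

definition hbox :: "real \<Rightarrow> heis set" where "hbox r = {p. hgauge p \<le> r}"

lemma hbox_sets [measurable]: "hbox r \<in> sets borel" unfolding hbox_def by measurable

lemma hbox_eq:
  assumes "0 \<le> r" shows "hbox r = cbox (Complex (-r) (-r), - r\<^sup>2) (Complex r r, r\<^sup>2)"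
proof -
  have *: "sqrt \<bar>t\<bar> \<le> r \<longleftrightarrow> \<bar>t\<bar> \<le> r\<^sup>2" for t
    using assms by (metis abs_ge_zero real_sqrt_le_iff real_sqrt_unique)
  show ?thesis
    using assms by (auto simp: hbox_def hgauge_def * cbox_Pair_eq in_cbox_complex_iff abs_le_iff)
qed

text \<open>The exponent is the homogeneous dimension.\<close>

lemma emeasure_hbox:
  assumes "0 \<le> r" shows "emeasure lborel (hbox r) = ennreal (8 * r ^ 4)"
proof -
  have "emeasure (lborel :: complex measure) (cbox (Complex (-r) (-r)) (Complex r r)) = ennreal (4 * r\<^sup>2)"
    using assms by (subst emeasure_lborel_cbox) (auto simp: Basis_complex_def power2_eq_square)
  moreover have "emeasure lborel (cbox (- r\<^sup>2) (r\<^sup>2)) = ennreal (2 * r\<^sup>2)"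
    using assms by simp
  ultimately have "emeasure (lborel \<Otimes>\<^sub>M lborel) (cbox (Complex (-r) (-r)) (Complex r r) \<times> cbox (- r\<^sup>2) (r\<^sup>2))
      = ennreal (4 * r\<^sup>2) * ennreal (2 * r\<^sup>2)"
    by (subst lborel.emeasure_pair_measure_Times) auto
  then show ?thesis
    using assms by (simp add: hbox_eq cbox_Pair_eq lborel_prod ennreal_mult'[symmetric] power2_eq_square power4_eq_xxxx mult_ac)
qed

lemma dyadic_bracket:
  fixes x :: real assumes "1 \<le> x" shows "\<exists>j. 2 ^ j \<le> x \<and> x < 2 ^ Suc j"
proof -
  have ex: "\<exists>n. x < 2 ^ n" by (rule real_arch_pow) simp
  define n where "n = (LEAST n. x < 2 ^ n)"
  have n: "x < 2 ^ n" unfolding n_def using ex by (rule LeastI_ex)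
  then obtain j where j: "n = Suc j" using assms by (cases n) auto
  have "\<not> x < 2 ^ j" using not_less_Least[of j "\<lambda>n. x < 2 ^ n"] j by (auto simp: n_def)
  with n j show ?thesis by (intro exI[of _ j]) (simp only: not_less)
qed

text \<open>Estimates an integral of a function of the gauge by comparing it with a constant on each
  dyadic shell; the measure of a shell is bounded by that of the box around it.\<close>

lemma nn_integral_dyadic:
  assumes g: "\<And>p. ennreal (g p) \<le> (\<Sum>j. ennreal (c j) * indicator (hbox (r j)) p)"
    and c: "\<And>j. 0 \<le> c j" and r: "\<And>j. 0 \<le> r j" and s: "(\<lambda>j. c j * (8 * r j ^ 4)) sums s"
  shows "(\<integral>\<^sup>+p. ennreal (g p) \<partial>lborel) \<le> ennreal s"
proof -
  have "(\<integral>\<^sup>+p. ennreal (g p) \<partial>lborel) \<le> (\<integral>\<^sup>+p. (\<Sum>j. ennreal (c j) * indicator (hbox (r j)) p) \<partial>lborel)"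
    by (intro nn_integral_mono g)
  also have "\<dots> = (\<Sum>j. \<integral>\<^sup>+p. ennreal (c j) * indicator (hbox (r j)) p \<partial>lborel)"
    by (intro nn_integral_suminf) measurable
  also have "\<dots> = (\<Sum>j. ennreal (c j * (8 * r j ^ 4)))"
    using c r by (simp add: nn_integral_cmult_indicator emeasure_hbox ennreal_mult)
  also have "\<dots> = ennreal s"
    using s c r by (intro suminf_ennreal_eq) auto
  finally show ?thesis .
qed

lemma suminf_indicator_ge:
  assumes "p \<in> hbox (r j)" "x \<le> c j"
  shows "ennreal x \<le> (\<Sum>j. ennreal (c j) * indicator (hbox (r j)) p)"
proof -
  have "ennreal x \<le> ennreal (c j) * indicator (hbox (r j)) p"
    using assms by (simp add: ennreal_leI)
  also have "\<dots> = (\<Sum>i\<in>{j}. ennreal (c i) * indicator (hbox (r i)) p)"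
    by (simp only: sum.insert finite.emptyI empty_iff not_False_eq_True sum.empty add_0_right)
  also have "\<dots> \<le> (\<Sum>j. ennreal (c j) * indicator (hbox (r j)) p)"
    by (rule sum_le_suminf) auto
  finally show ?thesis .
qed

lemma nn_integral_gauge_near:
  assumes r: "0 < r"
  shows "(\<integral>\<^sup>+p. ennreal (if hgauge p < r then inverse (hgauge p) ^ 3 else 0) \<partial>lborel) \<le> ennreal (128 * r)"
proof (rule nn_integral_dyadic)
  define c R where "c j = (2 ^ Suc j / r) ^ 3" and "R j = r / 2 ^ j" for j
  show "0 \<le> c j" "0 \<le> R j" for j using r by (auto simp: c_def R_def)
  show "ennreal (if hgauge p < r then inverse (hgauge p) ^ 3 else 0)
      \<le> (\<Sum>j. ennreal (c j) * indicator (hbox (R j)) p)" for p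
  proof (cases "0 < hgauge p \<and> hgauge p < r")
    case True
    then have "1 \<le> r / hgauge p" by simp
    from dyadic_bracket[OF this] obtain j where j: "2 ^ j \<le> r / hgauge p" "r / hgauge p < 2 ^ Suc j" by blast
    have "p \<in> hbox (R j)" using j(1) True by (simp add: hbox_def R_def field_simps)
    moreover have "inverse (hgauge p) ^ 3 \<le> c j"
      unfolding c_def using j(2) True r by (intro power_mono) (auto simp: field_simps)
    ultimately show ?thesis using True by (auto intro!: suminf_indicator_ge)
  next
    case False
    then show ?thesis using hgauge_nonneg[of p] by (auto simp: not_less)
  qed
  have "(\<lambda>j. 64 * r * (1/2) ^ j) sums (64 * r * (1 / (1 - 1/2)))"
    by (intro sums_mult geometric_sums) simp
  moreover have "c j * (8 * R j ^ 4) = 64 * r * (1/2) ^ j" for j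
  proof -
    have "(2::real) ^ j * 2 ^ j * 2 ^ j * (2 ^ j)  = (2 ^ j) ^ 4" by (simp add: power4_eq_xxxx)
    then show ?thesis using r
      by (simp add: c_def R_def power3_eq_cube power4_eq_xxxx field_simps)
  qed
  ultimately show "(\<lambda>j. c j * (8 * R j ^ 4)) sums (128 * r)" by (simp only:) simp
qed

lemma nn_integral_gauge_far:
  assumes r: "0 < r"
  shows "(\<integral>\<^sup>+p. ennreal (if hgauge p < r then 0 else inverse (hgauge p) ^ 6) \<partial>lborel) \<le> ennreal (512 / (3 * r\<^sup>2))"
proof (rule nn_integral_dyadic)
  define c R where "c j = inverse (r * 2 ^ j) ^ 6" and "R j = r * 2 ^ Suc j" for j
  show "0 \<le> c j" "0 \<le> R j" for j using r by (auto simp: c_def R_def)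
  show "ennreal (if hgauge p < r then 0 else inverse (hgauge p) ^ 6)
      \<le> (\<Sum>j. ennreal (c j) * indicator (hbox (R j)) p)" for p
  proof (cases "hgauge p < r")
    case False
    then have "1 \<le> hgauge p / r" using r by simp
    from dyadic_bracket[OF this] obtain j where j: "2 ^ j \<le> hgauge p / r" "hgauge p / r < 2 ^ Suc j" by blast
    have "p \<in> hbox (R j)" using j(2) r by (simp add: hbox_def R_def field_simps)
    moreover have "inverse (hgauge p) ^ 6 \<le> c j"
      unfolding c_def using j(1) r False by (intro power_mono le_imp_inverse_le) (auto simp: field_simps)
    ultimately show ?thesis using False by (auto intro!: suminf_indicator_ge)
  qed auto
  have "(\<lambda>j. 128 / r\<^sup>2 * (1/4) ^ j) sums (128 / r\<^sup>2 * (1 / (1 - 1/4)))"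
    by (intro sums_mult geometric_sums) simp
  moreover have "c j * (8 * R j ^ 4) = 128 / r\<^sup>2 * (1/4) ^ j" for j
  proof -
    have 1: "c j = inverse (r ^ 6 * (2 ^ j) ^ 6)" "R j ^ 4 = 16 * r ^ 4 * (2 ^ j) ^ 4"
      by (auto simp: c_def R_def power_mult_distrib power_inverse)
    have 2: "(1/4) ^ j = inverse ((2 ^ j)\<^sup>2 :: real)"
    proof -
      have "(4::real) ^ j = (2 ^ j)\<^sup>2" by (simp add: power2_eq_square flip: power_mult_distrib)
      then show ?thesis by (simp add: power_one_over inverse_eq_divide)
    qed
    show ?thesis unfolding 1 2 using r by (simp add: field_simps flip: power_add)
  qed
  ultimately show "(\<lambda>j. c j * (8 * R j ^ 4)) sums (512 / (3 * r\<^sup>2))" by (simp only:) (simp add: mult.commute)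
qed

section \<open>Fractional integration\<close>

text \<open>The two regimes of a convolution with \<open>\<rho>\<^sup>-\<^sup>3\<close> at height \<open>m\<close>: within distance \<open>1/m\<close> the kernel itself
  is integrable, beyond it the square of the kernel is. The powers of \<open>m\<close> make the integral a
  multiple of \<open>m\<^sup>4\<close>.\<close>

definition near_far :: "real \<Rightarrow> real \<Rightarrow> real" where
  "near_far m \<rho> = (if m * \<rho> < 1 then m ^ 5 * inverse \<rho> ^ 3 else m\<^sup>2 * inverse \<rho> ^ 6)"

lemma near_far_nonneg: "0 \<le> m \<Longrightarrow> 0 \<le> \<rho> \<Longrightarrow> 0 \<le> near_far m \<rho>"
  by (simp add: near_far_def)

lemma measurable_near_far [measurable]:
  assumes [measurable]: "f \<in> borel_measurable M" "g \<in> borel_measurable M"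
  shows "(\<lambda>x. near_far (f x) (g x)) \<in> borel_measurable M"
  unfolding near_far_def by measurable

text \<open>Replaces Holder's inequality in the proof of the Hardy-Littlewood-Sobolev inequality. Let
  \<open>m = max a b\<close>. Close to the diagonal \<open>a\<^sup>2 b\<^sup>3\<close> is at most \<open>m\<^sup>5\<close>; far from it the arithmetic-geometric
  mean inequality separates the kernel from \<open>a\<^sup>4 b\<^sup>4\<close>. The three terms on the right can each be integrated
  over both variables.\<close>

lemma kernel_split:
  fixes a b \<rho> :: real
  assumes "0 \<le> a" "0 \<le> b" "0 \<le> \<rho>"
  shows "a\<^sup>2 * b ^ 3 * inverse \<rho> ^ 3 \<le> a ^ 4 * b ^ 4 + near_far a \<rho> + near_far b \<rho>"
proof -
  define s where "s = inverse \<rho>"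
  have s: "0 \<le> s" using assms by (simp add: s_def)
  define m where "m = max a b"
  have m: "0 \<le> m" "a \<le> m" "b \<le> m" using assms by (auto simp: m_def)
  have "a\<^sup>2 * b ^ 3 * s ^ 3 \<le> a ^ 4 * b ^ 4 + near_far m \<rho>"
  proof (cases "m * \<rho> < 1")
    case True
    have "a\<^sup>2 * b ^ 3 \<le> m\<^sup>2 * m ^ 3"
      using assms m by (intro mult_mono power_mono) auto
    also have "\<dots> = m ^ 5" by (simp flip: power_add)
    finally have "a\<^sup>2 * b ^ 3 * s ^ 3 \<le> m ^ 5 * s ^ 3" using s by (intro mult_right_mono) auto
    moreover have "0 \<le> a ^ 4 * b ^ 4" by simp
    ultimately have "a\<^sup>2 * b ^ 3 * s ^ 3 \<le> a ^ 4 * b ^ 4 + m ^ 5 * s ^ 3" by linarith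
    then show ?thesis using True by (simp add: near_far_def s_def)
  next
    case False
    \<comment> \<open>Arithmetic-geometric mean: the cross term of this square is twice the quantity to be bounded.\<close>
    have "0 \<le> (a\<^sup>2 * b\<^sup>2 - b * s ^ 3)\<^sup>2" by simp
    also have "\<dots> = a ^ 4 * b ^ 4 + b\<^sup>2 * s ^ 6 - 2 * (a\<^sup>2 * b ^ 3 * s ^ 3)"
      by (simp add: power2_eq_square power3_eq_cube eval_nat_numeral algebra_simps)
    finally have "2 * (a\<^sup>2 * b ^ 3 * s ^ 3) \<le> a ^ 4 * b ^ 4 + b\<^sup>2 * s ^ 6" by simp
    moreover have "0 \<le> a\<^sup>2 * b ^ 3 * s ^ 3" using assms s by simp
    moreover have "b\<^sup>2 * s ^ 6 \<le> m\<^sup>2 * s ^ 6" using assms m s by (intro mult_right_mono power_mono) auto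
    ultimately have "a\<^sup>2 * b ^ 3 * s ^ 3 \<le> a ^ 4 * b ^ 4 + m\<^sup>2 * s ^ 6" by linarith
    then show ?thesis using False by (simp add: near_far_def s_def)
  qed
  moreover have "near_far m \<rho> \<le> near_far a \<rho> + near_far b \<rho>"
    using near_far_nonneg[of a \<rho>] near_far_nonneg[of b \<rho>] assms by (auto simp: m_def max_def)
  ultimately show ?thesis by (simp add: s_def)
qed

lemma nn_integral_near_far:
  assumes "0 \<le> m"
  shows "(\<integral>\<^sup>+p. ennreal (near_far m (hgauge p)) \<partial>lborel) \<le> ennreal (384 * m ^ 4)"
proof (cases "m = 0")
  case False
  with assms have m: "0 < m" by simp
  let ?N = "\<lambda>p. ennreal (if hgauge p < 1 / m then inverse (hgauge p) ^ 3 else 0)"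
  let ?F = "\<lambda>p. ennreal (if hgauge p < 1 / m then 0 else inverse (hgauge p) ^ 6)"
  have "ennreal (near_far m (hgauge p)) = ennreal (m ^ 5) * ?N p + ennreal (m\<^sup>2) * ?F p" for p
    using m hgauge_nonneg[of p] by (auto simp: near_far_def field_simps simp flip: ennreal_mult)
  then have "(\<integral>\<^sup>+p. ennreal (near_far m (hgauge p)) \<partial>lborel)
      = ennreal (m ^ 5) * (\<integral>\<^sup>+p. ?N p \<partial>lborel) + ennreal (m\<^sup>2) * (\<integral>\<^sup>+p. ?F p \<partial>lborel)"
    by (simp add: nn_integral_add nn_integral_cmult)
  also have "\<dots> \<le> ennreal (m ^ 5) * ennreal (128 * (1 / m)) + ennreal (m\<^sup>2) * ennreal (512 / (3 * (1 / m)\<^sup>2))"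
    using m by (intro add_mono mult_left_mono nn_integral_gauge_near nn_integral_gauge_far) auto
  also have "\<dots> = ennreal (m ^ 5 * (128 * (1 / m)) + m\<^sup>2 * (512 / (3 * (1 / m)\<^sup>2)))"
    using m by (subst ennreal_plus, simp, simp, subst (1 2) ennreal_mult) auto
  also have "m ^ 5 * (128 * (1 / m)) + m\<^sup>2 * (512 / (3 * (1 / m)\<^sup>2)) = (128 + 512 / 3) * m ^ 4"
    using m by (simp add: field_simps eval_nat_numeral)
  also have "ennreal \<dots> \<le> ennreal (384 * m ^ 4)" by (intro ennreal_leI mult_right_mono) auto
  finally show ?thesis .
qed (simp add: near_far_def)

text \<open>\<open>kernel_split\<close> at \<open>a = sqrt (g y)\<close>, integrated: the near-far term of \<open>a\<close> is integrated over \<open>x\<close>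
  first, that of \<open>b\<close> over \<open>y\<close> first.\<close>

lemma fractional_bilinear:
  fixes g b :: "heis \<Rightarrow> real"
  assumes [measurable]: "g \<in> borel_measurable borel" "b \<in> borel_measurable borel"
    and nn: "\<And>p. 0 \<le> g p" "\<And>p. 0 \<le> b p"
  defines "A \<equiv> \<integral>\<^sup>+p. ennreal (g p ^ 2) \<partial>lborel" and "J \<equiv> \<integral>\<^sup>+p. ennreal (b p ^ 4) \<partial>lborel"
  shows "(\<integral>\<^sup>+x. \<integral>\<^sup>+y. ennreal (g y * b x ^ 3 * inverse (hgauge (hmul (- y) x)) ^ 3) \<partial>lborel \<partial>lborel)
    \<le> A * J + 384 * A + 384 * J"
proof -
  let ?\<Phi>1 = "\<lambda>x y. ennreal (near_far (sqrt (g y)) (hgauge (hmul (- y) x)))"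
  let ?\<Phi>2 = "\<lambda>x y. ennreal (near_far (b x) (hgauge (hmul (- y) x)))"
  have 4: "sqrt (g y) ^ 4 = (g y)\<^sup>2" for y
    using nn(1)[of y] power_mult[of "sqrt (g y)" 2 2] by simp
  have "(\<integral>\<^sup>+x. \<integral>\<^sup>+y. ennreal (g y * b x ^ 3 * inverse (hgauge (hmul (- y) x)) ^ 3) \<partial>lborel \<partial>lborel)
    \<le> (\<integral>\<^sup>+x. \<integral>\<^sup>+y. (ennreal (b x ^ 4) * ennreal (g y ^ 2) + ?\<Phi>1 x y) + ?\<Phi>2 x y \<partial>lborel \<partial>lborel)"
  proof (intro nn_integral_mono)
    fix x y
    have "g y * b x ^ 3 * inverse (hgauge (hmul (- y) x)) ^ 3 \<le> b x ^ 4 * g y ^ 2 +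
        near_far (sqrt (g y)) (hgauge (hmul (- y) x)) + near_far (b x) (hgauge (hmul (- y) x))"
      using kernel_split[of "sqrt (g y)" "b x" "hgauge (hmul (- y) x)"] nn
      by (simp add: 4 hgauge_nonneg mult.commute)
    then show "ennreal (g y * b x ^ 3 * inverse (hgauge (hmul (- y) x)) ^ 3)
      \<le> (ennreal (b x ^ 4) * ennreal (g y ^ 2) + ?\<Phi>1 x y) + ?\<Phi>2 x y"
      using nn by (simp add: near_far_nonneg hgauge_nonneg flip: ennreal_mult ennreal_plus)
  qed
  also have "\<dots> = (\<integral>\<^sup>+x. \<integral>\<^sup>+y. ennreal (b x ^ 4) * ennreal (g y ^ 2) \<partial>lborel \<partial>lborel)
      + (\<integral>\<^sup>+x. \<integral>\<^sup>+y. ?\<Phi>1 x y \<partial>lborel \<partial>lborel) + (\<integral>\<^sup>+x. \<integral>\<^sup>+y. ?\<Phi>2 x y \<partial>lborel \<partial>lborel)"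
    by (simp add: nn_integral_add)
  also have "(\<integral>\<^sup>+x. \<integral>\<^sup>+y. ennreal (b x ^ 4) * ennreal (g y ^ 2) \<partial>lborel \<partial>lborel) = A * J"
    by (simp add: nn_integral_cmult nn_integral_multc A_def J_def mult.commute)
  also have "(\<integral>\<^sup>+x. \<integral>\<^sup>+y. ?\<Phi>1 x y \<partial>lborel \<partial>lborel) = (\<integral>\<^sup>+y. \<integral>\<^sup>+x. ?\<Phi>1 x y \<partial>lborel \<partial>lborel)"
    by (rule lborel_pair.Fubini') measurable
  also have "(\<integral>\<^sup>+x. ?\<Phi>1 x y \<partial>lborel) \<le> 384 * ennreal (g y ^ 2)" for y
  proof -
    have "(\<integral>\<^sup>+x. ?\<Phi>1 x y \<partial>lborel) = (\<integral>\<^sup>+x. ennreal (near_far (sqrt (g y)) (hgauge x)) \<partial>lborel)"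
      by (rule nn_integral_preserve[OF distr_hmul_left, where f="\<lambda>x. ennreal (near_far (sqrt (g y)) (hgauge x))"]) measurable
    also have "\<dots> \<le> ennreal (384 * sqrt (g y) ^ 4)" by (rule nn_integral_near_far) (simp add: nn)
    finally show ?thesis using nn(1)[of y] by (simp add: 4 ennreal_mult)
  qed
  then have "(\<integral>\<^sup>+y. \<integral>\<^sup>+x. ?\<Phi>1 x y \<partial>lborel \<partial>lborel) \<le> 384 * A"
    unfolding A_def by (subst nn_integral_cmult[symmetric]) (auto intro!: nn_integral_mono)
  moreover have "(\<integral>\<^sup>+y. ?\<Phi>2 x y \<partial>lborel) \<le> 384 * ennreal (b x ^ 4)" for x
  proof -
    have "(\<integral>\<^sup>+y. ?\<Phi>2 x y \<partial>lborel) = (\<integral>\<^sup>+y. ennreal (near_far (b x) (hgauge y)) \<partial>lborel)"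
      by (rule nn_integral_preserve[OF distr_inverse_hmul, where f="\<lambda>y. ennreal (near_far (b x) (hgauge y))"]) measurable
    also have "\<dots> \<le> ennreal (384 * b x ^ 4)" by (rule nn_integral_near_far) (simp add: nn)
    finally show ?thesis using nn(2)[of x] by (simp add: ennreal_mult)
  qed
  then have "(\<integral>\<^sup>+x. \<integral>\<^sup>+y. ?\<Phi>2 x y \<partial>lborel \<partial>lborel) \<le> 384 * J"
    unfolding J_def by (subst nn_integral_cmult[symmetric]) (auto intro!: nn_integral_mono)
  ultimately show ?thesis by (meson add_mono order_refl order_trans)
qed

definition riesz_potential :: "(heis \<Rightarrow> complex) \<Rightarrow> heis \<Rightarrow> ennreal" where
  "riesz_potential g x = (\<integral>\<^sup>+y. ennreal (norm (g y) * inverse (hgauge (hmul (- y) x)) ^ 3) \<partial>lborel)"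

lemma measurable_riesz_potential [measurable]:
  assumes [measurable]: "g \<in> borel_measurable borel"
  shows "riesz_potential g \<in> borel_measurable borel"
  unfolding riesz_potential_def by measurable

text \<open>Duality: the bilinear bound is applied with \<open>b\<close> a multiple of the potential itself, truncated in
  height and to a box so that \<open>J\<close>, the integral of its fourth power, is finite. In the
  multiplier the left-hand side is cubic and the terms containing \<open>J\<close> on the right are quartic; for a
  small multiplier the former absorbs the latter. Monotone convergence removes the truncation.\<close>

lemma riesz_potential_normalized:
  assumes [measurable]: "g \<in> borel_measurable borel"
    and A: "(\<integral>\<^sup>+p. ennreal (norm (g p) ^ 2) \<partial>lborel) \<le> 1"
  shows "(\<integral>\<^sup>+x. riesz_potential g x ^ 4 \<partial>lborel) \<le> 768 * 770 ^ 3"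
proof -
  define B where "B n x = indicator (hbox (real n)) x * min (riesz_potential g x) (of_nat n)" for n x
  have B_fin: "B n x < top" for n x
    by (auto simp: B_def indicator_def min_def ennreal_of_nat_eq_real_of_nat split: if_splits intro: le_less_trans)
  have [measurable]: "B n \<in> borel_measurable borel" for n
    unfolding B_def by measurable
  have J_le: "(\<integral>\<^sup>+x. B n x ^ 4 \<partial>lborel) \<le> 768 * 770 ^ 3" for n
  proof -
    define J where "J = (\<integral>\<^sup>+x. B n x ^ 4 \<partial>lborel)"
    have "J \<le> (\<integral>\<^sup>+x. of_nat n ^ 4 * indicator (hbox (real n)) x \<partial>lborel)"
      unfolding J_def by (intro nn_integral_mono) (auto simp: B_def indicator_def intro!: power_mono)
    also have "\<dots> < top"
      by (simp add: nn_integral_cmult_indicator emeasure_hbox ennreal_of_nat_eq_real_of_nat ennreal_mult_less_top ennreal_power)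
    finally have J_fin: "J < top" .
    \<comment> \<open>The divisor is twice the coefficient \<open>1 + 384\<close> that \<open>X\<close> acquires on the right.\<close>
    define b where "b x = enn2real (B n x) / 770" for x
    have [measurable]: "b \<in> borel_measurable borel" unfolding b_def by measurable
    have b_nn: "0 \<le> b x" for x by (simp add: b_def)
    have b: "B n x = ennreal (770 * b x)" for x
      using B_fin[of n x] by (simp add: b_def)
    define X where "X = (\<integral>\<^sup>+x. ennreal (b x ^ 4) \<partial>lborel)"
    have JX: "J = ennreal (770 ^ 4) * X"
      unfolding J_def X_def
      by (simp add: b b_nn ennreal_power power_mult_distrib ennreal_mult nn_integral_cmult)
    obtain x where x: "X = ennreal x" "0 \<le> x" "J = ennreal (770 ^ 4 * x)"
    proof (cases X rule: ennreal_cases)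
      case (real x) then show ?thesis using that[of x] JX by (simp add: ennreal_mult)
    next
      case top then show ?thesis using JX J_fin by (simp add: ennreal_mult_eq_top_iff)
    qed
    have "ennreal (770 * x) = (\<integral>\<^sup>+x. B n x * ennreal (b x ^ 3) \<partial>lborel)"
    proof -
      have "B n x * ennreal (b x ^ 3) = ennreal 770 * ennreal (b x ^ 4)" for x
      proof -
        have "B n x * ennreal (b x ^ 3) = ennreal (770 * b x * b x ^ 3)"
          using b_nn[of x] by (simp only: b) (simp flip: ennreal_mult)
        also have "770 * b x * b x ^ 3 = 770 * b x ^ 4" by (simp add: eval_nat_numeral)
        finally show ?thesis using b_nn[of x] by (simp only: ennreal_mult zero_le_power zero_le_numeral)
      qed
      then show ?thesis using x by (simp add: nn_integral_cmult ennreal_mult flip: X_def)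
    qed
    also have "\<dots> \<le> (\<integral>\<^sup>+x. riesz_potential g x * ennreal (b x ^ 3) \<partial>lborel)"
      by (intro nn_integral_mono mult_right_mono) (auto simp: B_def indicator_def)
    also have "\<dots> = (\<integral>\<^sup>+x. \<integral>\<^sup>+y. ennreal (norm (g y) * b x ^ 3 * inverse (hgauge (hmul (- y) x)) ^ 3) \<partial>lborel \<partial>lborel)"
      unfolding riesz_potential_def
      by (subst nn_integral_multc[symmetric])
        (auto intro!: nn_integral_cong simp: b_nn hgauge_nonneg mult_ac simp flip: ennreal_mult)
    also have "\<dots> \<le> (\<integral>\<^sup>+p. ennreal (norm (g p) ^ 2) \<partial>lborel) * X
        + 384 * (\<integral>\<^sup>+p. ennreal (norm (g p) ^ 2) \<partial>lborel) + 384 * X"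
      unfolding X_def by (intro fractional_bilinear) (auto simp: b_nn)
    also have "\<dots> \<le> 1 * X + 384 * 1 + 384 * X"
      by (intro add_mono mult_right_mono mult_left_mono A) auto
    also have "\<dots> = 385 * X + 384"
      using distrib_right[of 1 384 X] by (simp add: add_ac)
    also have "\<dots> = ennreal (385 * x + 384)"
      using x by (simp add: ennreal_plus ennreal_mult)
    finally have "770 * x \<le> 385 * x + 384"
      using x by (subst (asm) ennreal_le_iff) auto
    then have "770 ^ 4 * x \<le> 768 * 770 ^ 3" by (simp add: field_simps)
    then have "J \<le> ennreal (768 * 770 ^ 3)" unfolding x by (intro ennreal_leI)
    then show ?thesis unfolding J_def by simp
  qed
  have mono_B: "B m x \<le> B n x" if "m \<le> n" for m n x
    unfolding B_def using that
    by (intro mult_mono min.mono of_nat_mono) (auto simp: indicator_def hbox_def)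
  have "riesz_potential g x ^ 4 \<le> (SUP n. B n x ^ 4)" for x
  proof -
    obtain N :: nat where N: "hgauge x \<le> real N" "1 \<le> N"
      using real_arch_simple[of "max 1 (hgauge x)"] by auto
    then have B_eq: "B n x = min (riesz_potential g x) (of_nat n)" if "N \<le> n" for n
      using that by (auto simp: B_def indicator_def hbox_def)
    show ?thesis
    proof (cases "riesz_potential g x" rule: ennreal_cases)
      case (real r)
      obtain n :: nat where n: "r \<le> real n" "N \<le> n"
        using real_arch_simple[of "max (real N) r"] by auto
      then have "B n x = riesz_potential g x"
        using real by (simp add: B_eq ennreal_of_nat_eq_real_of_nat min_def)
      then show ?thesis by (metis SUP_upper UNIV_I)
    next
      case top
      have "of_nat n \<le> (SUP n. B n x ^ 4)" for n
      proof -
        have "(of_nat n :: ennreal) \<le> of_nat ((n + N) ^ 4)"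
        proof -
          have "n \<le> (n + N) ^ 1" by simp
          also have "\<dots> \<le> (n + N) ^ 4" using N by (intro power_increasing) auto
          finally show ?thesis by (simp only: of_nat_le_iff)
        qed
        also have "\<dots> = B (n + N) x ^ 4" using top by (simp add: B_eq)
        also have "\<dots> \<le> (SUP n. B n x ^ 4)" by (rule SUP_upper) simp
        finally show ?thesis .
      qed
      then have "(SUP n. of_nat n) \<le> (SUP n. B n x ^ 4)" by (rule SUP_least)
      then have "(SUP n. B n x ^ 4) = top" unfolding ennreal_SUP_of_nat_eq_top by (rule top_le)
      then show ?thesis by (simp only: top_greatest)
    qed
  qed
  then have "(\<integral>\<^sup>+x. riesz_potential g x ^ 4 \<partial>lborel) \<le> (\<integral>\<^sup>+x. (SUP n. B n x ^ 4) \<partial>lborel)"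
    by (intro nn_integral_mono)
  also have "\<dots> = (SUP n. \<integral>\<^sup>+x. B n x ^ 4 \<partial>lborel)"
    by (intro nn_integral_monotone_convergence_SUP)
      (auto simp: incseq_def le_fun_def intro!: power_mono mono_B)
  also have "\<dots> \<le> 768 * 770 ^ 3" by (intro SUP_least J_le)
  finally show ?thesis .
qed

lemma riesz_potential_L4:
  assumes [measurable]: "g \<in> borel_measurable borel"
    and e: "0 < e" and A: "(\<integral>\<^sup>+p. ennreal (norm (g p) ^ 2) \<partial>lborel) \<le> ennreal (e\<^sup>2)"
  shows "(\<integral>\<^sup>+x. riesz_potential g x ^ 4 \<partial>lborel) \<le> 768 * 770 ^ 3 * ennreal (e ^ 4)"
proof -
  \<comment> \<open>Both sides are homogeneous of degree 4 in \<open>g\<close>.\<close>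
  define h where "h p = g p / of_real e" for p
  have [measurable]: "h \<in> borel_measurable borel" unfolding h_def by measurable
  have gh: "norm (g p) = e * norm (h p)" for p using e by (simp add: h_def norm_divide)
  have "(\<integral>\<^sup>+p. ennreal (norm (g p) ^ 2) \<partial>lborel) = ennreal (e\<^sup>2) * (\<integral>\<^sup>+p. ennreal (norm (h p) ^ 2) \<partial>lborel)"
    using e by (simp add: gh power_mult_distrib ennreal_mult nn_integral_cmult)
  with A have "ennreal (e\<^sup>2) * (\<integral>\<^sup>+p. ennreal (norm (h p) ^ 2) \<partial>lborel) \<le> ennreal (e\<^sup>2) * 1" by simp
  then have "(\<integral>\<^sup>+p. ennreal (norm (h p) ^ 2) \<partial>lborel) \<le> 1"
    using e by (subst (asm) ennreal_mult_le_mult_iff) auto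
  then have *: "(\<integral>\<^sup>+x. riesz_potential h x ^ 4 \<partial>lborel) \<le> 768 * 770 ^ 3"
    by (intro riesz_potential_normalized) auto
  have "riesz_potential g x = ennreal e * riesz_potential h x" for x
    unfolding riesz_potential_def using e
    by (subst nn_integral_cmult[symmetric])
      (auto intro!: nn_integral_cong simp: gh mult_ac hgauge_nonneg simp flip: ennreal_mult)
  then have "(\<integral>\<^sup>+x. riesz_potential g x ^ 4 \<partial>lborel) = ennreal (e ^ 4) * (\<integral>\<^sup>+x. riesz_potential h x ^ 4 \<partial>lborel)"
    using e by (simp add: power_mult_distrib ennreal_power nn_integral_cmult)
  also have "\<dots> \<le> ennreal (e ^ 4) * (768 * 770 ^ 3)" by (intro mult_left_mono *) simp
  finally show ?thesis by (simp add: mult.commute)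
qed

section \<open>Smooth functions\<close>

lemma Ck_compose_affine:
  fixes F :: "'a::euclidean_space \<Rightarrow> 'c::real_normed_vector" and L :: "'b::euclidean_space \<Rightarrow> 'a"
  assumes L: "bounded_linear L"
  shows "Ck k F \<Longrightarrow> Ck k (\<lambda>x. F (c + L x))"
proof (induction k arbitrary: F)
  case 0
  have "continuous_on UNIV (\<lambda>x. c + L x)"
    using L by (intro continuous_intros linear_continuous_on)
  with 0 show ?case
    by (auto intro: continuous_on_compose2[where s=UNIV and t=UNIV and g=F])
next
  case (Suc k)
  have d: "((\<lambda>x. F (c + L x)) has_derivative (\<lambda>v. frechet_derivative F (at (c + L x)) (L v))) (at x)" for x
  proof -
    have "(F has_derivative frechet_derivative F (at (c + L x))) (at (c + L x))"
      using Suc.prems by (simp add: frechet_derivative_works[symmetric])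
    moreover have "((\<lambda>x. c + L x) has_derivative L) (at x)"
      using bounded_linear_imp_has_derivative[OF L] by (auto intro!: derivative_eq_intros)
    ultimately show ?thesis by (rule has_derivative_compose[rotated])
  qed
  show ?case using Suc.prems d by (auto simp: fd_eq[OF d] differentiable_def intro!: Suc.IH)
qed

lemma Ck_linear_compose:
  assumes L: "bounded_linear L"
  shows "Ck k F \<Longrightarrow> Ck k (\<lambda>x. L (F x))"
proof (induction k arbitrary: F)
  case 0 then show ?case
    using L by (auto intro: bounded_linear.continuous_on)
next
  case (Suc k)
  have d: "((\<lambda>x. L (F x)) has_derivative (\<lambda>v. L (frechet_derivative F (at x) v))) (at x)" for x
    using Suc.prems by (intro bounded_linear.has_derivative[OF L]) (simp add: frechet_derivative_works[symmetric])
  show ?case using Suc.prems d by (auto simp: fd_eq[OF d] differentiable_def intro!: Suc.IH)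
qed

lemma Ck_reciprocal:
  fixes f :: "'a::euclidean_space \<Rightarrow> complex"
  assumes nz: "\<And>x. f x \<noteq> 0"
  shows "Ck k f \<Longrightarrow> Ck k (\<lambda>x. inverse (f x))"
proof (induction k)
  case 0 then show ?case using nz by (auto intro!: continuous_intros)
next
  case (Suc k)
  have d: "((\<lambda>x. inverse (f x)) has_derivative
      (\<lambda>v. - 1 * (inverse (f x) * frechet_derivative f (at x) v * inverse (f x)))) (at x)" for x
    using Suc.prems nz by (auto intro!: has_derivative_inverse simp: frechet_derivative_works[symmetric])
  have "Ck k (\<lambda>x. inverse (f x))" by (rule Suc.IH[OF Ck_SucD[OF Suc.prems]])
  then have "Ck k (\<lambda>x. - 1 * (inverse (f x) * frechet_derivative f (at x) v * inverse (f x)))" for v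
    using Suc.prems by (intro Ck_mult Ck_const) auto
  then show ?case using d by (auto simp: fd_eq[OF d] differentiable_def simp del: mult_minus1)
qed

lemma smooth_compose_affine:
  fixes F :: "'a::euclidean_space \<Rightarrow> 'c::real_normed_vector" and L :: "'b::euclidean_space \<Rightarrow> 'a"
  shows "smooth F \<Longrightarrow> bounded_linear L \<Longrightarrow> smooth (\<lambda>x. F (c + L x))"
  by (simp add: smooth_def Ck_compose_affine)

lemma smooth_linear_compose: "smooth F \<Longrightarrow> bounded_linear M \<Longrightarrow> smooth (\<lambda>x. M (F x))"
  by (simp add: smooth_def Ck_linear_compose)

lemma smooth_inverse:
  fixes f :: "'a::euclidean_space \<Rightarrow> complex"
  shows "smooth f \<Longrightarrow> (\<And>x. f x \<noteq> 0) \<Longrightarrow> smooth (\<lambda>x. inverse (f x))"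
  by (simp add: smooth_def Ck_reciprocal)

lemma smooth_cmult: "smooth (f :: _ \<Rightarrow> complex) \<Longrightarrow> smooth (\<lambda>x. c * f x)"
  by (intro smooth_mult smooth_const)

lemma smooth_minus: "smooth (f :: _ \<Rightarrow> complex) \<Longrightarrow> smooth g \<Longrightarrow> smooth (\<lambda>x. f x - g x)"
  using smooth_add[of f "\<lambda>x. (- 1) * g x"] smooth_cmult[of g "-1"] by simp

lemma test_cmult: "f \<in> test_functions \<Longrightarrow> (\<lambda>x. c * f x :: complex) \<in> test_functions"
  by (intro test_mult1 smooth_const)

lemma smooth_measurable: "smooth f \<Longrightarrow> f \<in> borel_measurable borel"
  by (intro borel_measurable_continuous_onI smooth_cont)

lemma test_bounded:
  fixes f :: "'a::euclidean_space \<Rightarrow> 'b::real_normed_vector"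
  assumes "f \<in> test_functions" obtains B where "\<And>x. norm (f x) \<le> B" "0 \<le> B"
proof -
  have K: "compact (closure {x. f x \<noteq> 0})" and c: "continuous_on UNIV f"
    using assms smooth_cont by (auto simp: test_functions_def)
  have "bounded (f ` closure {x. f x \<noteq> 0})"
    using K c by (meson compact_continuous_image compact_imp_bounded continuous_on_subset subset_UNIV)
  then obtain B where "B > 0" "\<And>x. x \<in> closure {x. f x \<noteq> 0} \<Longrightarrow> norm (f x) \<le> B" by (auto simp: bounded_pos)
  then show ?thesis using that[of B] test_zero[OF assms] by (metis less_imp_le norm_zero)
qed

section \<open>Calculus of the operator Zbar\<close>

lemma Zbar_eq:
  "(f has_derivative D) (at p) \<Longrightarrow> Zbar f p = (D (1, 0) + \<i> * D (\<i>, 0)) / 2 - \<i> * fst p * D (0, 1)"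
  by (simp add: Zbar_def d_zbar_def d_x_def d_y_def d_t_def fd_eq)

lemma Zbar_smooth_eq:
  "smooth f \<Longrightarrow> Zbar f p = (frechet_derivative f (at p) (1, 0) + \<i> * frechet_derivative f (at p) (\<i>, 0)) / 2
     - \<i> * fst p * frechet_derivative f (at p) (0, 1)"
  by (rule Zbar_eq[OF smooth_diff])

lemma smooth_fst: "smooth (fst :: heis \<Rightarrow> complex)"
  by (intro smooth_linear bounded_linear_fst)

lemma Zbar_fun_eq: "Zbar f = (\<lambda>p. (1/2) * frechet_derivative f (at p) (1,0) + (\<i>/2) * frechet_derivative f (at p) (\<i>,0)
    + (- \<i> * fst p) * frechet_derivative f (at p) (0,1))"
  by (simp add: fun_eq_iff Zbar_def d_zbar_def d_x_def d_y_def d_t_def field_simps)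

lemma smooth_Zbar: "smooth f \<Longrightarrow> smooth (Zbar f)"
  unfolding Zbar_fun_eq by (intro smooth_add smooth_mult smooth_const smooth_deriv smooth_fst)

lemma test_Zbar: "f \<in> test_functions \<Longrightarrow> Zbar f \<in> test_functions"
  unfolding Zbar_fun_eq by (intro test_add test_mult1 smooth_mult smooth_const test_deriv smooth_fst)

lemma Zbar_mult:
  assumes "smooth f" "smooth g"
  shows "Zbar (\<lambda>p. f p * g p) p = f p * Zbar g p + Zbar f p * g p"
proof -
  have "((\<lambda>x. f x * g x) has_derivative
      (\<lambda>v. f p * frechet_derivative g (at p) v + frechet_derivative f (at p) v * g p)) (at p)"
    using assms by (intro has_derivative_mult smooth_diff)
  from Zbar_eq[OF this] show ?thesis
    using assms by (simp add: Zbar_smooth_eq algebra_simps add_divide_distrib)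
qed

lemma Zbar_add:
  assumes "smooth f" "smooth g"
  shows "Zbar (\<lambda>p. f p + g p) p = Zbar f p + Zbar g p"
proof -
  have "((\<lambda>x. f x + g x) has_derivative
      (\<lambda>v. frechet_derivative f (at p) v + frechet_derivative g (at p) v)) (at p)"
    using assms by (intro has_derivative_add smooth_diff)
  from Zbar_eq[OF this] show ?thesis
    using assms by (simp add: Zbar_smooth_eq algebra_simps add_divide_distrib)
qed

lemma Zbar_const: "Zbar (\<lambda>_. c) p = 0"
  using Zbar_eq[OF has_derivative_const[of c "at p"]] by simp

lemma Zbar_cmult: "smooth f \<Longrightarrow> Zbar (\<lambda>p. c * f p) p = c * Zbar f p"
  using Zbar_mult[OF smooth_const[of c]] by (simp add: Zbar_const)

lemma Zbar_diff:
  assumes "smooth f" "smooth g"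
  shows "Zbar (\<lambda>p. f p - g p) p = Zbar f p - Zbar g p"
  using Zbar_add[OF assms(1) smooth_cmult[OF assms(2), of "-1"]] Zbar_cmult[OF assms(2), of "-1"] by simp

lemma bounded_linear_hmul_deriv:
  "bounded_linear (\<lambda>v::heis. (fst v, snd v + 2 * Im (a * cnj (fst v))))"
  by (intro bounded_linear_Pair bounded_linear_fst bounded_linear_add bounded_linear_snd
     bounded_linear_const_mult[OF bounded_linear_compose[OF bounded_linear_Im
       bounded_linear_const_mult[OF bounded_linear_compose[OF bounded_linear_cnj bounded_linear_fst]]]])

lemma hmul_affine: "hmul a p = a + (fst p, snd p + 2 * Im (fst a * cnj (fst p)))"
  by (simp add: hmul_def prod_eq_iff)

lemma smooth_translate: "smooth F \<Longrightarrow> smooth (\<lambda>p. F (hmul a p))"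
  unfolding hmul_affine by (rule smooth_compose_affine[OF _ bounded_linear_hmul_deriv])

text \<open>Left invariance. The derivative of a left translation by \<open>a\<close> shears \<open>(1, 0)\<close> and \<open>(\<i>, 0)\<close> by
  multiples of \<open>(0, 1)\<close>, which turns the coefficient \<open>z\<close> of \<open>\<partial>/\<partial>t\<close> into \<open>a + z\<close>.\<close>

lemma Zbar_translate:
  assumes "smooth F" shows "Zbar (\<lambda>p. F (hmul a p)) q = Zbar F (hmul a q)"
proof -
  let ?L = "\<lambda>v::heis. (fst v, snd v + 2 * Im (fst a * cnj (fst v)))"
  let ?D = "frechet_derivative F (at (hmul a q))"
  have "((\<lambda>p. hmul a p) has_derivative ?L) (at q)"
    unfolding hmul_affine
    using bounded_linear_imp_has_derivative[OF bounded_linear_hmul_deriv] by (auto intro!: derivative_eq_intros)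
  from has_derivative_compose[OF this smooth_diff[OF assms]]
  have d: "((\<lambda>p. F (hmul a p)) has_derivative (\<lambda>v. ?D (?L v))) (at q)" .
  interpret bounded_linear ?D using smooth_diff[OF assms] by (rule has_derivative_bounded_linear)
  have e: "?D (c, r) = ?D (c, 0) + of_real r * ?D (0, 1)" for c r
    using add[of "(c, 0)" "(0, r)"] scaleR[of r "(0, 1)"] by (simp add: scaleR_conv_of_real)
  have L: "?D (?L (1, 0)) = ?D (1, 0) + of_real (2 * Im (fst a)) * ?D (0, 1)"
      "?D (?L (\<i>, 0)) = ?D (\<i>, 0) - of_real (2 * Re (fst a)) * ?D (0, 1)" "?D (?L (0, 1)) = ?D (0, 1)"
    using e[of 1 "2 * Im (fst a)"] e[of \<i> "- (2 * Re (fst a))"] by simp_all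
  \<comment> \<open>The sheared terms combine to \<open>- \<i> a\<close>, the amount by which the coefficient at \<open>hmul a q\<close> differs from the one at \<open>q\<close>.\<close>
  have k: "\<i> * fst (hmul a q) = \<i> * of_real (Re (fst a)) - of_real (Im (fst a)) + \<i> * fst q"
    by (simp add: complex_eq_iff hmul_def)
  show ?thesis
    unfolding Zbar_eq[OF d] Zbar_smooth_eq[OF assms] L k by (simp add: field_simps)
qed

lemma bounded_hmul_preimage:
  assumes "bounded S" shows "bounded {p. hmul a p \<in> S}"
proof -
  have "compact (hmul (- a) ` closure S)"
    using assms by (intro compact_continuous_image continuous_intros) (auto simp: compact_closure continuous_on_id)
  moreover have "{p. hmul a p \<in> S} \<subseteq> hmul (- a) ` closure S"
    using closure_subset[of S] by (auto intro!: image_eqI[where x="hmul a _"])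
  ultimately show ?thesis using compact_imp_bounded bounded_subset by blast
qed

lemma test_translate: "F \<in> test_functions \<Longrightarrow> (\<lambda>p. F (hmul a p)) \<in> test_functions"
  using bounded_hmul_preimage[of "{x. F x \<noteq> 0}" a] by (auto simp: test_iff intro: smooth_translate)

text \<open>The coefficient of \<open>\<partial>/\<partial>t\<close> in \<open>Zbar\<close> does not depend on \<open>t\<close>.\<close>

lemma integral_Zbar:
  assumes F: "F \<in> test_functions" shows "(\<integral>p. Zbar F p \<partial>lborel) = 0"
proof -
  have "frechet_derivative (fst :: heis \<Rightarrow> complex) (at x) (0, 1) = 0" for x
    unfolding fd_eq[OF bounded_linear_imp_has_derivative[OF bounded_linear_fst]] by simp
  then have *: "(\<integral>p. frechet_derivative F (at p) (0,1) * fst p \<partial>lborel) = 0"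
    using parts[OF F smooth_fst, of "(0,1)"] by simp
  have I: "integrable lborel (\<lambda>p. frechet_derivative F (at p) v)" for v
    by (intro test_integrable test_deriv F)
  have I2: "integrable lborel (\<lambda>p. frechet_derivative F (at p) (0,1) * fst p)"
    using test_integrable[OF test_mult1[OF test_deriv[OF F] smooth_fst]] by (simp add: mult.commute)
  have "(\<integral>p. Zbar F p \<partial>lborel) = (\<integral>p. (1/2) * frechet_derivative F (at p) (1,0)
      + (\<i>/2) * frechet_derivative F (at p) (\<i>,0) + (- \<i>) * (frechet_derivative F (at p) (0,1) * fst p) \<partial>lborel)"
    by (simp add: Zbar_fun_eq mult_ac)
  also have "\<dots> = (1/2) * (\<integral>p. frechet_derivative F (at p) (1,0) \<partial>lborel)
      + (\<i>/2) * (\<integral>p. frechet_derivative F (at p) (\<i>,0) \<partial>lborel)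
      + (- \<i>) * (\<integral>p. frechet_derivative F (at p) (0,1) * fst p \<partial>lborel)"
    using I I2 by (subst Bochner_Integration.integral_add; simp)+
  finally show ?thesis by (simp add: integral_deriv_zero[OF F] *)
qed

text \<open>No complex conjugate occurs in this pairing, with respect to which the transpose of \<open>Zbar\<close> is \<open>- Zbar\<close>.\<close>

lemma Zbar_parts:
  assumes f: "f \<in> test_functions" and g: "smooth g"
  shows "(\<integral>p. Zbar f p * g p \<partial>lborel) = - (\<integral>p. f p * Zbar g p \<partial>lborel)"
proof -
  have "(\<lambda>p. f p * g p) \<in> test_functions" using test_mult1[OF f g] by (simp add: mult.commute)
  from integral_Zbar[OF this] have "(\<integral>p. f p * Zbar g p + Zbar f p * g p \<partial>lborel) = 0"
    by (simp add: Zbar_mult test_smooth[OF f] g)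
  moreover have "integrable lborel (\<lambda>p. f p * Zbar g p)" "integrable lborel (\<lambda>p. Zbar f p * g p)"
    using test_integrable[OF test_mult1[OF f smooth_Zbar[OF g]]] test_integrable[OF test_mult1[OF test_Zbar[OF f] g]]
    by (simp_all add: mult.commute)
  ultimately show ?thesis by (simp add: add_eq_0_iff)
qed

section \<open>Smooth plateau functions on the line\<close>

text \<open>The functions \<open>P(1/x) exp(-1/x)\<close>, extended by \<open>0\<close>, are closed under
  differentiation; this makes them smooth.\<close>

definition exp_bump :: "real poly \<Rightarrow> real \<Rightarrow> real" where
  "exp_bump P x = (if 0 < x then poly P (1 / x) * exp (- (1 / x)) else 0)"

lemma tendsto_poly_exp: "((\<lambda>u. u ^ n * poly P u * exp (- u)) \<longlongrightarrow> 0) (at_top :: real filter)"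
proof (induction P arbitrary: n)
  case (pCons a P)
  have "((\<lambda>u. a * (u ^ n / exp u) + u ^ Suc n * poly P u * exp (- u)) \<longlongrightarrow> a * 0 + 0) at_top"
    by (intro tendsto_intros tendsto_power_div_exp_0 pCons.IH)
  then show ?case by (simp add: exp_minus field_simps)
qed simp

lemma exp_bump_deriv: "(exp_bump P has_real_derivative exp_bump ([:0,0,1:] * (P - pderiv P)) x) (at x)"
proof -
  consider "0 < x" | "x < 0" | "x = 0" by linarith
  then show ?thesis
  proof cases
    case 1
    have "((\<lambda>x. poly P (1 / x) * exp (- (1 / x))) has_real_derivative
        exp_bump ([:0,0,1:] * (P - pderiv P)) x) (at x)"
      using 1 by (auto intro!: derivative_eq_intros poly_DERIV[THEN DERIV_chain2] simp: exp_bump_def field_simps power2_eq_square)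
    then show ?thesis
      by (rule DERIV_cong_ev[THEN iffD1, rotated -1])
        (use 1 in \<open>auto simp: exp_bump_def eventually_nhds intro!: exI[of _ "{0<..}"]\<close>)
  next
    case 2
    have "((\<lambda>x. 0) has_real_derivative 0) (at x)" by simp
    then have "(exp_bump P has_real_derivative 0) (at x)"
      by (rule DERIV_cong_ev[THEN iffD1, rotated -1])
        (use 2 in \<open>auto simp: exp_bump_def eventually_nhds intro!: exI[of _ "{..<0}"]\<close>)
    with 2 show ?thesis by (simp add: exp_bump_def)
  next
    case 3
    \<comment> \<open>At \<open>0\<close> the difference quotient is \<open>u P(u) exp(-u)\<close> with \<open>u = 1/h\<close> tending to infinity.\<close>
    have "((\<lambda>h. (exp_bump P (0 + h) - exp_bump P 0) / h) \<longlongrightarrow> 0) (at 0)"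
    proof (rule filterlim_split_at)
      have "((\<lambda>h. 0) \<longlongrightarrow> 0) (at_left (0::real))" by simp
      then show "((\<lambda>h. (exp_bump P (0 + h) - exp_bump P 0) / h) \<longlongrightarrow> 0) (at_left 0)"
        by (rule Lim_transform_eventually) (auto simp: exp_bump_def eventually_at_filter)
      have "((\<lambda>h. inverse h ^ 1 * poly P (inverse h) * exp (- inverse h)) \<longlongrightarrow> 0) (at_right (0::real))"
        by (rule filterlim_compose[OF tendsto_poly_exp filterlim_inverse_at_top_right])
      then show "((\<lambda>h. (exp_bump P (0 + h) - exp_bump P 0) / h) \<longlongrightarrow> 0) (at_right 0)"
        by (rule Lim_transform_eventually) (auto simp: exp_bump_def eventually_at_filter field_simps)
    qed
    then show ?thesis by (simp add: DERIV_def 3) (simp add: exp_bump_def)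
  qed
qed

lemma Ck_exp_bump: "Ck k (exp_bump P)"
proof (induction k arbitrary: P)
  case 0 then show ?case
    using DERIV_continuous_on[of UNIV "exp_bump P"] exp_bump_deriv by auto
next
  case (Suc k)
  have d: "(exp_bump P has_derivative (\<lambda>v. exp_bump ([:0,0,1:] * (P - pderiv P)) x * v)) (at x)" for x
    using exp_bump_deriv[of P x] by (simp add: has_field_derivative_def)
  have "Ck k (\<lambda>x. exp_bump ([:0,0,1:] * (P - pderiv P)) x * v)" for v
    using Ck_linear_compose[OF bounded_linear_mult_left Suc.IH] .
  then show ?case using d unfolding Ck.simps fd_eq[OF d] differentiable_def by blast
qed

text \<open>The denominator has no zeros because \<open>2 - s\<close> or \<open>s - 1\<close> is positive.\<close>

definition smooth_step :: "real \<Rightarrow> complex" where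
  "smooth_step s = of_real (exp_bump 1 (2 - s)) * inverse (of_real (exp_bump 1 (2 - s)) + of_real (exp_bump 1 (s - 1)))"

lemma exp_bump_1: "exp_bump 1 x = (if 0 < x then exp (- (1 / x)) else 0)"
  by (simp add: exp_bump_def)

lemma smooth_smooth_step: "smooth smooth_step"
proof -
  have 1: "smooth (\<lambda>s. complex_of_real (exp_bump 1 (c + l * s)))" for c l
  proof -
    have "smooth (exp_bump 1)" by (simp add: smooth_def Ck_exp_bump)
    from smooth_linear_compose[OF smooth_compose_affine[OF this bounded_linear_mult_right] bounded_linear_of_real]
    show ?thesis .
  qed
  have nz: "complex_of_real (exp_bump 1 (2 - s)) + of_real (exp_bump 1 (s - 1)) \<noteq> 0" for s
  proof -
    have "exp_bump 1 (2 - s) + exp_bump 1 (s - 1) > 0" by (auto simp: exp_bump_1 add_pos_pos)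
    then show ?thesis by (metis of_real_add of_real_eq_0_iff less_irrefl)
  qed
  show ?thesis unfolding smooth_step_def
    using 1[of 2 "-1"] 1[of "-1" 1] nz by (intro smooth_mult smooth_inverse smooth_add) auto
qed

lemma smooth_step_eq_1: "s \<le> 1 \<Longrightarrow> smooth_step s = 1"
  and smooth_step_eq_0: "2 \<le> s \<Longrightarrow> smooth_step s = 0"
  by (auto simp: smooth_step_def exp_bump_1)

lemma smooth_step_real: "\<exists>r. smooth_step s = of_real r \<and> 0 \<le> r \<and> r \<le> 1"
proof -
  define a b where "a = exp_bump 1 (2 - s)" and "b = exp_bump 1 (s - 1)"
  have ab: "0 \<le> a" "0 \<le> b" by (simp_all add: a_def b_def exp_bump_1)
  then have "a * inverse (a + b) \<le> 1"
    by (cases "a + b = 0") (auto simp: field_simps)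
  with ab show ?thesis
    by (intro exI[of _ "a * inverse (a + b)"]) (auto simp: smooth_step_def a_def b_def)
qed

definition plateau :: "real \<Rightarrow> complex" where "plateau s = smooth_step s * smooth_step (- s)"

lemma smooth_plateau: "smooth plateau"
proof -
  have "smooth (\<lambda>s. smooth_step (0 + (-1) * s))"
    by (rule smooth_compose_affine[OF smooth_smooth_step bounded_linear_mult_right])
  then show ?thesis unfolding plateau_def by (intro smooth_mult smooth_smooth_step) simp
qed

lemma plateau_eq_1: "\<bar>s\<bar> \<le> 1 \<Longrightarrow> plateau s = 1"
  by (simp add: plateau_def smooth_step_eq_1 abs_le_iff)

lemma plateau_eq_0: "2 \<le> \<bar>s\<bar> \<Longrightarrow> plateau s = 0"
  by (cases "0 \<le> s") (auto simp: plateau_def smooth_step_eq_0)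

lemma plateau_real: "\<exists>r. plateau s = of_real r \<and> 0 \<le> r \<and> r \<le> 1"
proof -
  obtain r1 r2 where "smooth_step s = of_real r1" "0 \<le> r1" "r1 \<le> 1"
      "smooth_step (-s) = of_real r2" "0 \<le> r2" "r2 \<le> 1"
    using smooth_step_real by metis
  then show ?thesis by (intro exI[of _ "r1 * r2"]) (auto simp: plateau_def mult_le_one)
qed

section \<open>Convergence in Lp and integrals of powers\<close>

text \<open>The \<open>p\<close>-th power of the \<open>L\<^sup>p\<close> norm for Lebesgue measure. Values in \<open>ennreal\<close> keep
  divergence visible; passing to \<open>heis_vol\<close> multiplies it by \<open>4\<close>.\<close>

definition power_integral :: "real \<Rightarrow> (heis \<Rightarrow> complex) \<Rightarrow> ennreal" where
  "power_integral p f = (\<integral>\<^sup>+x. ennreal (norm (f x) powr p) \<partial>lborel)"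

lemma nn_integral_heis_vol:
  assumes [measurable]: "F \<in> borel_measurable borel"
  shows "(\<integral>\<^sup>+x. F x \<partial>heis_vol) = 4 * (\<integral>\<^sup>+x. F x \<partial>lborel)"
  unfolding heis_vol_def by (subst nn_integral_density) (auto simp: nn_integral_cmult)

lemma sets_heis_vol [measurable_cong, simp]: "sets heis_vol = sets borel"
  by (simp add: heis_vol_def)

lemma Lp_heis_iff: "f \<in> Lp p heis_vol \<longleftrightarrow> f \<in> borel_measurable borel \<and> power_integral p f < \<infinity>"
proof -
  have "borel_measurable heis_vol = (borel_measurable borel :: (heis \<Rightarrow> complex) set)"
    by (rule measurable_cong_sets) auto
  moreover have "integrable heis_vol (\<lambda>x. norm (f x) powr p) \<longleftrightarrow> power_integral p f < \<infinity>"
    if [measurable]: "f \<in> borel_measurable borel"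
    by (auto simp: integrable_iff_bounded nn_integral_heis_vol power_integral_def ennreal_mult_less_top)
  ultimately show ?thesis by (auto simp: Lp_def)
qed

lemma Lp_norm_heis:
  assumes [measurable]: "f \<in> borel_measurable borel"
  shows "Lp_norm p heis_vol f = enn2real (4 * power_integral p f) powr (1 / p)"
  unfolding Lp_norm_def
  by (subst integral_eq_nn_integral) (auto simp: nn_integral_heis_vol power_integral_def)

lemma Lp_convergesI:
  assumes p: "0 < p" and fs: "\<And>j. fs j \<in> Lp p heis_vol" and f: "f \<in> Lp p heis_vol"
    and lim: "(\<lambda>j. power_integral p (\<lambda>x. fs j x - f x)) \<longlonglongrightarrow> 0"
  shows "Lp_converges p heis_vol fs f"
proof -
  have [measurable]: "fs j \<in> borel_measurable borel" "f \<in> borel_measurable borel" for j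
    using fs f by (auto simp: Lp_heis_iff)
  have "(\<lambda>j. 4 * power_integral p (\<lambda>x. fs j x - f x)) \<longlonglongrightarrow> 4 * 0"
    by (intro ennreal_tendsto_cmult lim) simp
  then have "(\<lambda>j. enn2real (4 * power_integral p (\<lambda>x. fs j x - f x))) \<longlonglongrightarrow> enn2real 0"
    by (intro tendsto_enn2real) simp_all
  then have "(\<lambda>j. Lp_norm p heis_vol (\<lambda>x. fs j x - f x)) \<longlonglongrightarrow> 0"
    using p by (subst Lp_norm_heis, measurable) (auto intro!: tendsto_zero_powrI[where b="1 / p"])
  then show ?thesis using fs f by (simp add: Lp_converges_def)
qed

lemma powr_add_le:
  fixes a b p :: real assumes "0 \<le> a" "0 \<le> b" "0 < p"
  shows "(a + b) powr p \<le> 2 powr p * (a powr p + b powr p)"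
proof -
  have "(a + b) powr p \<le> (2 * max a b) powr p" using assms by (intro powr_mono2) auto
  also have "\<dots> = 2 powr p * max a b powr p" using assms by (simp add: powr_mult)
  also have "\<dots> \<le> 2 powr p * (a powr p + b powr p)" by (intro mult_left_mono) (auto simp: max_def)
  finally show ?thesis .
qed

lemma power_integral_add:
  assumes p: "0 < p" and [measurable]: "f \<in> borel_measurable borel" "g \<in> borel_measurable borel"
  shows "power_integral p (\<lambda>x. f x + g x) \<le> ennreal (2 powr p) * (power_integral p f + power_integral p g)"
proof -
  have "ennreal (norm (f x + g x) powr p)
      \<le> ennreal (2 powr p) * (ennreal (norm (f x) powr p) + ennreal (norm (g x) powr p))" for x
  proof -
    have "norm (f x + g x) powr p \<le> (norm (f x) + norm (g x)) powr p"
      using p by (intro powr_mono2 norm_triangle_ineq) auto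
    also have "\<dots> \<le> 2 powr p * (norm (f x) powr p + norm (g x) powr p)"
      using p by (intro powr_add_le) auto
    finally show ?thesis by (simp add: ennreal_leI flip: ennreal_plus ennreal_mult)
  qed
  then have "power_integral p (\<lambda>x. f x + g x)
      \<le> (\<integral>\<^sup>+x. ennreal (2 powr p) * (ennreal (norm (f x) powr p) + ennreal (norm (g x) powr p)) \<partial>lborel)"
    unfolding power_integral_def by (intro nn_integral_mono)
  also have "\<dots> = ennreal (2 powr p) * (power_integral p f + power_integral p g)"
    unfolding power_integral_def by (simp add: nn_integral_cmult nn_integral_add)
  finally show ?thesis .
qed

lemma power_integral_diff_commute: "power_integral p (\<lambda>x. f x - g x) = power_integral p (\<lambda>x. g x - f x)"
  by (simp add: power_integral_def norm_minus_commute)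

lemma test_Lp: assumes "f \<in> test_functions" "0 < p" shows "f \<in> Lp p heis_vol"
proof -
  obtain B where B: "\<And>x. norm (f x) \<le> B" "0 \<le> B" using test_bounded[OF assms(1)] by blast
  have c: "compact (closure {x. f x \<noteq> 0})" using assms by (simp add: test_functions_def)
  have "power_integral p f \<le> (\<integral>\<^sup>+x. ennreal (B powr p) * indicator (closure {x. f x \<noteq> 0}) x \<partial>lborel)"
    unfolding power_integral_def
  proof (rule nn_integral_mono)
    fix x
    show "ennreal (norm (f x) powr p) \<le> ennreal (B powr p) * indicator (closure {x. f x \<noteq> 0}) x"
      using B assms(2) test_zero[OF assms(1), of x]
      by (cases "x \<in> closure {x. f x \<noteq> 0}") (simp_all add: ennreal_leI powr_mono2)
  qed
  also have "\<dots> < \<infinity>"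
    using emeasure_compact_finite[OF c] by (subst nn_integral_cmult_indicator) (auto simp: ennreal_mult_less_top)
  finally show ?thesis by (simp add: Lp_heis_iff test_measurable assms)
qed

lemma ennreal_tendsto_0I:
  fixes x :: "nat \<Rightarrow> ennreal"
  assumes "\<And>e. 0 < e \<Longrightarrow> \<forall>\<^sub>F n in sequentially. x n \<le> ennreal e"
  shows "x \<longlonglongrightarrow> 0"
proof (rule order_tendstoI)
  fix a :: ennreal assume "0 < a"
  then obtain e where e: "0 < e" "ennreal e < a"
    by (metis dense ennreal_cases ennreal_less_zero_iff less_top_ennreal order_less_trans top.not_eq_extremum)
  show "\<forall>\<^sub>F n in sequentially. x n < a"
    using assms[OF e(1)] by eventually_elim (use e(2) in auto)
qed simp

lemma ennreal_tendsto_0D: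
  fixes x :: "nat \<Rightarrow> ennreal"
  assumes "x \<longlonglongrightarrow> 0" "0 < e"
  shows "\<forall>\<^sub>F n in sequentially. x n \<le> ennreal e"
proof -
  have "\<forall>\<^sub>F n in sequentially. x n < ennreal e"
    by (rule order_tendstoD[OF assms(1)]) (simp add: assms)
  then show ?thesis by (rule eventually_mono) simp
qed

lemma ennreal_tendsto_0_le:
  fixes x y :: "nat \<Rightarrow> ennreal"
  assumes "y \<longlonglongrightarrow> 0" "\<And>n. x n \<le> y n" shows "x \<longlonglongrightarrow> 0"
  using assms by (intro tendsto_sandwich[OF _ _ tendsto_const[of 0] assms(1)]) auto

lemma nn_integral_tail:
  assumes [measurable]: "F \<in> borel_measurable borel" and fin: "(\<integral>\<^sup>+x. F x \<partial>lborel) < \<infinity>"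
  shows "(\<lambda>n. \<integral>\<^sup>+x. F x * indicator {p. real (Suc n) \<le> hgauge p} x \<partial>lborel) \<longlonglongrightarrow> 0"
proof -
  have "(\<lambda>n. \<integral>\<^sup>+x. F x * indicator {p. real (Suc n) \<le> hgauge p} x \<partial>lborel) \<longlonglongrightarrow> (\<integral>\<^sup>+x. 0 \<partial>(lborel :: heis measure))"
  proof (rule nn_integral_dominated_convergence[where w=F])
    show "AE x in lborel. (\<lambda>n. F x * indicator {p. real (Suc n) \<le> hgauge p} x) \<longlonglongrightarrow> 0"
    proof (rule AE_I2)
      fix x
      obtain N :: nat where "hgauge x < real N" using reals_Archimedean2 by blast
      then have "\<forall>\<^sub>F n in sequentially. F x * indicator {p. real (Suc n) \<le> hgauge p} x = 0"
        by (intro eventually_sequentiallyI[of N]) (auto simp: indicator_def)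
      then show "(\<lambda>n. F x * indicator {p. real (Suc n) \<le> hgauge p} x) \<longlonglongrightarrow> 0"
        by (rule tendsto_eventually)
    qed
  qed (use fin in \<open>auto simp: indicator_def\<close>)
  then show ?thesis by simp
qed

section \<open>Cutoff functions on the group\<close>

text \<open>The scale in \<open>t\<close> is \<open>R\<^sup>2\<close>, so that all three terms of \<open>Zbar\<close> contribute derivatives of order \<open>1/R\<close>:
  on the support, the factor \<open>z\<close> of \<open>\<partial>/\<partial>t\<close> is of size at most \<open>R\<close>, up to a constant.\<close>

definition cutoff :: "real \<Rightarrow> heis \<Rightarrow> complex" where
  "cutoff R p = plateau (Re (fst p) / R) * plateau (Im (fst p) / R) * plateau (snd p / R\<^sup>2)"

lemma smooth_plateau_linear: "bounded_linear L \<Longrightarrow> smooth (\<lambda>p::heis. plateau (L p))"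
  using smooth_compose_affine[OF smooth_plateau, of L 0] by simp

lemma cutoff_linear:
  "bounded_linear (\<lambda>p::heis. Re (fst p) / R)" "bounded_linear (\<lambda>p::heis. Im (fst p) / R)"
  "bounded_linear (\<lambda>p::heis. snd p / R)"
  by (intro bounded_linear_compose[OF bounded_linear_divide] bounded_linear_compose[OF bounded_linear_Re]
    bounded_linear_compose[OF bounded_linear_Im] bounded_linear_fst bounded_linear_snd)+

lemma smooth_cutoff: "smooth (cutoff R)"
  unfolding cutoff_def by (intro smooth_mult smooth_plateau_linear cutoff_linear)

lemma cutoff_real: "\<exists>r. cutoff R p = of_real r \<and> 0 \<le> r \<and> r \<le> 1"
proof -
  obtain a b c where "plateau (Re (fst p) / R) = of_real a" "0 \<le> a" "a \<le> 1"
      "plateau (Im (fst p) / R) = of_real b" "0 \<le> b" "b \<le> 1"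
      "plateau (snd p / R\<^sup>2) = of_real c" "0 \<le> c" "c \<le> 1"
    using plateau_real by metis
  then show ?thesis by (intro exI[of _ "a * b * c"]) (auto simp: cutoff_def mult_le_one)
qed

lemma norm_cutoff: "norm (cutoff R p) \<le> 1" "norm (cutoff R p - 1) \<le> 1"
proof -
  obtain r where r: "cutoff R p = of_real r" "0 \<le> r" "r \<le> 1" using cutoff_real by blast
  then show "norm (cutoff R p) \<le> 1" by simp
  have "cutoff R p - 1 = of_real (r - 1)" using r by simp
  then show "norm (cutoff R p - 1) \<le> 1" using r by (simp only: norm_of_real)
qed

lemma hgauge_bounds: "\<bar>Re (fst p)\<bar> \<le> hgauge p" "\<bar>Im (fst p)\<bar> \<le> hgauge p" "\<bar>snd p\<bar> \<le> (hgauge p)\<^sup>2"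
proof -
  show "\<bar>Re (fst p)\<bar> \<le> hgauge p" "\<bar>Im (fst p)\<bar> \<le> hgauge p" by (simp_all add: hgauge_def le_max_iff_disj)
  have "sqrt \<bar>snd p\<bar> \<le> hgauge p" by (simp add: hgauge_def)
  then show "\<bar>snd p\<bar> \<le> (hgauge p)\<^sup>2" by (simp add: real_le_lsqrt sqrt_le_D)
qed

lemma cutoff_eq_1: assumes "0 < R" "hgauge p \<le> R" shows "cutoff R p = 1"
proof -
  have "(hgauge p)\<^sup>2 \<le> R\<^sup>2" using assms hgauge_nonneg by (intro power_mono) auto
  then have "\<bar>snd p\<bar> \<le> R\<^sup>2" using hgauge_bounds(3)[of p] by linarith
  with hgauge_bounds(1,2)[of p] assms have "\<bar>Re (fst p) / R\<bar> \<le> 1" "\<bar>Im (fst p) / R\<bar> \<le> 1" "\<bar>snd p / R\<^sup>2\<bar> \<le> 1"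
    by (auto simp: abs_divide)
  then show ?thesis by (simp add: cutoff_def plateau_eq_1)
qed

lemma hgauge_large:
  assumes "0 < R" "2 * R < hgauge p"
  shows "2 < \<bar>Re (fst p) / R\<bar> \<or> 2 < \<bar>Im (fst p) / R\<bar> \<or> 2 < \<bar>snd p / R\<^sup>2\<bar>"
proof -
  consider "2 * R < \<bar>Re (fst p)\<bar>" | "2 * R < \<bar>Im (fst p)\<bar>" | "2 * R < sqrt \<bar>snd p\<bar>"
    using assms(2) by (auto simp: hgauge_def less_max_iff_disj)
  then show ?thesis
  proof cases
    case 3
    then have "(2 * R)\<^sup>2 < (sqrt \<bar>snd p\<bar>)\<^sup>2" using assms(1) by (intro power_strict_mono) auto
    then have "(2 * R)\<^sup>2 < \<bar>snd p\<bar>" by simp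
    moreover have "2 * R\<^sup>2 \<le> (2 * R)\<^sup>2" by (simp add: power_mult_distrib)
    ultimately have "2 * R\<^sup>2 < \<bar>snd p\<bar>" by linarith
    then show ?thesis using assms(1) by (auto simp: field_simps abs_divide)
  qed (use assms(1) in \<open>auto simp: field_simps abs_divide\<close>)
qed

lemma bounded_hbox: "bounded (hbox r)"
proof (rule bounded_subset)
  show "bounded (hbox \<bar>r\<bar>)" by (simp only: hbox_eq abs_ge_zero bounded_cbox)
  show "hbox r \<subseteq> hbox \<bar>r\<bar>" by (auto simp: hbox_def)
qed

lemma test_cutoff: assumes "0 < R" shows "cutoff R \<in> test_functions"
proof -
  have "{p. cutoff R p \<noteq> 0} \<subseteq> hbox (2 * R)"
  proof
    fix p assume "p \<in> {p. cutoff R p \<noteq> 0}"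
    then have "plateau (Re (fst p) / R) \<noteq> 0" "plateau (Im (fst p) / R) \<noteq> 0" "plateau (snd p / R\<^sup>2) \<noteq> 0"
      by (auto simp: cutoff_def)
    then have "\<not> 2 * R < hgauge p"
      using hgauge_large[OF assms, of p] plateau_eq_0 less_imp_le by blast
    then show "p \<in> hbox (2 * R)" by (simp add: hbox_def)
  qed
  then show ?thesis using bounded_hbox bounded_subset smooth_cutoff by (auto simp: test_iff)
qed

definition plateau_deriv :: "real \<Rightarrow> complex" where
  "plateau_deriv s = frechet_derivative plateau (at s) 1"

lemma plateau_has_derivative: "(plateau has_derivative (\<lambda>v. of_real v * plateau_deriv s)) (at s)"
proof -
  have d: "(plateau has_derivative frechet_derivative plateau (at s)) (at s)"
    by (rule smooth_diff[OF smooth_plateau])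
  then interpret bounded_linear "frechet_derivative plateau (at s)" by (rule has_derivative_bounded_linear)
  have "frechet_derivative plateau (at s) = (\<lambda>v. of_real v * plateau_deriv s)"
  proof
    fix v
    from scaleR[of v 1] show "frechet_derivative plateau (at s) v = of_real v * plateau_deriv s"
      by (simp add: plateau_deriv_def scaleR_conv_of_real)
  qed
  with d show ?thesis by (simp only:)
qed

lemma plateau_deriv_0: assumes "\<bar>s\<bar> < 1 \<or> 2 < \<bar>s\<bar>" shows "plateau_deriv s = 0"
proof -
  have "\<exists>S c. open S \<and> s \<in> S \<and> (\<forall>x\<in>S. plateau x = c)"
  proof (cases "\<bar>s\<bar> < 1")
    case True then show ?thesis
      by (intro exI[of _ "{-1<..<1}"] exI[of _ 1]) (auto intro!: plateau_eq_1)
  next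
    case False with assms have "2 < \<bar>s\<bar>" by simp
    then show ?thesis
      by (intro exI[of _ "{..<-2} \<union> {2<..}"] exI[of _ 0]) (auto intro!: plateau_eq_0)
  qed
  then obtain S c where S: "open S" "s \<in> S" "\<And>x. x \<in> S \<Longrightarrow> plateau x = c" by blast
  have "(plateau has_derivative (\<lambda>_. 0)) (at s)"
    by (rule has_derivative_transform_within_open[OF has_derivative_const[of c] S(1,2)]) (simp add: S(3))
  from fd_eq[OF this] show ?thesis by (simp add: plateau_deriv_def)
qed

lemma plateau_deriv_bounded: obtains D where "0 \<le> D" "\<And>s. norm (plateau_deriv s) \<le> D"
proof -
  have "continuous_on UNIV plateau_deriv"
    unfolding plateau_deriv_def by (intro smooth_cont smooth_deriv smooth_plateau)
  then have "compact (plateau_deriv ` {-2..2})"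
    by (intro compact_continuous_image) (auto intro: continuous_on_subset)
  then obtain B where "B > 0" "\<And>s. s \<in> {-2..2} \<Longrightarrow> norm (plateau_deriv s) \<le> B"
    by (auto dest!: compact_imp_bounded simp: bounded_pos)
  then show ?thesis using that[of B] plateau_deriv_0 by (metis abs_le_iff atLeastAtMost_iff less_imp_le linorder_not_le minus_le_iff norm_zero)
qed

lemma Zbar_plateau:
  assumes L: "bounded_linear L"
  shows "Zbar (\<lambda>p. plateau (L p)) p
    = plateau_deriv (L p) * ((of_real (L (1, 0)) + \<i> * of_real (L (\<i>, 0))) / 2 - \<i> * fst p * of_real (L (0, 1)))"
proof -
  have "((\<lambda>p. plateau (L p)) has_derivative (\<lambda>v. of_real (L v) * plateau_deriv (L p))) (at p)"
    using has_derivative_compose[OF bounded_linear_imp_has_derivative[OF L] plateau_has_derivative] .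
  from Zbar_eq[OF this] show ?thesis by (simp add: field_simps)
qed

lemma Zbar_cutoff:
  "Zbar (cutoff R) p =
     plateau (Re (fst p) / R) * plateau (Im (fst p) / R) * (- \<i> * fst p * plateau_deriv (snd p / R\<^sup>2) / of_real (R\<^sup>2))
   + (plateau (Re (fst p) / R) * (\<i> * plateau_deriv (Im (fst p) / R) / (2 * of_real R))
     + plateau_deriv (Re (fst p) / R) / (2 * of_real R) * plateau (Im (fst p) / R)) * plateau (snd p / R\<^sup>2)"
proof -
  note s = smooth_plateau_linear[OF cutoff_linear(1)] smooth_plateau_linear[OF cutoff_linear(2)]
    smooth_plateau_linear[OF cutoff_linear(3)]
  show ?thesis
    unfolding cutoff_def
    by (subst Zbar_mult, intro smooth_mult s, rule s, subst Zbar_mult, rule s, rule s)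
      (simp add: Zbar_plateau cutoff_linear mult_ac)
qed

lemma norm_plateau: "norm (plateau s) \<le> 1"
  using plateau_real[of s] by auto

lemma norm_Zbar_cutoff:
  obtains K where "0 \<le> K"
    "\<And>R p. 0 < R \<Longrightarrow> norm (Zbar (cutoff R) p) \<le> (if R \<le> hgauge p \<and> hgauge p \<le> 2 * R then K / R else 0)"
proof -
  obtain D where D: "0 \<le> D" "\<And>s. norm (plateau_deriv s) \<le> D" using plateau_deriv_bounded by blast
  show ?thesis
  proof (rule that[of "5 * D"])
    show "0 \<le> 5 * D" using D by simp
    fix R :: real and p assume R: "0 < R"
    show "norm (Zbar (cutoff R) p) \<le> (if R \<le> hgauge p \<and> hgauge p \<le> 2 * R then 5 * D / R else 0)"
    proof (cases "R \<le> hgauge p \<and> hgauge p \<le> 2 * R")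
      case True
      have "norm (fst p) \<le> \<bar>Re (fst p)\<bar> + \<bar>Im (fst p)\<bar>" by (rule cmod_le)
      also have "\<dots> \<le> 4 * R" using hgauge_bounds[of p] True by linarith
      finally have z: "norm (fst p) \<le> 4 * R" .
      have "norm (- \<i> * fst p * plateau_deriv (snd p / R\<^sup>2) / of_real (R\<^sup>2)) \<le> 4 * R * D / R\<^sup>2"
        using z D R by (auto simp: norm_mult norm_divide norm_power intro!: divide_right_mono mult_mono)
      also have "\<dots> = 4 * D / R" using R by (simp add: field_simps power2_eq_square)
      finally have 1: "norm (- \<i> * fst p * plateau_deriv (snd p / R\<^sup>2) / of_real (R\<^sup>2)) \<le> 4 * D / R" .
      have 2: "norm (\<i> * plateau_deriv (Im (fst p) / R) / (2 * of_real R)) \<le> D / (2 * R)"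
          "norm (plateau_deriv (Re (fst p) / R) / (2 * of_real R)) \<le> D / (2 * R)"
        using D R by (auto simp: norm_mult norm_divide intro!: divide_right_mono)
      have m: "norm (a * b) \<le> B" if "norm a \<le> 1" "norm b \<le> B" for a b :: complex and B
        using mult_mono[OF that] norm_ge_zero[of b] that by (simp add: norm_mult)
      have "norm (Zbar (cutoff R) p) \<le> 4 * D / R + (D / (2 * R) + D / (2 * R))"
        unfolding Zbar_cutoff
        apply (intro norm_triangle_mono)
         apply (rule m[OF m[OF norm_plateau norm_plateau] 1])
        apply (subst mult.commute, rule m[OF norm_plateau], intro norm_triangle_mono)
         apply (rule m[OF norm_plateau 2(1)])
        apply (subst mult.commute, rule m[OF norm_plateau 2(2)])
        done
      also have "\<dots> = 5 * D / R" using R by (simp add: field_simps)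
      finally show ?thesis using True by simp
    next
      case False
      then consider "hgauge p < R" | "2 * R < hgauge p" by linarith
      then have "Zbar (cutoff R) p = 0"
      proof cases
        case 1
        have "(hgauge p)\<^sup>2 < R\<^sup>2" using 1 hgauge_nonneg[of p] by (intro power_strict_mono) auto
        then have "\<bar>Re (fst p) / R\<bar> < 1" "\<bar>Im (fst p) / R\<bar> < 1" "\<bar>snd p / R\<^sup>2\<bar> < 1"
          using hgauge_bounds[of p] 1 R by (auto simp: abs_divide)
        then show ?thesis by (simp add: Zbar_cutoff plateau_deriv_0)
      next
        case 2
        have "plateau s = 0" "plateau_deriv s = 0" if "2 < \<bar>s\<bar>" for s
          using that by (auto intro: plateau_eq_0 plateau_deriv_0)
        with hgauge_large[OF R 2] show ?thesis by (auto simp: Zbar_cutoff)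
      qed
      with False D R show ?thesis by simp
    qed
  qed
qed

text \<open>A smooth function is its own test function: pair \<open>H\<close> with \<open>\<chi>\<^sup>2\<close> times its conjugate, \<open>\<chi>\<close> a cutoff.\<close>

lemma smooth_weak_zero:
  assumes H: "smooth (H :: heis \<Rightarrow> complex)"
    and weak: "\<And>w. w \<in> test_functions \<Longrightarrow> (\<integral>p. H p * w p \<partial>lborel) = 0"
  shows "H p = 0"
proof -
  \<comment> \<open>The cutoff equals \<open>1\<close> at \<open>p\<close>.\<close>
  define R where "R = hgauge p + 1"
  have R: "0 < R" "hgauge p \<le> R" using hgauge_nonneg[of p] by (auto simp: R_def)
  define k where "k = (\<lambda>p. H p * cutoff R p)"
  have k: "k \<in> test_functions" unfolding k_def by (intro test_mult1 test_cutoff R H)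
  have "(\<lambda>p. cutoff R p * (cnj (k p))) \<in> test_functions"
    by (intro test_mult1 smooth_cutoff test_cnj k)
  from weak[OF this] have "heis_inner k k = 0"
    by (simp add: inner_lborel test_measurable k) (simp add: k_def mult_ac)
  from test_eq_0[OF k this] have "k p = 0" by simp
  then show ?thesis using cutoff_eq_1[OF R] by (simp add: k_def)
qed

section \<open>Truncation of smooth functions\<close>

text \<open>With \<open>A = \<delta> powr (- p / 4) * a powr p\<close> and \<open>B = \<delta> * b powr 4\<close>, the left-hand side is the
  weighted geometric mean of \<open>A\<close> and \<open>B\<close> with weights \<open>q/p\<close> and \<open>q/4\<close>, which add up to \<open>1\<close>.\<close>

lemma young_powr:
  fixes a b \<delta> p q :: real
  assumes "0 \<le> a" "0 \<le> b" "0 < \<delta>" "0 < p" and q: "q = 4 * p / (p + 4)"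
  shows "(a * b) powr q \<le> \<delta> powr (- p / 4) * a powr p + \<delta> * b powr 4"
proof (cases "a = 0 \<or> b = 0")
  case True then show ?thesis using assms by (auto)
next
  case False
  with assms have ab: "0 < a" "0 < b" by auto
  define A B where "A = \<delta> powr (- p / 4) * a powr p" and "B = \<delta> * b powr 4"
  have AB: "0 < A" "0 < B" using ab assms by (auto simp: A_def B_def)
  have q': "q = 4 * (p / (p + 4))" by (simp add: q)
  have "q / p = 4 / (p + 4)" unfolding q' using assms(4) by simp
  moreover have "q / 4 = p / (p + 4)" unfolding q' by (rule nonzero_mult_div_cancel_left) simp
  ultimately
  have th: "q / p + q / 4 = 1" "0 < q" using assms by (auto simp: q simp flip: add_divide_distrib)
  have "A powr (q / p) = \<delta> powr (- q / 4) * a powr q"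
    using ab assms by (simp add: A_def powr_mult powr_powr field_simps)
  moreover have "B powr (q / 4) = \<delta> powr (q / 4) * b powr q"
    using ab assms by (simp add: B_def powr_mult powr_powr field_simps del: powr_numeral)
  moreover have "\<delta> powr (- q / 4) * \<delta> powr (q / 4) = 1" using assms by (simp flip: powr_add)
  ultimately have "A powr (q / p) * B powr (q / 4) = (a * b) powr q"
    using ab by (simp add: powr_mult mult_ac)
  then have "(a * b) powr q = A powr (q / p) * B powr (q / 4)" by simp
  also have "\<dots> \<le> max A B powr (q / p) * max A B powr (q / 4)"
    using AB th assms by (intro mult_mono powr_mono2) auto
  also have "\<dots> = max A B" using AB th by (simp flip: powr_add)
  also have "\<dots> \<le> A + B" using AB by simp
  finally show ?thesis by (simp add: A_def B_def)
qed

text \<open>The relation between \<open>p\<close> and \<open>q\<close> is \<open>1/q = 1/p + 1/4\<close>. The commutator \<open>v Zbar \<chi>\<close> is estimated by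
  \<open>young_powr\<close>: the integral of \<open>\<bar>Zbar \<chi>\<bar>\<^sup>4\<close> is only bounded, but its coefficient \<open>\<delta>\<close> is arbitrary, and the integral of
  \<open>\<bar>v\<bar>\<^sup>p\<close> over the support of \<open>Zbar \<chi>\<close> tends to \<open>0\<close> for fixed \<open>\<delta>\<close>.\<close>

lemma cutoff_converges:
  assumes p: "0 < p" and q: "q = 4 * p / (p + 4)" and v: "smooth v"
    and fin: "power_integral p v < \<infinity>" "power_integral q (Zbar v) < \<infinity>"
  shows "(\<lambda>n. power_integral p (\<lambda>x. cutoff (real (Suc n)) x * v x - v x)) \<longlonglongrightarrow> 0"
    and "(\<lambda>n. power_integral q (\<lambda>x. Zbar (\<lambda>x. cutoff (real (Suc n)) x * v x) x - Zbar v x)) \<longlonglongrightarrow> 0"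
proof -
  have q0: "0 < q" using p by (simp add: q)
  have [measurable]: "v \<in> borel_measurable borel" "Zbar v \<in> borel_measurable borel"
    "cutoff R \<in> borel_measurable borel" "Zbar (cutoff R) \<in> borel_measurable borel" for R
    by (intro smooth_measurable v smooth_Zbar smooth_cutoff)+
  define T where "T F n = (\<integral>\<^sup>+x. F x * indicator {p. real (Suc n) \<le> hgauge p} x \<partial>lborel)" for F :: "heis \<Rightarrow> ennreal" and n
  have Tv: "T (\<lambda>x. ennreal (norm (v x) powr p)) \<longlonglongrightarrow> 0"
    and TZ: "T (\<lambda>x. ennreal (norm (Zbar v x) powr q)) \<longlonglongrightarrow> 0"
    unfolding T_def by (rule nn_integral_tail; use fin in \<open>simp add: power_integral_def\<close>)+
  have cut: "power_integral r (\<lambda>x. (cutoff (real (Suc n)) x - 1) * u x)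
      \<le> T (\<lambda>x. ennreal (norm (u x) powr r)) n" if "0 < r" for r u n
    unfolding power_integral_def T_def
  proof (rule nn_integral_mono)
    fix x
    show "ennreal (norm ((cutoff (real (Suc n)) x - 1) * u x) powr r)
        \<le> ennreal (norm (u x) powr r) * indicator {p. real (Suc n) \<le> hgauge p} x"
    proof (cases "real (Suc n) \<le> hgauge x")
      case True
      have "norm ((cutoff (real (Suc n)) x - 1) * u x) \<le> 1 * norm (u x)"
        unfolding norm_mult by (intro mult_right_mono norm_cutoff) auto
      then show ?thesis using True that by (auto intro!: ennreal_leI powr_mono2)
    next
      case False
      then have "cutoff (real (Suc n)) x = 1" by (intro cutoff_eq_1) auto
      then show ?thesis by simp
    qed
  qed
  have "(\<lambda>n. power_integral p (\<lambda>x. (cutoff (real (Suc n)) x - 1) * v x)) \<longlonglongrightarrow> 0"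
    by (rule ennreal_tendsto_0_le[OF Tv cut[OF p]])
  then show "(\<lambda>n. power_integral p (\<lambda>x. cutoff (real (Suc n)) x * v x - v x)) \<longlonglongrightarrow> 0"
    by (simp add: left_diff_distrib)
  obtain K where K: "0 \<le> K"
    "\<And>R p. 0 < R \<Longrightarrow> norm (Zbar (cutoff R) p) \<le> (if R \<le> hgauge p \<and> hgauge p \<le> 2 * R then K / R else 0)"
    using norm_Zbar_cutoff by blast
  define w where "w n x = Zbar (cutoff (real (Suc n))) x * v x" for n x
  have [measurable]: "w n \<in> borel_measurable borel" for n unfolding w_def by measurable
  \<comment> \<open>The factor \<open>R\<^sup>4\<close> in the measure of the box cancels \<open>R\<^sup>-\<^sup>4\<close>; this is where the exponents are sharp.\<close>
  have w_le: "power_integral q (w n) \<le> ennreal (\<delta> powr (- p / 4)) * T (\<lambda>x. ennreal (norm (v x) powr p)) n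
      + ennreal (\<delta> * (128 * K ^ 4))" if \<delta>: "0 < \<delta>" for \<delta> n
  proof -
    let ?R = "real (Suc n)" let ?I = "indicator {p. ?R \<le> hgauge p} :: heis \<Rightarrow> ennreal"
    have "ennreal (norm (w n x) powr q) \<le> ennreal (\<delta> powr (- p / 4)) * (ennreal (norm (v x) powr p) * ?I x)
        + ennreal (\<delta> * (K / ?R) ^ 4) * indicator (hbox (2 * ?R)) x" for x
    proof (cases "?R \<le> hgauge x \<and> hgauge x \<le> 2 * ?R")
      case True
      have "norm (w n x) powr q \<le> (norm (v x) * (K / ?R)) powr q"
        unfolding w_def norm_mult using K(2)[of ?R x] True q0
        by (subst mult.commute) (intro powr_mono2 mult_left_mono; simp)
      also have "\<dots> \<le> \<delta> powr (- p / 4) * norm (v x) powr p + \<delta> * (K / ?R) powr 4"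
        using K(1) \<delta> p q by (intro young_powr) auto
      also have "(K / ?R) powr 4 = (K / ?R) ^ 4" using K(1) by simp
      finally show ?thesis using True \<delta> K(1)
        by (simp add: hbox_def ennreal_leI flip: ennreal_plus ennreal_mult)
    next
      case False
      have "norm (Zbar (cutoff ?R) x) \<le> 0" using K(2)[of ?R x] unfolding if_not_P[OF False] by simp
      then have "w n x = 0" by (simp add: w_def)
      then show ?thesis by simp
    qed
    then have "power_integral q (w n) \<le> (\<integral>\<^sup>+x. ennreal (\<delta> powr (- p / 4)) * (ennreal (norm (v x) powr p) * ?I x)
        + ennreal (\<delta> * (K / ?R) ^ 4) * indicator (hbox (2 * ?R)) x \<partial>lborel)"
      unfolding power_integral_def by (intro nn_integral_mono)
    also have "\<dots> = ennreal (\<delta> powr (- p / 4)) * T (\<lambda>x. ennreal (norm (v x) powr p)) n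
        + ennreal (\<delta> * (K / ?R) ^ 4) * emeasure lborel (hbox (2 * ?R))"
      unfolding T_def by (subst nn_integral_add) (auto simp: nn_integral_cmult nn_integral_cmult_indicator)
    also have "ennreal (\<delta> * (K / ?R) ^ 4) * emeasure lborel (hbox (2 * ?R)) = ennreal (\<delta> * (K / ?R) ^ 4 * (8 * (2 * ?R) ^ 4))"
      using \<delta> K(1) by (subst emeasure_hbox) (auto simp: ennreal_mult simp del: of_nat_Suc)
    also have "\<delta> * (K / ?R) ^ 4 * (8 * (2 * ?R) ^ 4) = \<delta> * (128 * K ^ 4)"
      by (simp add: power_divide power_mult_distrib del: of_nat_Suc)
    finally show ?thesis .
  qed
  have wn: "(\<lambda>n. power_integral q (w n)) \<longlonglongrightarrow> 0"
  proof (rule ennreal_tendsto_0I)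
    fix e :: real assume e: "0 < e"
    \<comment> \<open>The summand \<open>1\<close> covers the case \<open>K = 0\<close>.\<close>
    define \<delta> where "\<delta> = e / (2 * (128 * K ^ 4 + 1))"
    have \<delta>: "0 < \<delta>" using e K(1) by (simp add: \<delta>_def add_nonneg_pos)
    have \<delta>2: "\<delta> * (128 * K ^ 4) \<le> e / 2"
    proof -
      have "0 < 128 * K ^ 4 + 1" using K(1) by (intro add_nonneg_pos) auto
      then have "\<delta> * (128 * K ^ 4 + 1) = e / 2" by (simp add: \<delta>_def field_simps)
      then show ?thesis using \<delta> by (simp add: distrib_left)
    qed
    have "(\<lambda>n. ennreal (\<delta> powr (- p / 4)) * T (\<lambda>x. ennreal (norm (v x) powr p)) n) \<longlonglongrightarrow> ennreal (\<delta> powr (- p / 4)) * 0"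
      by (intro ennreal_tendsto_cmult Tv) simp
    then have "(\<lambda>n. ennreal (\<delta> powr (- p / 4)) * T (\<lambda>x. ennreal (norm (v x) powr p)) n) \<longlonglongrightarrow> 0" by simp
    from ennreal_tendsto_0D[OF this, of "e / 2"] e
    have "\<forall>\<^sub>F n in sequentially. ennreal (\<delta> powr (- p / 4)) * T (\<lambda>x. ennreal (norm (v x) powr p)) n \<le> ennreal (e / 2)" by simp
    then show "\<forall>\<^sub>F n in sequentially. power_integral q (w n) \<le> ennreal e"
    proof eventually_elim
      case (elim n)
      have "power_integral q (w n) \<le> ennreal (e / 2) + ennreal (e / 2)"
        using w_le[OF \<delta>, of n] add_mono[OF elim ennreal_leI[OF \<delta>2]] by (rule order_trans)
      also have "\<dots> = ennreal e" using e by (simp flip: ennreal_plus)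
      finally show ?case .
    qed
  qed
  have *: "Zbar (\<lambda>x. cutoff (real (Suc n)) x * v x) x - Zbar v x = (cutoff (real (Suc n)) x - 1) * Zbar v x + w n x" for n x
    by (simp add: Zbar_mult smooth_cutoff v w_def algebra_simps)
  have "(\<lambda>n. ennreal (2 powr q) * (T (\<lambda>x. ennreal (norm (Zbar v x) powr q)) n + power_integral q (w n))) \<longlonglongrightarrow> ennreal (2 powr q) * (0 + 0)"
    by (intro ennreal_tendsto_cmult tendsto_add TZ wn) simp
  then have lim: "(\<lambda>n. ennreal (2 powr q) * (T (\<lambda>x. ennreal (norm (Zbar v x) powr q)) n + power_integral q (w n))) \<longlonglongrightarrow> 0" by simp
  show "(\<lambda>n. power_integral q (\<lambda>x. Zbar (\<lambda>x. cutoff (real (Suc n)) x * v x) x - Zbar v x)) \<longlonglongrightarrow> 0"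
  proof (rule ennreal_tendsto_0_le[OF lim])
    fix n
    have "power_integral q (\<lambda>x. Zbar (\<lambda>x. cutoff (real (Suc n)) x * v x) x - Zbar v x)
        \<le> ennreal (2 powr q) * (power_integral q (\<lambda>x. (cutoff (real (Suc n)) x - 1) * Zbar v x) + power_integral q (w n))"
      unfolding * using q0 by (intro power_integral_add) auto
    also have "\<dots> \<le> ennreal (2 powr q) * (T (\<lambda>x. ennreal (norm (Zbar v x) powr q)) n + power_integral q (w n))"
      by (intro mult_left_mono add_mono cut q0) auto
    finally show "power_integral q (\<lambda>x. Zbar (\<lambda>x. cutoff (real (Suc n)) x * v x) x - Zbar v x)
        \<le> ennreal (2 powr q) * (T (\<lambda>x. ennreal (norm (Zbar v x) powr q)) n + power_integral q (w n))" .
  qed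
qed

section \<open>Uniform Taylor expansion of test functions\<close>

lemma frechet_derivative_Basis:
  assumes "smooth f"
  shows "frechet_derivative f (at q) w = (\<Sum>b\<in>Basis. (w \<bullet> b) *\<^sub>R frechet_derivative f (at q) b)"
proof -
  interpret bounded_linear "frechet_derivative f (at q)"
    using smooth_diff[OF assms] by (rule has_derivative_bounded_linear)
  have "frechet_derivative f (at q) w = frechet_derivative f (at q) (\<Sum>b\<in>Basis. (w \<bullet> b) *\<^sub>R b)"
    by (simp add: euclidean_representation)
  then show ?thesis by (simp add: sum scaleR)
qed

text \<open>Stated for the linear map \<open>D\<close> only through its expansion in the basis, so that it applies to a
  derivative as well as to the difference of two derivatives.\<close>

lemma norm_linear_le_Basis:
  fixes D :: "'a::euclidean_space \<Rightarrow> 'b::real_normed_vector"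
  assumes "\<And>w. D w = (\<Sum>b\<in>Basis. (w \<bullet> b) *\<^sub>R D b)" "\<And>b. b \<in> Basis \<Longrightarrow> norm (D b) \<le> B b"
  shows "norm (D w) \<le> sum B Basis * norm w"
proof -
  have "norm (D w) \<le> (\<Sum>b\<in>Basis. norm ((w \<bullet> b) *\<^sub>R D b))"
    by (subst assms(1)) (rule norm_sum)
  also have "\<dots> \<le> (\<Sum>b\<in>Basis. norm w * B b)"
    using assms(2) by (intro sum_mono) (auto intro!: mult_mono Basis_le_norm)
  finally show ?thesis by (simp add: sum_distrib_left mult.commute)
qed

lemma test_Lipschitz:
  fixes f :: "'a::euclidean_space \<Rightarrow> 'b::real_normed_vector"
  assumes f: "f \<in> test_functions"
  shows "\<exists>M\<ge>0. \<forall>q q'. norm (f q - f q') \<le> M * norm (q - q')"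
proof -
  have s: "smooth f" using f by (rule test_smooth)
  have "\<forall>b. \<exists>B\<ge>0. \<forall>q. norm (frechet_derivative f (at q) b) \<le> B"
    using test_bounded[OF test_deriv[OF f]] by metis
  then obtain B where B: "\<And>b. 0 \<le> B b" "\<And>b q. norm (frechet_derivative f (at q) b) \<le> B b" by metis
  have "norm (frechet_derivative f (at q) w) \<le> sum B Basis * norm w" for q w
    by (rule norm_linear_le_Basis[OF frechet_derivative_Basis[OF s]]) (rule B)
  then have "onorm (frechet_derivative f (at q)) \<le> sum B Basis" for q
    by (intro onorm_le)
  then have "norm (f q - f q') \<le> sum B Basis * norm (q - q')" for q q'
    by (intro differentiable_bound[of UNIV f "\<lambda>q. frechet_derivative f (at q)"] smooth_diff[OF s]) auto
  then show ?thesis using B by (intro exI[of _ "sum B Basis"]) (auto intro: sum_nonneg)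
qed

text \<open>The quadratic error is uniform because the first derivatives are themselves test functions and
  hence Lipschitz.\<close>

lemma test_Taylor:
  fixes f :: "'a::euclidean_space \<Rightarrow> 'b::real_normed_vector"
  assumes f: "f \<in> test_functions"
  shows "\<exists>M\<ge>0. \<forall>q h. norm (f (q + h) - f q - frechet_derivative f (at q) h) \<le> M * (norm h)\<^sup>2"
proof -
  have s: "smooth f" using f by (rule test_smooth)
  have "\<forall>b. \<exists>M\<ge>0. \<forall>q q'. norm (frechet_derivative f (at q) b - frechet_derivative f (at q') b) \<le> M * norm (q - q')"
    using test_Lipschitz[OF test_deriv[OF f]] by blast
  then obtain B where B: "\<And>b. 0 \<le> B b"
    "\<And>b q q'. norm (frechet_derivative f (at q) b - frechet_derivative f (at q') b) \<le> B b * norm (q - q')" by metis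
  have L: "norm (frechet_derivative f (at q) w - frechet_derivative f (at q') w)
      \<le> sum B Basis * norm (q - q') * norm w" for q q' w
  proof -
    have "norm (frechet_derivative f (at q) w - frechet_derivative f (at q') w)
      \<le> (\<Sum>b\<in>Basis. B b * norm (q - q')) * norm w"
    proof (rule norm_linear_le_Basis)
      show "frechet_derivative f (at q) w - frechet_derivative f (at q') w =
          (\<Sum>b\<in>Basis. (w \<bullet> b) *\<^sub>R (frechet_derivative f (at q) b - frechet_derivative f (at q') b))" for w
        by (subst (1 2) frechet_derivative_Basis[OF s]) (simp add: scaleR_diff_right sum_subtractf)
    qed (rule B)
    then show ?thesis by (simp add: sum_distrib_right)
  qed
  have "norm (f (q + h) - f q - frechet_derivative f (at q) h) \<le> sum B Basis * (norm h)\<^sup>2" for q h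
  proof -
    have "norm (f (q + h) - f q - frechet_derivative f (at q) ((q + h) - q)) \<le> norm ((q + h) - q) * (sum B Basis * norm h)"
    proof (rule differentiable_bound_linearization[of q "q + h" "cball q (norm h)" f "\<lambda>x. frechet_derivative f (at x)"])
      show "q + t *\<^sub>R (q + h - q) \<in> cball q (norm h)" if "t \<in> {0..1}" for t
        using that by (auto simp: dist_norm intro!: mult_left_le_one_le)
      show "(f has_derivative frechet_derivative f (at x)) (at x within cball q (norm h))" for x
        by (rule has_derivative_at_withinI[OF smooth_diff[OF s]])
      show "onorm (frechet_derivative f (at x) - frechet_derivative f (at q)) \<le> sum B Basis * norm h"
        if "x \<in> cball q (norm h)" for x
      proof (rule onorm_le)
        fix w
        have "norm (frechet_derivative f (at x) w - frechet_derivative f (at q) w) \<le> sum B Basis * norm (x - q) * norm w"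
          by (rule L)
        also have "\<dots> \<le> sum B Basis * norm h * norm w"
          using that B(1) by (intro mult_right_mono mult_left_mono) (auto simp: dist_norm norm_minus_commute intro: sum_nonneg)
        finally show "norm ((frechet_derivative f (at x) - frechet_derivative f (at q)) w) \<le> sum B Basis * norm h * norm w"
          by (simp add: fun_diff_def)
      qed
    qed simp
    then show ?thesis by (simp add: power2_eq_square mult_ac)
  qed
  then show ?thesis using B by (intro exI[of _ "sum B Basis"]) (auto intro: sum_nonneg)
qed

section \<open>Convolution on the group\<close>

text \<open>The boxes exhaust the group, and every bounded set lies in one of them.\<close>

definition locally_integrable :: "(heis \<Rightarrow> complex) \<Rightarrow> bool" where
  "locally_integrable v \<longleftrightarrow> v \<in> borel_measurable borel \<and>
     (\<forall>r. (\<integral>\<^sup>+y. ennreal (norm (v y)) * indicator (hbox r) y \<partial>lborel) < \<infinity>)"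

text \<open>The group convolution of \<open>\<phi>\<close> and \<open>v\<close>, written so that the variable \<open>x\<close> occurs in \<open>\<phi>\<close> only: derivatives fall
  on \<open>\<phi>\<close>. In \<open>hconv_alt\<close> it is a superposition of left translates of \<open>v\<close>, which commutes
  with the left invariant \<open>Zbar\<close>.\<close>

definition hconv :: "(heis \<Rightarrow> complex) \<Rightarrow> (heis \<Rightarrow> complex) \<Rightarrow> heis \<Rightarrow> complex" where
  "hconv \<phi> v x = (\<integral>y. \<phi> (hmul x (- y)) * v y \<partial>lborel)"

lemma hconv_alt:
  assumes [measurable]: "\<phi> \<in> borel_measurable borel" "v \<in> borel_measurable borel"
  shows "hconv \<phi> v x = (\<integral>q. \<phi> q * v (hmul (- q) x) \<partial>lborel)"
proof -
  have "(\<integral>q. \<phi> q * v (hmul (- q) x) \<partial>lborel) = (\<integral>q. (\<lambda>y. \<phi> (hmul x (- y)) * v y) (hmul (- q) x) \<partial>lborel)"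
    by (simp add: minus_hmul)
  also have "\<dots> = (\<integral>y. \<phi> (hmul x (- y)) * v y \<partial>lborel)"
    by (rule integral_preserve(1)[OF distr_inverse_hmul]) measurable
  finally show ?thesis by (simp add: hconv_def)
qed

lemma bounded_imp_hbox: assumes "bounded S" shows "\<exists>r. S \<subseteq> hbox r"
proof -
  have "compact (hgauge ` closure S)"
    using assms by (intro compact_continuous_image continuous_on_subset[OF continuous_on_hgauge]) (auto simp: compact_closure)
  then obtain r where "\<forall>x\<in>hgauge ` closure S. norm x \<le> r" by (auto dest!: compact_imp_bounded simp: bounded_iff)
  then show ?thesis using closure_subset[of S] by (intro exI[of _ r]) (force simp: hbox_def)
qed

lemma locally_integrable_hbox:
  assumes "locally_integrable v" shows "integrable lborel (\<lambda>y. indicator (hbox r) y * v y)"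
    "integrable lborel (\<lambda>y. indicator (hbox r) y * norm (v y))"
proof -
  have [measurable]: "v \<in> borel_measurable borel" using assms by (simp add: locally_integrable_def)
  have fin: "(\<integral>\<^sup>+y. ennreal (norm (v y)) * indicator (hbox r) y \<partial>lborel) < \<infinity>"
    using assms by (auto simp: locally_integrable_def)
  have "(\<lambda>y. ennreal (norm (indicator (hbox r) y * v y))) = (\<lambda>y. ennreal (norm (v y)) * indicator (hbox r) y)"
    by (auto simp: indicator_def fun_eq_iff)
  then show *: "integrable lborel (\<lambda>y. indicator (hbox r) y * v y)"
    using fin by (simp add: integrable_iff_bounded)
  have "norm (indicator (hbox r) y * v y) = indicator (hbox r) y * norm (v y)" for y
    by (simp add: indicator_def)
  with integrable_norm[OF *] show "integrable lborel (\<lambda>y. indicator (hbox r) y * norm (v y))"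
    by (simp only:)
qed

lemma locally_integrable_mult:
  assumes v: "locally_integrable v" and c: "continuous_on UNIV c"
  shows "locally_integrable (\<lambda>y. c y * v y)"
proof -
  have [measurable]: "v \<in> borel_measurable borel" using v by (simp add: locally_integrable_def)
  have [measurable]: "c \<in> borel_measurable borel" using c by (rule borel_measurable_continuous_onI)
  have "(\<integral>\<^sup>+y. ennreal (norm (c y * v y)) * indicator (hbox r) y \<partial>lborel) < \<infinity>" for r
  proof -
    have "compact (closure (hbox r))" using bounded_hbox by (simp add: compact_closure)
    then have "compact (c ` closure (hbox r))" using c by (intro compact_continuous_image) (auto intro: continuous_on_subset)
    then obtain B where "\<forall>x\<in>c ` closure (hbox r). norm x \<le> B" by (auto dest!: compact_imp_bounded simp: bounded_iff)
    then have B: "norm (c y) \<le> B" if "y \<in> hbox r" for y using that closure_subset by blast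
    have "(\<integral>\<^sup>+y. ennreal (norm (c y * v y)) * indicator (hbox r) y \<partial>lborel)
        \<le> (\<integral>\<^sup>+y. ennreal B * (ennreal (norm (v y)) * indicator (hbox r) y) \<partial>lborel)"
    proof (rule nn_integral_mono)
      fix y
      show "ennreal (norm (c y * v y)) * indicator (hbox r) y \<le> ennreal B * (ennreal (norm (v y)) * indicator (hbox r) y)"
      proof (cases "y \<in> hbox r")
        case True
        have "norm (c y * v y) \<le> B * norm (v y)" using B[OF True] by (auto simp: norm_mult intro: mult_right_mono)
        moreover have "0 \<le> B" using B[OF True] norm_ge_zero[of "c y"] by linarith
        ultimately show ?thesis using True by (simp add: ennreal_leI flip: ennreal_mult)
      qed simp
    qed
    also have "\<dots> < \<infinity>" using v by (auto simp: nn_integral_cmult locally_integrable_def ennreal_mult_less_top)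
    finally show ?thesis .
  qed
  then show ?thesis by (simp add: locally_integrable_def)
qed

text \<open>If \<open>x y\<^sup>-\<^sup>1\<close> lies in the support of \<open>\<phi>\<close>, then \<open>y\<close> lies in the set of all \<open>q\<^sup>-\<^sup>1 x\<close> with \<open>q\<close> in that support.\<close>

lemma support_hbox:
  assumes \<phi>: "\<phi> \<in> test_functions" and X: "bounded X"
  obtains r where "\<And>x y. x \<in> X \<Longrightarrow> y \<notin> hbox r \<Longrightarrow> hmul x (- y) \<notin> closure {q. \<phi> q \<noteq> 0}"
proof -
  define S where "S = closure {q. \<phi> q \<noteq> 0}"
  have "compact ((\<lambda>p. hmul (- fst p) (snd p)) ` (S \<times> closure X))"
    using \<phi> X by (intro compact_continuous_image compact_Times continuous_intros)
      (auto simp: S_def test_functions_def compact_closure)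
  then obtain r where r: "(\<lambda>p. hmul (- fst p) (snd p)) ` (S \<times> closure X) \<subseteq> hbox r"
    using bounded_imp_hbox compact_imp_bounded by blast
  show ?thesis
  proof (rule that[of r], rule notI)
    fix x y assume a: "x \<in> X" "y \<notin> hbox r" "hmul x (- y) \<in> closure {q. \<phi> q \<noteq> 0}"
    then have "(hmul x (- y), x) \<in> S \<times> closure X" using closure_subset by (auto simp: S_def)
    then have "hmul (- hmul x (- y)) x \<in> hbox r" using r by force
    then show False using a(2) by (simp add: minus_hmul)
  qed
qed

lemma hconv_integrable:
  assumes \<phi>: "\<phi> \<in> test_functions" and v: "locally_integrable v"
  shows "integrable lborel (\<lambda>y. \<phi> (hmul x (- y)) * v y)"
proof -
  have [measurable]: "v \<in> borel_measurable borel" using v by (simp add: locally_integrable_def)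
  have [measurable]: "\<phi> \<in> borel_measurable borel" by (rule test_measurable[OF \<phi>])
  obtain B where B: "\<And>x. norm (\<phi> x) \<le> B" "0 \<le> B" using test_bounded[OF \<phi>] by blast
  obtain r where r: "\<And>x' y. x' \<in> cball x 1 \<Longrightarrow> y \<notin> hbox r \<Longrightarrow> hmul x' (- y) \<notin> closure {q. \<phi> q \<noteq> 0}"
    using support_hbox[OF \<phi> bounded_cball] by blast
  have "integrable lborel (\<lambda>y. B * (indicator (hbox r) y * norm (v y)))"
    using locally_integrable_hbox(2)[OF v] by (rule integrable_mult_right)
  then show ?thesis
  proof (rule Bochner_Integration.integrable_bound)
    show "AE y in lborel. norm (\<phi> (hmul x (- y)) * v y) \<le> norm (B * (indicator (hbox r) y * norm (v y)))"
    proof (rule AE_I2)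
      fix y
      show "norm (\<phi> (hmul x (- y)) * v y) \<le> norm (B * (indicator (hbox r) y * norm (v y)))"
        using B r[of x y] test_zero[OF \<phi>, of "hmul x (- y)"]
        by (cases "y \<in> hbox r") (auto simp: norm_mult mult_right_mono)
    qed
  qed measurable
qed

text \<open>Differentiation under the integral sign. The product \<open>x y\<^sup>-\<^sup>1\<close> is affine in \<open>x\<close>, and the coefficients of its
  linear part are affine in \<open>y\<close>; they are absorbed in \<open>v\<close>, so that the derivative is again a combination of
  convolutions of test functions with locally integrable functions, and induction gives smoothness.\<close>

lemma hconv_has_derivative:
  assumes \<phi>: "\<phi> \<in> test_functions" and v: "locally_integrable v"
  defines "D \<equiv> \<lambda>h q. frechet_derivative \<phi> (at q) h"
  shows "(hconv \<phi> v has_derivative (\<lambda>h.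
      of_real (Re (fst h)) * (hconv (D (1,0)) v x + 2 * hconv (D (0,1)) (\<lambda>y. of_real (Im (fst y)) * v y) x)
    + of_real (Im (fst h)) * (hconv (D (\<i>,0)) v x - 2 * hconv (D (0,1)) (\<lambda>y. of_real (Re (fst y)) * v y) x)
    + of_real (snd h) * hconv (D (0,1)) v x)) (at x)" (is "(_ has_derivative ?F) _")
proof -
  have [measurable]: "v \<in> borel_measurable borel" using v by (simp add: locally_integrable_def)
  have s: "smooth \<phi>" by (rule test_smooth[OF \<phi>])
  have DT: "D h \<in> test_functions" for h unfolding D_def by (rule test_deriv[OF \<phi>])
  have Dlin: "D h q = of_real (Re (fst h)) * D (1,0) q + of_real (Im (fst h)) * D (\<i>,0) q + of_real (snd h) * D (0,1) q" for h q
    unfolding D_def by (subst frechet_derivative_Basis[OF s])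
      (simp add: Basis_prod_def sum.union_disjoint inner_prod_def Basis_complex_def image_Un sum.reindex scaleR_conv_of_real)
  \<comment> \<open>The increment of \<open>x y\<^sup>-\<^sup>1\<close> caused by the increment \<open>h\<close> of \<open>x\<close>.\<close>
  define L where "L y h = (fst h, snd h - 2 * (Im (fst h) * Re (fst y) - Re (fst h) * Im (fst y)))" for y h :: heis
  have hL: "hmul (x + h) (- y) = hmul x (- y) + L y h" for h y
    by (simp add: hmul_def L_def prod_eq_iff algebra_simps)
  have lR: "locally_integrable (\<lambda>y. of_real (Re (fst y)) * v y)" "locally_integrable (\<lambda>y. of_real (Im (fst y)) * v y)"
    by (intro locally_integrable_mult v continuous_intros)+
  note I = hconv_integrable[OF \<phi> v] hconv_integrable[OF DT v, of _ x] hconv_integrable[OF DT lR(1), of _ x] hconv_integrable[OF DT lR(2), of _ x]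
  have F: "?F h = (\<integral>y. D (L y h) (hmul x (- y)) * v y \<partial>lborel)"
      and FI: "integrable lborel (\<lambda>y. D (L y h) (hmul x (- y)) * v y)" for h
  proof -
    have *: "(\<lambda>y. D (L y h) (hmul x (- y)) * v y) = (\<lambda>y. of_real (Re (fst h)) * (D (1,0) (hmul x (- y)) * v y
        + 2 * (D (0,1) (hmul x (- y)) * (of_real (Im (fst y)) * v y)))
      + of_real (Im (fst h)) * (D (\<i>,0) (hmul x (- y)) * v y
        - 2 * (D (0,1) (hmul x (- y)) * (of_real (Re (fst y)) * v y)))
      + of_real (snd h) * (D (0,1) (hmul x (- y)) * v y))"
      by (subst Dlin) (simp add: L_def algebra_simps fun_eq_iff)
    show "?F h = (\<integral>y. D (L y h) (hmul x (- y)) * v y \<partial>lborel)"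
      unfolding * hconv_def using I by simp
    show "integrable lborel (\<lambda>y. D (L y h) (hmul x (- y)) * v y)"
      unfolding * using I by (intro Bochner_Integration.integrable_add Bochner_Integration.integrable_diff integrable_mult_right) auto
  qed
  obtain M where M: "0 \<le> M" "\<And>q h. norm (\<phi> (q + h) - \<phi> q - D h q) \<le> M * (norm h)\<^sup>2"
    using test_Taylor[OF \<phi>] unfolding D_def by blast
  obtain r where r: "\<And>x' y. x' \<in> cball x 1 \<Longrightarrow> y \<notin> hbox r \<Longrightarrow> hmul x' (- y) \<notin> closure {q. \<phi> q \<noteq> 0}"
    using support_hbox[OF \<phi> bounded_cball] by blast
  define C where "C = M * (2 + 4 * \<bar>r\<bar>)\<^sup>2 * (\<integral>y. indicator (hbox r) y * norm (v y) \<partial>lborel)"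
  have tri: "\<bar>s - 2 * (a - b)\<bar> \<le> \<bar>s\<bar> + 2 * \<bar>a\<bar> + 2 * \<bar>b\<bar>" for s a b :: real
    by (smt (verit))
  have est: "norm (hconv \<phi> v (x + h) - hconv \<phi> v x - ?F h) \<le> C * (norm h)\<^sup>2" if h: "norm h \<le> 1" for h
  proof -
    define e where "e y = (\<phi> (hmul (x + h) (- y)) - \<phi> (hmul x (- y)) - D (L y h) (hmul x (- y))) * v y" for y
    have e_eq: "e = (\<lambda>y. \<phi> (hmul (x + h) (- y)) * v y - \<phi> (hmul x (- y)) * v y - D (L y h) (hmul x (- y)) * v y)"
      by (simp add: e_def fun_eq_iff algebra_simps)
    have eI: "integrable lborel e" unfolding e_eq using I FI by (intro Bochner_Integration.integrable_diff) auto
    have "hconv \<phi> v (x + h) - hconv \<phi> v x - ?F h = (\<integral>y. e y \<partial>lborel)"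
      unfolding F unfolding e_eq hconv_def using I FI by simp
    also have "norm \<dots> \<le> (\<integral>y. norm (e y) \<partial>lborel)" by (rule integral_norm_bound)
    also have "\<dots> \<le> (\<integral>y. M * (2 + 4 * \<bar>r\<bar>)\<^sup>2 * (norm h)\<^sup>2 * (indicator (hbox r) y * norm (v y)) \<partial>lborel)"
    proof (rule integral_mono)
      show "integrable lborel (\<lambda>y. norm (e y))" using eI by simp
      show "integrable lborel (\<lambda>y. M * (2 + 4 * \<bar>r\<bar>)\<^sup>2 * (norm h)\<^sup>2 * (indicator (hbox r) y * norm (v y)))"
        by (intro integrable_mult_right locally_integrable_hbox v)
      fix y
      show "norm (e y) \<le> M * (2 + 4 * \<bar>r\<bar>)\<^sup>2 * (norm h)\<^sup>2 * (indicator (hbox r) y * norm (v y))"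
      proof (cases "y \<in> hbox r")
        case True
        have y: "\<bar>Re (fst y)\<bar> \<le> \<bar>r\<bar>" "\<bar>Im (fst y)\<bar> \<le> \<bar>r\<bar>"
          using True hgauge_bounds[of y] by (auto simp: hbox_def)
        have hh: "\<bar>Re (fst h)\<bar> \<le> norm h" "\<bar>Im (fst h)\<bar> \<le> norm h" "norm (fst h) \<le> norm h" "\<bar>snd h\<bar> \<le> norm h"
          using norm_fst_le[of "fst h" "snd h"] norm_snd_le[of "snd h" "fst h"] abs_Re_le_cmod[of "fst h"] abs_Im_le_cmod[of "fst h"]
          by auto
        have "\<bar>Im (fst h) * Re (fst y)\<bar> \<le> norm h * \<bar>r\<bar>" "\<bar>Re (fst h) * Im (fst y)\<bar> \<le> norm h * \<bar>r\<bar>"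
          unfolding abs_mult by (rule mult_mono[OF hh(2) y(1)] mult_mono[OF hh(1) y(2)]; simp)+
        then have "norm (snd (L y h)) \<le> norm h + 4 * (norm h * \<bar>r\<bar>)"
          using hh(4) tri[of "snd h" "Im (fst h) * Re (fst y)" "Re (fst h) * Im (fst y)"]
          unfolding L_def snd_conv real_norm_def by linarith
        moreover have "norm (L y h) \<le> norm (fst (L y h)) + norm (snd (L y h))"
          by (metis norm_Pair_le prod.collapse)
        ultimately have "norm (L y h) \<le> (2 + 4 * \<bar>r\<bar>) * norm h"
          using hh(3) by (simp add: L_def algebra_simps)
        then have "(norm (L y h))\<^sup>2 \<le> ((2 + 4 * \<bar>r\<bar>) * norm h)\<^sup>2" by (intro power_mono) auto
        then have "M * (norm (L y h))\<^sup>2 \<le> M * ((2 + 4 * \<bar>r\<bar>) * norm h)\<^sup>2" using M by (intro mult_left_mono)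
        with M(2)[of "hmul x (- y)" "L y h"]
        have "norm (\<phi> (hmul (x + h) (- y)) - \<phi> (hmul x (- y)) - D (L y h) (hmul x (- y))) \<le> M * ((2 + 4 * \<bar>r\<bar>) * norm h)\<^sup>2"
          by (simp add: hL)
        from mult_right_mono[OF this, of "norm (v y)"] show ?thesis
          using True by (simp add: e_def norm_mult power_mult_distrib mult_ac)
      next
        case False
        have "hmul (x + h) (- y) \<notin> closure {q. \<phi> q \<noteq> 0}" "hmul x (- y) \<notin> closure {q. \<phi> q \<noteq> 0}"
          by (rule r[OF _ False]; use h in \<open>simp add: dist_norm\<close>)+
        from test_zero[OF \<phi> this(1)] test_zero[OF \<phi> this(2)] fd_zero[OF s this(2)]
        have "e y = 0" unfolding e_def D_def by simp
        then show ?thesis using False by simp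
      qed
    qed
    also have "\<dots> = C * (norm h)\<^sup>2" by (simp add: C_def)
    finally show ?thesis .
  qed
  show ?thesis
  proof (rule has_derivativeI_sandwich[where e=1 and H="\<lambda>y. C * norm (y - x)"])
    show "bounded_linear ?F"
      by (intro bounded_linear_add bounded_linear_mult_const bounded_linear_compose[OF bounded_linear_of_real]
          bounded_linear_compose[OF bounded_linear_Re] bounded_linear_compose[OF bounded_linear_Im] bounded_linear_fst bounded_linear_snd)
    show "norm (hconv \<phi> v y - hconv \<phi> v x - ?F (y - x)) / norm (y - x) \<le> C * norm (y - x)"
      if "y \<noteq> x" "dist y x < 1" for y
      using est[of "y - x"] that by (simp add: dist_norm divide_le_eq power2_eq_square mult_ac)
    have "((\<lambda>y. C * norm (y - x)) \<longlongrightarrow> C * norm (x - x)) (at x)" by (intro tendsto_intros)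
    then show "((\<lambda>y. C * norm (y - x)) \<longlongrightarrow> 0) (at x)" by simp
  qed auto
qed

lemma Ck_hconv: "\<phi> \<in> test_functions \<Longrightarrow> locally_integrable v \<Longrightarrow> Ck k (hconv \<phi> v)"
proof (induction k arbitrary: \<phi> v)
  case 0
  have "isCont (hconv \<phi> v) x" for x by (rule has_derivative_continuous[OF hconv_has_derivative[OF 0]])
  then show ?case by (simp add: continuous_at_imp_continuous_on)
next
  case (Suc k)
  note d = hconv_has_derivative[OF Suc.prems]
  have lR: "locally_integrable (\<lambda>y. of_real (Re (fst y)) * v y)" "locally_integrable (\<lambda>y. of_real (Im (fst y)) * v y)"
    by (intro locally_integrable_mult Suc.prems continuous_intros)+
  have DT: "(\<lambda>q. frechet_derivative \<phi> (at q) h) \<in> test_functions" for h by (rule test_deriv[OF Suc.prems(1)])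
  have minus: "Ck k (\<lambda>x. f x - g x)" if "Ck k f" "Ck k g" for f g :: "heis \<Rightarrow> complex"
    using Ck_add[OF that(1) Ck_mult[OF Ck_const[of k "-1"] that(2)]] by simp
  show ?case unfolding Ck.simps
  proof (intro conjI allI)
    show "hconv \<phi> v differentiable at x" for x using d by (rule differentiableI)
    show "Ck k (\<lambda>x. frechet_derivative (hconv \<phi> v) (at x) h)" for h
      unfolding fd_eq[OF d]
      by (intro Ck_add minus Ck_mult Ck_const Suc.IH DT lR Suc.prems(2))
  qed
qed

lemma smooth_hconv: "\<phi> \<in> test_functions \<Longrightarrow> locally_integrable v \<Longrightarrow> smooth (hconv \<phi> v)"
  by (simp add: smooth_def Ck_hconv)

section \<open>Dilations\<close>

text \<open>The automorphic dilations of the group, for which \<open>hgauge\<close> is homogeneous of degree \<open>1\<close>.\<close>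

definition dilation :: "real \<Rightarrow> heis \<Rightarrow> heis" where "dilation s p = (s *\<^sub>R fst p, s\<^sup>2 * snd p)"

lemma measurable_dilation [measurable]: "dilation s \<in> borel_measurable borel"
  unfolding dilation_def by (intro borel_measurable_continuous_onI continuous_intros)

lemma integral_dilation:
  fixes f :: "heis \<Rightarrow> complex"
  assumes s: "0 < s" and [measurable]: "f \<in> borel_measurable borel"
  shows "(\<integral>p. f p \<partial>lborel) = (\<integral>p. of_real (s ^ 4) * f (dilation s p) \<partial>lborel)"
proof -
  define c :: "heis \<Rightarrow> real" where "c j = (if fst j = 0 then s\<^sup>2 else s)" for j
  have B: "(Basis :: heis set) = {(1,0),(\<i>,0),(0,1)}"
    by (auto simp: Basis_prod_def Basis_complex_def)
  \<comment> \<open>The dilation as the diagonal map with entries \<open>s, s, s\<^sup>2\<close> in the standard basis; its determinant is \<open>s\<^sup>4\<close>.\<close>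
  have T: "0 + (\<Sum>j\<in>Basis. (c j * (x \<bullet> j)) *\<^sub>R j) = dilation s x" for x
    unfolding B c_def dilation_def by (auto simp: inner_prod_def prod_eq_iff complex_eq_iff)
  have P: "(\<Prod>j\<in>Basis. \<bar>c j\<bar>) = s ^ 4"
    unfolding B c_def using s by (auto simp: eval_nat_numeral)
  have "c j \<noteq> 0" for j using s by (simp add: c_def)
  from lborel_affine_euclidean[of c 0, OF this]
  have "lborel = density (distr lborel borel (dilation s)) (\<lambda>_. ennreal (s ^ 4))"
    unfolding T P by simp
  then have "(\<integral>p. f p \<partial>lborel) = (\<integral>p. f p \<partial>density (distr lborel borel (dilation s)) (\<lambda>_. ennreal (s ^ 4)))"
    by simp
  also have "\<dots> = (\<integral>p. s ^ 4 *\<^sub>R f p \<partial>distr lborel borel (dilation s))"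
    using s by (subst integral_density) auto
  also have "\<dots> = (\<integral>p. s ^ 4 *\<^sub>R f (dilation s p) \<partial>lborel)"
    by (subst integral_distr) auto
  finally show ?thesis by (simp add: scaleR_conv_of_real)
qed

section \<open>The regularised kernels\<close>

text \<open>The boundary coordinate \<open>z\<^sub>2 = t + \<i>\<bar>z\<bar>\<^sup>2\<close>, moved by \<open>\<i>\<epsilon>\<close> into the interior of the domain. It
  does not vanish for \<open>\<epsilon> > 0\<close>, which makes the three kernels below smooth.\<close>

definition cr_coord :: "real \<Rightarrow> heis \<Rightarrow> complex" where
  "cr_coord \<epsilon> p = of_real (snd p) + \<i> * (fst p * cnj (fst p) + of_real \<epsilon>)"

text \<open>For \<open>\<epsilon> = 0\<close> this is \<open>z' / (t\<^sup>2 + \<bar>z\<bar>\<^sup>4)\<close>, with value \<open>0\<close> at the origin.\<close>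

definition Zbar_kernel :: "real \<Rightarrow> heis \<Rightarrow> complex" where
  "Zbar_kernel \<epsilon> p = cnj (fst p) / (cr_coord \<epsilon> p * cnj (cr_coord \<epsilon> p))"

text \<open>A multiple of the Szego kernel of the domain with one variable at a boundary point.\<close>

definition szego_kernel :: "real \<Rightarrow> heis \<Rightarrow> complex" where
  "szego_kernel \<epsilon> p = 1 / (cr_coord \<epsilon> p)\<^sup>2"

text \<open>The error term in \<open>Zbar_kernel_uminus\<close>: a function of fixed shape concentrating at the origin as
  \<open>\<epsilon>\<close> tends to \<open>0\<close>.\<close>

definition approx_identity :: "real \<Rightarrow> heis \<Rightarrow> complex" where
  "approx_identity \<epsilon> p = 2 * \<i> * of_real \<epsilon> / ((cr_coord \<epsilon> p)\<^sup>2 * cnj (cr_coord \<epsilon> p))"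

lemma cr_coord_parts: "Re (cr_coord \<epsilon> p) = snd p" "Im (cr_coord \<epsilon> p) = (norm (fst p))\<^sup>2 + \<epsilon>"
  by (simp_all add: cr_coord_def cmod_power2) (simp add: power2_eq_square)

lemma cr_coord_nonzero: "0 < \<epsilon> \<Longrightarrow> cr_coord \<epsilon> p \<noteq> 0"
  using cr_coord_parts(2)[of \<epsilon> p] by (metis add_nonneg_pos less_irrefl zero_complex.sel(2) zero_le_power2)

lemma norm_cr_coord: "(norm (cr_coord \<epsilon> p))\<^sup>2 = (snd p)\<^sup>2 + ((norm (fst p))\<^sup>2 + \<epsilon>)\<^sup>2"
  by (simp add: cmod_power2 cr_coord_parts)

lemma norm_cr_coord_ge: "0 \<le> \<epsilon> \<Longrightarrow> \<epsilon> \<le> norm (cr_coord \<epsilon> p)" "0 \<le> \<epsilon> \<Longrightarrow> (hgauge p)\<^sup>2 \<le> norm (cr_coord \<epsilon> p)"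
proof -
  assume \<epsilon>: "0 \<le> \<epsilon>"
  have im: "(norm (fst p))\<^sup>2 + \<epsilon> \<le> norm (cr_coord \<epsilon> p)" using abs_Im_le_cmod[of "cr_coord \<epsilon> p"] by (simp add: cr_coord_parts)
  then show "\<epsilon> \<le> norm (cr_coord \<epsilon> p)" by (smt (verit) zero_le_power2)
  have t: "\<bar>snd p\<bar> \<le> norm (cr_coord \<epsilon> p)" using abs_Re_le_cmod[of "cr_coord \<epsilon> p"] by (simp add: cr_coord_parts)
  have z: "(norm (fst p))\<^sup>2 \<le> norm (cr_coord \<epsilon> p)" using im \<epsilon> by linarith
  have xy: "\<bar>Re (fst p)\<bar>\<^sup>2 \<le> (norm (fst p))\<^sup>2" "\<bar>Im (fst p)\<bar>\<^sup>2 \<le> (norm (fst p))\<^sup>2"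
    by (simp_all add: cmod_power2)
  consider "hgauge p = \<bar>Re (fst p)\<bar>" | "hgauge p = \<bar>Im (fst p)\<bar>" | "hgauge p = sqrt \<bar>snd p\<bar>"
    by (metis hgauge_def max_def)
  then show "(hgauge p)\<^sup>2 \<le> norm (cr_coord \<epsilon> p)"
    using t z xy by cases auto
qed

lemma measurable_kernels [measurable]:
  "cr_coord \<epsilon> \<in> borel_measurable borel" "Zbar_kernel \<epsilon> \<in> borel_measurable borel"
  "szego_kernel \<epsilon> \<in> borel_measurable borel" "approx_identity \<epsilon> \<in> borel_measurable borel"
proof -
  show [measurable]: "cr_coord \<epsilon> \<in> borel_measurable borel"
    unfolding cr_coord_def by (intro borel_measurable_continuous_onI continuous_intros)
  have [measurable]: "(\<lambda>p. cnj (cr_coord \<epsilon> p)) \<in> borel_measurable borel" "(\<lambda>p::heis. cnj (fst p)) \<in> borel_measurable borel"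
    unfolding cr_coord_def by (intro borel_measurable_continuous_onI continuous_intros)+
  show "Zbar_kernel \<epsilon> \<in> borel_measurable borel" "szego_kernel \<epsilon> \<in> borel_measurable borel"
    "approx_identity \<epsilon> \<in> borel_measurable borel"
    unfolding Zbar_kernel_def szego_kernel_def approx_identity_def by measurable
qed

lemma smooth_cr_coord: "smooth (cr_coord \<epsilon>)"
  unfolding cr_coord_def
  by (intro smooth_add smooth_mult smooth_const smooth_cnj smooth_fst smooth_linear
     bounded_linear_compose[OF bounded_linear_of_real bounded_linear_snd])

lemma cr_coord_has_derivative:
  "(cr_coord \<epsilon> has_derivative (\<lambda>v. of_real (snd v) + \<i> * (fst v * cnj (fst p) + fst p * cnj (fst v)))) (at p)"
  unfolding cr_coord_def by (auto intro!: derivative_eq_intros simp: algebra_simps)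

lemma Zbar_cr_coord: "Zbar (cr_coord \<epsilon>) p = 0"
  by (subst Zbar_eq[OF cr_coord_has_derivative]) (simp add: algebra_simps)

lemma smooth_uminus: "smooth f \<Longrightarrow> smooth (\<lambda>p::heis. f (- p) :: complex)"
  using smooth_compose_affine[of f uminus 0] bounded_linear_minus[OF bounded_linear_ident] by simp

lemma cr_coord_uminus_has_derivative:
  "((\<lambda>p. cr_coord \<epsilon> (- p)) has_derivative (\<lambda>v. - of_real (snd v) + \<i> * (fst v * cnj (fst p) + fst p * cnj (fst v)))) (at p)"
  unfolding cr_coord_def by (auto intro!: derivative_eq_intros simp: algebra_simps)

lemma Zbar_cr_coord_uminus: "Zbar (\<lambda>p. cr_coord \<epsilon> (- p)) p = 2 * \<i> * fst p"
  by (subst Zbar_eq[OF cr_coord_uminus_has_derivative]) (simp add: algebra_simps)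

lemma Zbar_cnj_cr_coord_uminus: "Zbar (\<lambda>p. cnj (cr_coord \<epsilon> (- p))) p = 0"
proof -
  have "((\<lambda>p. cnj (cr_coord \<epsilon> (- p))) has_derivative
      (\<lambda>v. cnj (- of_real (snd v) + \<i> * (fst v * cnj (fst p) + fst p * cnj (fst v))))) (at p)"
    by (intro has_derivative_cnj cr_coord_uminus_has_derivative)
  from Zbar_eq[OF this] show ?thesis by (simp add: algebra_simps)
qed

lemma Zbar_inverse:
  assumes f: "smooth f" and nz: "\<And>p. f p \<noteq> 0"
  shows "Zbar (\<lambda>p. inverse (f p)) p = - Zbar f p / (f p)\<^sup>2"
proof -
  have "Zbar (\<lambda>p. f p * inverse (f p)) p = 0" using nz by (simp add: Zbar_const)
  then have "f p * Zbar (\<lambda>p. inverse (f p)) p + Zbar f p * inverse (f p) = 0"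
    using Zbar_mult[OF f smooth_inverse[OF f nz]] by simp
  then show ?thesis using nz[of p] by (simp add: field_simps power2_eq_square add_eq_0_iff)
qed

lemma Zbar_cnj_fst: "Zbar (\<lambda>p. cnj (fst p)) p = 1"
proof -
  have "((\<lambda>p. cnj (fst p)) has_derivative (\<lambda>v. cnj (fst v))) (at p)" by (auto intro!: derivative_eq_intros)
  from Zbar_eq[OF this] show ?thesis by simp
qed

lemma smooth_szego: assumes "0 < \<epsilon>" shows "smooth (szego_kernel \<epsilon>)"
proof -
  have "smooth (\<lambda>p. inverse (cr_coord \<epsilon> p) * inverse (cr_coord \<epsilon> p))"
    using cr_coord_nonzero[OF assms] by (intro smooth_mult smooth_inverse smooth_cr_coord) auto
  then show ?thesis by (simp add: szego_kernel_def[abs_def] power2_eq_square divide_inverse)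
qed

lemma Zbar_szego: assumes "0 < \<epsilon>" shows "Zbar (szego_kernel \<epsilon>) p = 0"
proof -
  have s: "smooth (\<lambda>p. inverse (cr_coord \<epsilon> p))"
    using cr_coord_nonzero[OF assms] by (intro smooth_inverse smooth_cr_coord) auto
  have "szego_kernel \<epsilon> = (\<lambda>p. inverse (cr_coord \<epsilon> p) * inverse (cr_coord \<epsilon> p))"
    by (simp add: szego_kernel_def[abs_def] power2_eq_square divide_inverse)
  then show ?thesis
    using Zbar_mult[OF s s] Zbar_inverse[OF smooth_cr_coord cr_coord_nonzero[OF assms]] by (simp add: Zbar_cr_coord)
qed

text \<open>The computation on which the solution rests. Inversion of the group turns the right invariant
  counterpart of \<open>Zbar\<close> into \<open>- Zbar\<close>. With \<open>v = cr_coord \<epsilon> (- p)\<close> one has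
  \<open>Zbar v = 2\<i>z\<close> and \<open>Zbar (cnj v) = 0\<close>, so that the quotient rule leaves \<open>(2\<i>\<bar>z\<bar>\<^sup>2 - v) / (v\<^sup>2 cnj v)\<close>, and the
  numerator equals \<open>- cnj v - 2\<i>\<epsilon>\<close>.\<close>

lemma Zbar_kernel_uminus:
  assumes "0 < \<epsilon>"
  shows "smooth (\<lambda>p. Zbar_kernel \<epsilon> (- p))"
    "Zbar (\<lambda>p. Zbar_kernel \<epsilon> (- p)) p = - (szego_kernel \<epsilon> (- p) + approx_identity \<epsilon> (- p))"
proof -
  define v where "v p = cr_coord \<epsilon> (- p)" for p
  have v: "smooth v" "smooth (\<lambda>p. cnj (v p))" unfolding v_def by (intro smooth_uminus smooth_cr_coord smooth_cnj)+
  have nz: "v p \<noteq> 0" "cnj (v p) \<noteq> 0" for p using cr_coord_nonzero[OF assms] by (auto simp: v_def)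
  have i: "smooth (\<lambda>p. inverse (v p))" "smooth (\<lambda>p. inverse (cnj (v p)))"
    by (intro smooth_inverse v nz)+
  have c: "smooth (\<lambda>p::heis. (- 1) * cnj (fst p))" by (intro smooth_mult smooth_const smooth_cnj smooth_fst)
  have K: "(\<lambda>p. Zbar_kernel \<epsilon> (- p)) = (\<lambda>p. ((- 1) * cnj (fst p)) * (inverse (v p) * inverse (cnj (v p))))"
    by (simp add: Zbar_kernel_def v_def fun_eq_iff divide_inverse)
  show "smooth (\<lambda>p. Zbar_kernel \<epsilon> (- p))" unfolding K by (intro smooth_mult[OF c] smooth_mult i)
  have Zv: "Zbar v p = 2 * \<i> * fst p" "Zbar (\<lambda>p. cnj (v p)) p = 0"
    unfolding v_def[abs_def] by (rule Zbar_cr_coord_uminus Zbar_cnj_cr_coord_uminus)+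
  have "Zbar (\<lambda>p. (- 1) * cnj (fst p)) p = - 1"
    using Zbar_cmult[OF smooth_cnj[OF smooth_fst], of "-1"] by (simp add: Zbar_cnj_fst)
  then have "Zbar (\<lambda>p. Zbar_kernel \<epsilon> (- p)) p
      = 2 * \<i> * (fst p * cnj (fst p)) / ((v p)\<^sup>2 * cnj (v p)) - 1 / (v p * cnj (v p))"
    unfolding K
    by (subst Zbar_mult[OF c smooth_mult[OF i]], subst Zbar_mult[OF i], subst Zbar_inverse[OF v(1) nz(1)],
        subst Zbar_inverse[OF v(2) nz(2)])
      (simp add: Zv divide_inverse)
  also have "\<dots> = (2 * \<i> * (fst p * cnj (fst p)) - v p) / ((v p)\<^sup>2 * cnj (v p))"
    using nz[of p] by (simp add: field_simps power2_eq_square)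
  also have "2 * \<i> * (fst p * cnj (fst p)) - v p = - (cnj (v p) + 2 * \<i> * of_real \<epsilon>)"
    by (simp add: v_def cr_coord_def algebra_simps)
  also have "- (cnj (v p) + 2 * \<i> * of_real \<epsilon>) / ((v p)\<^sup>2 * cnj (v p)) = - (szego_kernel \<epsilon> (- p) + approx_identity \<epsilon> (- p))"
    using nz[of p] by (simp add: szego_kernel_def approx_identity_def field_simps flip: v_def)
  finally show "Zbar (\<lambda>p. Zbar_kernel \<epsilon> (- p)) p = - (szego_kernel \<epsilon> (- p) + approx_identity \<epsilon> (- p))" .
qed

lemma hconv_uminus:
  assumes [measurable]: "\<phi> \<in> borel_measurable borel" "v \<in> borel_measurable borel"
  shows "hconv \<phi> v x = (\<integral>y. \<phi> (hmul x y) * v (- y) \<partial>lborel)"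
  unfolding hconv_def
  using integral_preserve(1)[OF distr_uminus, of "\<lambda>y. \<phi> (hmul x (- y)) * v y"] by simp

lemma continuous_locally_integrable:
  assumes "continuous_on UNIV v" shows "locally_integrable v"
proof -
  have "locally_integrable (\<lambda>_. 1)"
  proof -
    have "emeasure lborel (hbox r) < \<infinity>" for r
    proof -
      have "emeasure lborel (hbox r) \<le> emeasure lborel (hbox \<bar>r\<bar>)"
        by (intro emeasure_mono) (auto simp: hbox_def)
      also have "\<dots> < \<infinity>" by (simp add: emeasure_hbox)
      finally show ?thesis .
    qed
    then show ?thesis by (simp add: locally_integrable_def)
  qed
  from locally_integrable_mult[OF this assms] show ?thesis by simp
qed

lemma smooth_approx: assumes "0 < \<epsilon>" shows "smooth (approx_identity \<epsilon>)"
proof -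
  have "smooth (\<lambda>p. (2 * \<i> * of_real \<epsilon>) * (szego_kernel \<epsilon> p * inverse (cnj (cr_coord \<epsilon> p))))"
    using cr_coord_nonzero[OF assms]
    by (intro smooth_mult smooth_const smooth_szego assms smooth_inverse smooth_cnj smooth_cr_coord) auto
  then show ?thesis by (simp add: approx_identity_def[abs_def] szego_kernel_def divide_inverse)
qed

text \<open>Integration by parts after translating \<open>x\<close> to the origin, which left invariance permits.\<close>

lemma hconv_Zbar_kernel:
  assumes w: "w \<in> test_functions" and \<epsilon>: "0 < \<epsilon>"
  shows "hconv (Zbar w) (Zbar_kernel \<epsilon>) x = hconv w (szego_kernel \<epsilon>) x + hconv w (approx_identity \<epsilon>) x"
proof -
  define W where "W = (\<lambda>y. w (hmul x y))"
  have W: "W \<in> test_functions" unfolding W_def using w by (rule test_translate)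
  have [measurable]: "w \<in> borel_measurable borel" "Zbar w \<in> borel_measurable borel"
    by (intro test_measurable test_Zbar w)+
  have I: "integrable lborel (\<lambda>y. W y * szego_kernel \<epsilon> (- y))" "integrable lborel (\<lambda>y. W y * approx_identity \<epsilon> (- y))"
    using test_integrable[OF test_mult1[OF W smooth_uminus[OF smooth_szego[OF \<epsilon>]]]]
      test_integrable[OF test_mult1[OF W smooth_uminus[OF smooth_approx[OF \<epsilon>]]]] by (simp_all add: mult.commute)
  have "hconv (Zbar w) (Zbar_kernel \<epsilon>) x = (\<integral>y. Zbar W y * Zbar_kernel \<epsilon> (- y) \<partial>lborel)"
    unfolding W_def by (subst hconv_uminus) (auto simp: Zbar_translate test_smooth[OF w])
  also have "\<dots> = - (\<integral>y. W y * Zbar (\<lambda>p. Zbar_kernel \<epsilon> (- p)) y \<partial>lborel)"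
    by (rule Zbar_parts[OF W Zbar_kernel_uminus(1)[OF \<epsilon>]])
  also have "\<dots> = (\<integral>y. W y * szego_kernel \<epsilon> (- y) + W y * approx_identity \<epsilon> (- y) \<partial>lborel)"
    by (simp add: Zbar_kernel_uminus(2)[OF \<epsilon>] algebra_simps flip: integral_minus)
  also have "\<dots> = hconv w (szego_kernel \<epsilon>) x + hconv w (approx_identity \<epsilon>) x"
    using I by (simp add: hconv_uminus W_def)
  finally show ?thesis .
qed

section \<open>The Szego term is annihilated weakly\<close>

lemma fubini_swap:
  fixes F :: "heis \<times> heis \<Rightarrow> complex"
  assumes [measurable]: "F \<in> borel_measurable borel"
    and b: "(\<integral>\<^sup>+q. \<integral>\<^sup>+x. ennreal (norm (F (q, x))) \<partial>lborel \<partial>lborel) < \<infinity>"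
  shows "(\<integral>x. \<integral>q. F (q, x) \<partial>lborel \<partial>lborel) = (\<integral>q. \<integral>x. F (q, x) \<partial>lborel \<partial>lborel)"
proof -
  have m [measurable]: "F \<in> borel_measurable (lborel \<Otimes>\<^sub>M lborel)" by (simp add: lborel_prod)
  have "(\<integral>\<^sup>+p. ennreal (norm (F p)) \<partial>(lborel \<Otimes>\<^sub>M lborel)) < \<infinity>"
    using b by (subst lborel.nn_integral_fst[symmetric]) auto
  then have "integrable (lborel \<Otimes>\<^sub>M lborel) (case_prod (\<lambda>q x. F (q, x)))"
    by (simp add: integrable_iff_bounded)
  from lborel_pair.Fubini_integral[OF this] show ?thesis .
qed

lemma measurable_fst_snd:
  "(fst :: heis \<times> heis \<Rightarrow> heis) \<in> borel_measurable borel" "(snd :: heis \<times> heis \<Rightarrow> heis) \<in> borel_measurable borel"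
  by (intro borel_measurable_continuous_onI continuous_intros)+

lemma norm_integral_le:
  fixes f :: "'a \<Rightarrow> complex"
  assumes g: "integrable M g" and f: "f \<in> borel_measurable M" and le: "\<And>x. norm (f x) \<le> g x"
  shows "norm (\<integral>x. f x \<partial>M) \<le> (\<integral>x. g x \<partial>M)"
proof -
  have i: "integrable M f"
    by (rule Bochner_Integration.integrable_bound[OF g f], intro AE_I2)
      (metis le abs_ge_self order_trans real_norm_def)
  have "norm (\<integral>x. f x \<partial>M) \<le> (\<integral>x. norm (f x) \<partial>M)" by (rule integral_norm_bound)
  also have "\<dots> \<le> (\<integral>x. g x \<partial>M)" using i g le by (intro integral_mono) auto
  finally show ?thesis .
qed

lemma test_norm_finite:
  assumes "w \<in> test_functions" shows "(\<integral>\<^sup>+q. ennreal (norm (w q :: complex)) \<partial>lborel) < \<infinity>"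
  using test_integrable[OF assms] by (simp add: integrable_iff_bounded)

lemma norm_szego_le: assumes "0 < \<epsilon>" shows "norm (szego_kernel \<epsilon> p) \<le> 1 / \<epsilon>\<^sup>2"
  using norm_cr_coord_ge(1)[of \<epsilon> p] assms
  by (auto simp: szego_kernel_def norm_divide norm_power intro!: divide_left_mono power_mono mult_pos_pos zero_less_power)

text \<open>The convolution is a superposition of left translates of the Szego kernel, and \<open>Zbar\<close> annihilates
  each of them.\<close>

lemma hconv_szego_weak_CR:
  assumes w: "w \<in> test_functions" and \<phi>: "\<phi> \<in> test_functions" and \<epsilon>: "0 < \<epsilon>"
  shows "(\<integral>x. hconv w (szego_kernel \<epsilon>) x * Zbar \<phi> x \<partial>lborel) = 0"
proof -
  have [measurable]: "w \<in> borel_measurable borel" "Zbar \<phi> \<in> borel_measurable borel"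
    by (intro test_measurable test_Zbar w \<phi>)+
  define F where "F = (\<lambda>p. w (fst p) * szego_kernel \<epsilon> (hmul (- fst p) (snd p)) * Zbar \<phi> (snd p))"
  note measurable_fst_snd [measurable]
  have [measurable]: "F \<in> borel_measurable borel"
    unfolding F_def by measurable
  have Fb: "(\<integral>\<^sup>+q. \<integral>\<^sup>+x. ennreal (norm (F (q, x))) \<partial>lborel \<partial>lborel) < \<infinity>"
  proof -
    have "ennreal (norm (F (q, x))) \<le> ennreal (1 / \<epsilon>\<^sup>2) * ennreal (norm (w q)) * ennreal (norm (Zbar \<phi> x))" for q x
    proof -
      have "norm (F (q, x)) \<le> 1 / \<epsilon>\<^sup>2 * norm (w q) * norm (Zbar \<phi> x)"
        using mult_right_mono[OF norm_szego_le[OF \<epsilon>, of "hmul (- q) x"], of "norm (w q) * norm (Zbar \<phi> x)"]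
        by (simp add: F_def norm_mult mult_ac)
      then show ?thesis using \<epsilon> by (simp add: ennreal_leI flip: ennreal_mult)
    qed
    then have "(\<integral>\<^sup>+q. \<integral>\<^sup>+x. ennreal (norm (F (q, x))) \<partial>lborel \<partial>lborel)
       \<le> (\<integral>\<^sup>+q. \<integral>\<^sup>+x. ennreal (1 / \<epsilon>\<^sup>2) * ennreal (norm (w q)) * ennreal (norm (Zbar \<phi> x)) \<partial>lborel \<partial>lborel)"
      by (intro nn_integral_mono)
    also have "\<dots> = ennreal (1 / \<epsilon>\<^sup>2) * (\<integral>\<^sup>+q. ennreal (norm (w q)) \<partial>lborel) * (\<integral>\<^sup>+x. ennreal (norm (Zbar \<phi> x)) \<partial>lborel)"
      by (simp add: nn_integral_cmult nn_integral_multc)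
    also have "\<dots> < \<infinity>" using test_norm_finite[OF w] test_norm_finite[OF test_Zbar[OF \<phi>]]
      by (simp add: ennreal_mult_less_top)
    finally show ?thesis .
  qed
  have 1: "hconv w (szego_kernel \<epsilon>) x * Zbar \<phi> x = (\<integral>q. F (q, x) \<partial>lborel)" for x
    by (simp add: hconv_alt F_def)
  have 2: "(\<integral>x. F (q, x) \<partial>lborel) = 0" for q
  proof -
    have s: "smooth (\<lambda>x. szego_kernel \<epsilon> (hmul (- q) x))" by (rule smooth_translate[OF smooth_szego[OF \<epsilon>]])
    have "(\<integral>x. F (q, x) \<partial>lborel) = w q * (\<integral>x. Zbar \<phi> x * szego_kernel \<epsilon> (hmul (- q) x) \<partial>lborel)"
      by (simp add: F_def mult_ac)
    also have "(\<integral>x. Zbar \<phi> x * szego_kernel \<epsilon> (hmul (- q) x) \<partial>lborel) = 0"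
      by (simp add: Zbar_parts[OF \<phi> s] Zbar_translate[OF smooth_szego[OF \<epsilon>]] Zbar_szego[OF \<epsilon>])
    finally show ?thesis by simp
  qed
  show ?thesis unfolding 1 using fubini_swap[OF _ Fb] by (simp add: 2)
qed

section \<open>The approximate identity\<close>

text \<open>The constant \<open>c = \<pi>\<^sup>2\<close> of the introduction. It is nonzero because the integrand has positive
  real part.\<close>

definition delta_mass :: complex where "delta_mass = (\<integral>p. approx_identity 1 p \<partial>lborel)"

text \<open>Its modulus is \<open>2 / \<bar>\<zeta> + \<i>\<bar>\<^sup>3\<close>, bounded near the origin and at most \<open>2 N\<^sup>-\<^sup>6\<close> for the gauge \<open>N\<close>, in homogeneous
  dimension 4.\<close>

lemma integrable_approx: "integrable lborel (approx_identity 1)"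
proof -
  have "norm (approx_identity 1 p) \<le> 2 * indicator (hbox 1) p + 2 * (if hgauge p < 1 then 0 else inverse (hgauge p) ^ 6)" for p
  proof -
    have n: "norm (approx_identity 1 p) = 2 / norm (cr_coord 1 p) ^ 3"
      by (simp add: approx_identity_def norm_divide norm_mult norm_power eval_nat_numeral)
    show ?thesis
    proof (cases "hgauge p < 1")
      case True
      have "2 / norm (cr_coord 1 p) ^ 3 \<le> 2 / 1 ^ 3"
        using norm_cr_coord_ge(1)[of 1 p] by (intro divide_left_mono power_mono) auto
      with True show ?thesis by (simp add: n hbox_def)
    next
      case False
      have "2 / norm (cr_coord 1 p) ^ 3 \<le> 2 / ((hgauge p)\<^sup>2) ^ 3"
        using norm_cr_coord_ge(2)[of 1 p] norm_cr_coord_ge(1)[of 1 p] False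
        by (intro divide_left_mono power_mono mult_pos_pos zero_less_power) auto
      with False show ?thesis by (simp add: n power_inverse divide_inverse indicator_def flip: power_mult)
    qed
  qed
  then have "(\<integral>\<^sup>+p. ennreal (norm (approx_identity 1 p)) \<partial>lborel)
      \<le> (\<integral>\<^sup>+p. 2 * indicator (hbox 1) p + 2 * ennreal (if hgauge p < 1 then 0 else inverse (hgauge p) ^ 6) \<partial>lborel)"
    apply (intro nn_integral_mono)
    subgoal for p
      apply (rule order_trans[OF ennreal_leI], assumption)
      apply (auto simp: indicator_def hbox_def ennreal_mult hgauge_nonneg ennreal_plus)
      done
    done
  also have "\<dots> = 2 * emeasure lborel (hbox 1) + 2 * (\<integral>\<^sup>+p. ennreal (if hgauge p < 1 then 0 else inverse (hgauge p) ^ 6) \<partial>lborel)"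
    by (simp add: nn_integral_add nn_integral_cmult nn_integral_cmult_indicator)
  also have "\<dots> < \<infinity>"
    using nn_integral_gauge_far[of 1] by (auto simp: emeasure_hbox ennreal_mult_less_top intro: le_less_trans)
  finally show ?thesis by (simp add: integrable_iff_bounded)
qed

lemma delta_mass_nonzero: "delta_mass \<noteq> 0"
proof
  assume 0: "delta_mass = 0"
  \<comment> \<open>\<open>1 / (c\<^sup>2 cnj c) = cnj c / \<bar>c\<bar>\<^sup>4\<close>, and \<open>Im c > 0\<close>.\<close>
  have Re: "Re (approx_identity 1 p) > 0" for p
  proof -
    define c where "c = cr_coord 1 p"
    have c: "c \<noteq> 0" "Im c > 0" using cr_coord_nonzero[of 1 p] cr_coord_parts(2)[of 1 p] by (auto simp: c_def add_nonneg_pos)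
    have "c\<^sup>2 * cnj c * cnj c = of_real ((norm c)^4)"
      using complex_norm_square[of c] by (simp add: power2_eq_square eval_nat_numeral mult_ac)
    then have "approx_identity 1 p = 2 * \<i> * cnj c / of_real ((norm c)^4)"
      using c by (simp add: approx_identity_def flip: c_def) (simp add: divide_simps, metis mult.commute)
    then have "Re (approx_identity 1 p) = 2 * Im c / (norm c)^4" by (simp add: Re_divide_of_real)
    then show ?thesis using c by simp
  qed
  have i: "integrable lborel (\<lambda>p. Re (approx_identity 1 p))" using integrable_approx by simp
  have "(\<integral>p. Re (approx_identity 1 p) \<partial>lborel) = 0"
    using 0 integrable_approx by (simp add: delta_mass_def)
  then have "AE p in (lborel :: heis measure). Re (approx_identity 1 p) = 0"
    by (rule integral_nonneg_eq_0_iff_AE[OF i, THEN iffD1, rotated]) (intro AE_I2 less_imp_le Re)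
  then have "AE p in (lborel :: heis measure). False"
    by eventually_elim (use Re in \<open>metis less_irrefl\<close>)
  then have "emeasure (lborel :: heis measure) (hbox 1) = 0"
    by (subst (asm) AE_iff_measurable[of UNIV]) (auto simp: emeasure_lborel_UNIV)
  then show False by (simp add: emeasure_hbox)
qed

lemma approx_identity_dilation: assumes "0 < s" shows "of_real (s ^ 4) * approx_identity (s\<^sup>2) (dilation s p) = approx_identity 1 p"
proof -
  have "cr_coord (s\<^sup>2) (dilation s p) = of_real (s\<^sup>2) * cr_coord 1 p"
    by (simp add: cr_coord_def dilation_def scaleR_conv_of_real power2_eq_square algebra_simps)
  then show ?thesis using assms
    by (simp add: approx_identity_def power2_eq_square eval_nat_numeral divide_simps)
qed

text \<open>Rescaling moves the parameter from the kernel to the argument of \<open>w\<close>, where dominated convergence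
  applies.\<close>

lemma hconv_approx:
  assumes w: "w \<in> test_functions" and s: "0 < s"
  shows "hconv w (approx_identity (s\<^sup>2)) x = (\<integral>p. w (hmul x (- dilation s p)) * approx_identity 1 p \<partial>lborel)"
proof -
  have [measurable]: "w \<in> borel_measurable borel" by (rule test_measurable[OF w])
  have "hconv w (approx_identity (s\<^sup>2)) x
      = (\<integral>p. of_real (s ^ 4) * (w (hmul x (- dilation s p)) * approx_identity (s\<^sup>2) (dilation s p)) \<partial>lborel)"
    unfolding hconv_def by (rule integral_dilation[OF s, of "\<lambda>y. w (hmul x (- y)) * approx_identity (s\<^sup>2) y"]) measurable
  also have "(\<lambda>p. of_real (s ^ 4) * (w (hmul x (- dilation s p)) * approx_identity (s\<^sup>2) (dilation s p)))
      = (\<lambda>p. w (hmul x (- dilation s p)) * approx_identity 1 p)"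
    using approx_identity_dilation[OF s] by (intro ext) (metis mult.left_commute)
  finally show ?thesis .
qed

definition inv_Suc :: "nat \<Rightarrow> real" where "inv_Suc n = 1 / real (Suc n)"

lemma inv_Suc: "0 < inv_Suc n" "inv_Suc \<longlonglongrightarrow> 0"
proof -
  show "0 < inv_Suc n" by (simp add: inv_Suc_def)
  have "inv_Suc = (\<lambda>n. inverse (real (Suc n)))" by (simp add: inv_Suc_def fun_eq_iff inverse_eq_divide)
  then show "inv_Suc \<longlonglongrightarrow> 0" using LIMSEQ_inverse_real_of_nat by (simp only:)
qed

lemma inv_Suc_sq: "0 < (inv_Suc n)\<^sup>2"
  by (rule zero_less_power[OF inv_Suc(1)])

lemma hconv_approx_tendsto:
  assumes w: "w \<in> test_functions"
  shows "(\<lambda>n. hconv w (approx_identity ((inv_Suc n)\<^sup>2)) x) \<longlonglongrightarrow> delta_mass * w x"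
proof -
  have [measurable]: "w \<in> borel_measurable borel" by (rule test_measurable[OF w])
  obtain B where B: "\<And>x. norm (w x) \<le> B" "0 \<le> B" using test_bounded[OF w] by blast
  have "(\<lambda>n. \<integral>p. w (hmul x (- dilation (inv_Suc n) p)) * approx_identity 1 p \<partial>lborel)
      \<longlonglongrightarrow> (\<integral>p. w x * approx_identity 1 p \<partial>lborel)"
  proof (rule integral_dominated_convergence[where w="\<lambda>p. B * norm (approx_identity 1 p)"])
    show "integrable lborel (\<lambda>p. B * norm (approx_identity 1 p))" using integrable_approx by simp
    show "AE p in lborel. (\<lambda>n. w (hmul x (- dilation (inv_Suc n) p)) * approx_identity 1 p) \<longlonglongrightarrow> w x * approx_identity 1 p"
    proof (rule AE_I2)
      fix p
      have "(\<lambda>n. hmul x (- dilation (inv_Suc n) p)) \<longlonglongrightarrow> hmul x (- dilation 0 p)"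
        unfolding hmul_def dilation_def by (intro tendsto_intros inv_Suc(2) | simp)+
      then have "(\<lambda>n. hmul x (- dilation (inv_Suc n) p)) \<longlonglongrightarrow> x" by (simp add: dilation_def zero_prod_def[symmetric])
      moreover have "isCont w x" using smooth_cont[OF test_smooth[OF w]] by (metis UNIV_I continuous_on_eq_continuous_at open_UNIV)
      ultimately have "(\<lambda>n. w (hmul x (- dilation (inv_Suc n) p))) \<longlonglongrightarrow> w x" by (rule isCont_tendsto_compose[rotated])
      then show "(\<lambda>n. w (hmul x (- dilation (inv_Suc n) p)) * approx_identity 1 p) \<longlonglongrightarrow> w x * approx_identity 1 p"
        by (intro tendsto_intros)
    qed
    show "AE p in lborel. norm (w (hmul x (- dilation (inv_Suc n) p)) * approx_identity 1 p) \<le> B * norm (approx_identity 1 p)" for n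
      by (intro AE_I2) (simp add: norm_mult mult_right_mono B)
  qed measurable
  then show ?thesis by (simp add: hconv_approx[OF w inv_Suc(1)] delta_mass_def mult.commute)
qed

lemma hconv_approx_bound:
  assumes w: "w \<in> test_functions"
  obtains C where "\<And>n x. norm (hconv w (approx_identity ((inv_Suc n)\<^sup>2)) x) \<le> C"
proof -
  have [measurable]: "w \<in> borel_measurable borel" by (rule test_measurable[OF w])
  obtain B where B: "\<And>x. norm (w x) \<le> B" "0 \<le> B" using test_bounded[OF w] by blast
  have "norm (hconv w (approx_identity ((inv_Suc n)\<^sup>2)) x) \<le> (\<integral>p. B * norm (approx_identity 1 p) \<partial>lborel)" for n x
    unfolding hconv_approx[OF w inv_Suc(1)]
    using integrable_approx by (intro norm_integral_le) (simp_all add: norm_mult mult_right_mono B)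
  then show ?thesis by (rule that)
qed

section \<open>Inversion of Zbar by the limit kernel\<close>

lemma norm_Zbar_kernel_mono: "norm (Zbar_kernel \<epsilon> p) \<le> norm (Zbar_kernel 0 p)" if "0 \<le> \<epsilon>"
proof (cases "cr_coord 0 p = 0")
  case True
  then have "(norm (fst p))\<^sup>2 = 0" using cr_coord_parts(2)[of 0 p] by simp
  then show ?thesis by (simp add: Zbar_kernel_def)
next
  case False
  have "(norm (cr_coord 0 p))\<^sup>2 \<le> (norm (cr_coord \<epsilon> p))\<^sup>2"
    unfolding norm_cr_coord using that by (intro add_left_mono power_mono) auto
  moreover have "0 < (norm (cr_coord 0 p))\<^sup>2" using False by simp
  ultimately have "norm (fst p) / (norm (cr_coord \<epsilon> p))\<^sup>2 \<le> norm (fst p) / (norm (cr_coord 0 p))\<^sup>2"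
    by (intro divide_left_mono mult_pos_pos) auto
  then show ?thesis by (simp add: Zbar_kernel_def norm_divide norm_mult power2_eq_square)
qed

text \<open>\<open>\<bar>z\<bar> \<le> 2 N\<close> and \<open>\<bar>\<zeta>\<bar> \<ge> N\<^sup>2\<close> for the gauge \<open>N\<close>.\<close>

lemma Zbar_kernel_bound: "norm (Zbar_kernel 0 p) \<le> 2 * inverse (hgauge p) ^ 3"
proof (cases "hgauge p = 0")
  case True
  then have "fst p = 0" using hgauge_bounds(1,2)[of p] by (auto simp: complex_eq_iff)
  then show ?thesis by (simp add: Zbar_kernel_def True)
next
  case False
  then have N: "0 < hgauge p" using hgauge_nonneg[of p] by simp
  have "norm (fst p) \<le> \<bar>Re (fst p)\<bar> + \<bar>Im (fst p)\<bar>" by (rule cmod_le)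
  also have "\<dots> \<le> 2 * hgauge p" using hgauge_bounds[of p] by linarith
  finally have z: "norm (fst p) \<le> 2 * hgauge p" .
  have "norm (fst p) / (norm (cr_coord 0 p))\<^sup>2 \<le> (2 * hgauge p) / ((hgauge p)\<^sup>2)\<^sup>2"
    using z norm_cr_coord_ge(2)[of 0 p] N by (intro frac_le power_mono) auto
  also have "\<dots> = 2 * inverse (hgauge p) ^ 3" using N by (simp add: field_simps eval_nat_numeral)
  finally show ?thesis by (simp add: Zbar_kernel_def norm_divide norm_mult power2_eq_square)
qed

lemma locally_integrable_Zbar_kernel: "locally_integrable (Zbar_kernel 0)"
proof -
  have "(\<integral>\<^sup>+y. ennreal (norm (Zbar_kernel 0 y)) * indicator (hbox r) y \<partial>lborel) < \<infinity>" for r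
  proof -
    have "(\<integral>\<^sup>+y. ennreal (norm (Zbar_kernel 0 y)) * indicator (hbox r) y \<partial>lborel)
        \<le> (\<integral>\<^sup>+y. 2 * ennreal (if hgauge y < \<bar>r\<bar> + 1 then inverse (hgauge y) ^ 3 else 0) \<partial>lborel)"
    proof (rule nn_integral_mono)
      fix y
      have "ennreal (norm (Zbar_kernel 0 y)) \<le> 2 * ennreal (inverse (hgauge y) ^ 3)"
        using ennreal_leI[OF Zbar_kernel_bound[of y]] by (simp add: ennreal_mult hgauge_nonneg)
      then show "ennreal (norm (Zbar_kernel 0 y)) * indicator (hbox r) y
          \<le> 2 * ennreal (if hgauge y < \<bar>r\<bar> + 1 then inverse (hgauge y) ^ 3 else 0)"
        by (auto simp: indicator_def hbox_def)
    qed
    also have "\<dots> \<le> 2 * ennreal (128 * (\<bar>r\<bar> + 1))"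
      by (subst nn_integral_cmult, measurable, rule mult_left_mono[OF nn_integral_gauge_near]) auto
    also have "\<dots> < \<infinity>" by (simp add: ennreal_mult_less_top)
    finally show ?thesis .
  qed
  then show ?thesis by (simp add: locally_integrable_def)
qed

lemma hconv_kernel_tendsto:
  assumes g: "g \<in> test_functions"
  shows "(\<lambda>n. hconv g (Zbar_kernel ((inv_Suc n)\<^sup>2)) x) \<longlonglongrightarrow> hconv g (Zbar_kernel 0) x"
  unfolding hconv_def
proof (rule integral_dominated_convergence[where w="\<lambda>y. norm (g (hmul x (- y)) * Zbar_kernel 0 y)"])
  have [measurable]: "g \<in> borel_measurable borel" by (rule test_measurable[OF g])
  show "(\<lambda>y. g (hmul x (- y)) * Zbar_kernel 0 y) \<in> borel_measurable lborel"
    "(\<lambda>y. g (hmul x (- y)) * Zbar_kernel ((inv_Suc n)\<^sup>2) y) \<in> borel_measurable lborel" for n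
    by measurable
  show "integrable lborel (\<lambda>y. norm (g (hmul x (- y)) * Zbar_kernel 0 y))"
    using hconv_integrable[OF g locally_integrable_Zbar_kernel] by simp
  show "AE y in lborel. norm (g (hmul x (- y)) * Zbar_kernel ((inv_Suc n)\<^sup>2) y) \<le> norm (g (hmul x (- y)) * Zbar_kernel 0 y)" for n
    by (auto simp: norm_mult intro!: mult_left_mono norm_Zbar_kernel_mono)
  show "AE y in lborel. (\<lambda>n. g (hmul x (- y)) * Zbar_kernel ((inv_Suc n)\<^sup>2) y) \<longlonglongrightarrow> g (hmul x (- y)) * Zbar_kernel 0 y"
  proof (rule AE_I2)
    fix y
    have "(\<lambda>n. Zbar_kernel ((inv_Suc n)\<^sup>2) y) \<longlonglongrightarrow> Zbar_kernel 0 y"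
    proof (cases "cr_coord 0 y = 0")
      case True
      then have "(norm (fst y))\<^sup>2 = 0" using cr_coord_parts(2)[of 0 y] by simp
      then show ?thesis by (simp add: Zbar_kernel_def)
    next
      case False
      have "(\<lambda>n. cr_coord ((inv_Suc n)\<^sup>2) y) \<longlonglongrightarrow> cr_coord (0\<^sup>2) y"
        unfolding cr_coord_def by (intro tendsto_intros inv_Suc(2))
      then have "(\<lambda>n. cr_coord ((inv_Suc n)\<^sup>2) y) \<longlonglongrightarrow> cr_coord 0 y" by simp
      then show ?thesis unfolding Zbar_kernel_def using False by (intro tendsto_intros) auto
    qed
    then show "(\<lambda>n. g (hmul x (- y)) * Zbar_kernel ((inv_Suc n)\<^sup>2) y) \<longlonglongrightarrow> g (hmul x (- y)) * Zbar_kernel 0 y"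
      by (intro tendsto_intros)
  qed
qed

text \<open>Uniform in \<open>n\<close>, so that dominated convergence applies on the support of a test function.\<close>

lemma hconv_kernel_bound:
  assumes g: "g \<in> test_functions" and X: "bounded X"
  obtains C where "\<And>n x. x \<in> X \<Longrightarrow> norm (hconv g (Zbar_kernel ((inv_Suc n)\<^sup>2)) x) \<le> C"
proof -
  have [measurable]: "g \<in> borel_measurable borel" by (rule test_measurable[OF g])
  obtain B where B: "\<And>x. norm (g x) \<le> B" "0 \<le> B" using test_bounded[OF g] by blast
  obtain r where r: "\<And>x y. x \<in> X \<Longrightarrow> y \<notin> hbox r \<Longrightarrow> hmul x (- y) \<notin> closure {q. g q \<noteq> 0}"
    using support_hbox[OF g X] by blast
  have "norm (hconv g (Zbar_kernel ((inv_Suc n)\<^sup>2)) x) \<le> (\<integral>y. B * (indicator (hbox r) y * norm (Zbar_kernel 0 y)) \<partial>lborel)"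
    if x: "x \<in> X" for n x
    unfolding hconv_def
  proof (rule norm_integral_le)
    show "integrable lborel (\<lambda>y. B * (indicator (hbox r) y * norm (Zbar_kernel 0 y)))"
      by (intro integrable_mult_right locally_integrable_hbox locally_integrable_Zbar_kernel)
    show "norm (g (hmul x (- y)) * Zbar_kernel ((inv_Suc n)\<^sup>2) y) \<le> B * (indicator (hbox r) y * norm (Zbar_kernel 0 y))" for y
    proof (cases "y \<in> hbox r")
      case True
      then show ?thesis by (simp add: norm_mult mult_mono B norm_Zbar_kernel_mono)
    next
      case False
      from test_zero[OF g r[OF x False]] show ?thesis by (simp add: False)
    qed
  qed measurable
  then show ?thesis by (rule that)
qed

lemma smooth_hconv_kernel: "g \<in> test_functions \<Longrightarrow> smooth (hconv g (Zbar_kernel 0))"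
  by (rule smooth_hconv[OF _ locally_integrable_Zbar_kernel])

text \<open>The function \<open>H\<close> is the limit of the Szego terms, which satisfy \<open>Zbar H = 0\<close> weakly; as \<open>H\<close> is smooth,
  this holds pointwise.\<close>

lemma Zbar_hconv_kernel:
  assumes w: "w \<in> test_functions"
  shows "Zbar (hconv (Zbar w) (Zbar_kernel 0)) p = delta_mass * Zbar w p"
proof -
  define g where "g = Zbar w"
  have g: "g \<in> test_functions" unfolding g_def by (rule test_Zbar[OF w])
  define u where "u = hconv g (Zbar_kernel 0)"
  have u: "smooth u" unfolding u_def by (rule smooth_hconv_kernel[OF g])
  define H where "H = (\<lambda>x. u x - delta_mass * w x)"
  have H: "smooth H" unfolding H_def by (intro smooth_minus smooth_cmult u test_smooth w)
  have H_lim: "(\<lambda>n. hconv w (szego_kernel ((inv_Suc n)\<^sup>2)) x) \<longlonglongrightarrow> H x" for x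
  proof -
    have "(\<lambda>n. hconv g (Zbar_kernel ((inv_Suc n)\<^sup>2)) x - hconv w (approx_identity ((inv_Suc n)\<^sup>2)) x) \<longlonglongrightarrow> H x"
      unfolding H_def u_def by (intro tendsto_diff hconv_kernel_tendsto g hconv_approx_tendsto w)
    then show ?thesis unfolding g_def by (simp add: hconv_Zbar_kernel[OF w inv_Suc_sq])
  qed
  have "(\<integral>x. Zbar H x * \<phi> x \<partial>lborel) = 0" if \<phi>: "\<phi> \<in> test_functions" for \<phi>
  proof -
    have Z\<phi>: "Zbar \<phi> \<in> test_functions" by (rule test_Zbar[OF \<phi>])
    define X where "X = {x. Zbar \<phi> x \<noteq> 0}"
    have X: "bounded X" using Z\<phi> by (simp add: X_def test_iff)
    obtain C1 where C1: "\<And>n x. x \<in> X \<Longrightarrow> norm (hconv g (Zbar_kernel ((inv_Suc n)\<^sup>2)) x) \<le> C1"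
      using hconv_kernel_bound[OF g X] by blast
    obtain C2 where C2: "\<And>n x. norm (hconv w (approx_identity ((inv_Suc n)\<^sup>2)) x) \<le> C2"
      using hconv_approx_bound[OF w] by blast
    have b: "norm (hconv w (szego_kernel ((inv_Suc n)\<^sup>2)) x * Zbar \<phi> x) \<le> (C1 + C2) * norm (Zbar \<phi> x)" for n x
    proof (cases "x \<in> X")
      case True
      have "hconv w (szego_kernel ((inv_Suc n)\<^sup>2)) x = hconv g (Zbar_kernel ((inv_Suc n)\<^sup>2)) x - hconv w (approx_identity ((inv_Suc n)\<^sup>2)) x"
        unfolding g_def by (simp add: hconv_Zbar_kernel[OF w inv_Suc_sq])
      then have "norm (hconv w (szego_kernel ((inv_Suc n)\<^sup>2)) x) \<le> C1 + C2"
        using norm_triangle_le_diff add_mono[OF C1[OF True] C2] by metis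
      then show ?thesis by (simp add: norm_mult mult_right_mono)
    qed (simp add: X_def)
    have sm: "hconv w (szego_kernel ((inv_Suc n)\<^sup>2)) \<in> borel_measurable borel" for n
      by (intro smooth_measurable smooth_hconv w continuous_locally_integrable smooth_cont smooth_szego inv_Suc_sq)
    have "(\<lambda>n. \<integral>x. hconv w (szego_kernel ((inv_Suc n)\<^sup>2)) x * Zbar \<phi> x \<partial>lborel) \<longlonglongrightarrow> (\<integral>x. H x * Zbar \<phi> x \<partial>lborel)"
    proof (rule integral_dominated_convergence[where w="\<lambda>x. (C1 + C2) * norm (Zbar \<phi> x)"])
      show "integrable lborel (\<lambda>x. (C1 + C2) * norm (Zbar \<phi> x))" using test_integrable[OF Z\<phi>] by simp
      show "(\<lambda>x. H x * Zbar \<phi> x) \<in> borel_measurable lborel"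
        using smooth_measurable[OF H] test_measurable[OF Z\<phi>] by simp
      show "(\<lambda>x. hconv w (szego_kernel ((inv_Suc n)\<^sup>2)) x * Zbar \<phi> x) \<in> borel_measurable lborel" for n
        using sm[of n] test_measurable[OF Z\<phi>] by simp
      show "AE x in lborel. (\<lambda>n. hconv w (szego_kernel ((inv_Suc n)\<^sup>2)) x * Zbar \<phi> x) \<longlonglongrightarrow> H x * Zbar \<phi> x"
        by (intro AE_I2 tendsto_mult H_lim tendsto_const)
    qed (use b in auto)
    then have "(\<integral>x. H x * Zbar \<phi> x \<partial>lborel) = 0"
      by (simp add: hconv_szego_weak_CR[OF w \<phi> inv_Suc_sq] LIMSEQ_const_iff)
    then have "(\<integral>x. Zbar \<phi> x * H x \<partial>lborel) = 0" by (simp add: mult.commute)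
    then show ?thesis using Zbar_parts[OF \<phi> H] by (simp add: mult.commute)
  qed
  from smooth_weak_zero[OF smooth_Zbar[OF H] this] have "Zbar H p = 0" .
  then show ?thesis
    using Zbar_diff[OF u smooth_cmult[OF test_smooth[OF w]]] Zbar_cmult[OF test_smooth[OF w]]
    by (simp add: H_def u_def g_def)
qed

section \<open>The solution operator from L2 to L4\<close>

lemma power_integral_2: "power_integral 2 f = (\<integral>\<^sup>+x. ennreal ((norm (f x))\<^sup>2) \<partial>lborel)"
  and power_integral_4: "power_integral 4 f = (\<integral>\<^sup>+x. ennreal (norm (f x) ^ 4) \<partial>lborel)"
  by (simp_all add: power_integral_def)

lemma measurable_hconv [measurable]:
  assumes [measurable]: "g \<in> borel_measurable borel" "v \<in> borel_measurable borel"
  shows "hconv g v \<in> borel_measurable borel"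
proof -
  have "(\<lambda>x. \<integral>y. g (hmul x (- y)) * v y \<partial>lborel) \<in> borel_measurable (borel :: heis measure)"
    by (rule lborel.borel_measurable_lebesgue_integral) measurable
  then show ?thesis by (simp add: hconv_def[abs_def])
qed

lemma nn_integral_kernel_le_riesz:
  assumes [measurable]: "g \<in> borel_measurable borel"
  shows "(\<integral>\<^sup>+y. ennreal (norm (g y * Zbar_kernel 0 (hmul (- y) x))) \<partial>lborel) \<le> 2 * riesz_potential g x"
proof -
  have "(\<integral>\<^sup>+y. ennreal (norm (g y * Zbar_kernel 0 (hmul (- y) x))) \<partial>lborel)
      \<le> (\<integral>\<^sup>+y. 2 * ennreal (norm (g y) * inverse (hgauge (hmul (- y) x)) ^ 3) \<partial>lborel)"
  proof (rule nn_integral_mono)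
    fix y
    have "norm (g y * Zbar_kernel 0 (hmul (- y) x)) \<le> norm (g y) * (2 * inverse (hgauge (hmul (- y) x)) ^ 3)"
      unfolding norm_mult by (intro mult_left_mono Zbar_kernel_bound) auto
    also have "\<dots> = 2 * (norm (g y) * inverse (hgauge (hmul (- y) x)) ^ 3)" by simp
    finally have "ennreal (norm (g y * Zbar_kernel 0 (hmul (- y) x))) \<le> ennreal (2 * (norm (g y) * inverse (hgauge (hmul (- y) x)) ^ 3))"
      by (rule ennreal_leI)
    also have "\<dots> = 2 * ennreal (norm (g y) * inverse (hgauge (hmul (- y) x)) ^ 3)"
      by (subst ennreal_mult) (auto simp: hgauge_nonneg)
    finally show "ennreal (norm (g y * Zbar_kernel 0 (hmul (- y) x))) \<le> 2 * ennreal (norm (g y) * inverse (hgauge (hmul (- y) x)) ^ 3)" .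
  qed
  also have "\<dots> = 2 * riesz_potential g x" unfolding riesz_potential_def by (subst nn_integral_cmult) auto
  finally show ?thesis .
qed

lemma norm_hconv_kernel_le:
  assumes [measurable]: "g \<in> borel_measurable borel"
  shows "ennreal (norm (hconv g (Zbar_kernel 0) x)) \<le> 2 * riesz_potential g x"
proof (cases "integrable lborel (\<lambda>y. g y * Zbar_kernel 0 (hmul (- y) x))")
  case True
  have "ennreal (norm (hconv g (Zbar_kernel 0) x)) \<le> (\<integral>\<^sup>+y. ennreal (norm (g y * Zbar_kernel 0 (hmul (- y) x))) \<partial>lborel)"
    unfolding hconv_alt[OF assms measurable_kernels(2)] by (rule integral_norm_bound_ennreal[OF True])
  then show ?thesis using nn_integral_kernel_le_riesz[OF assms] by (rule order_trans)
next
  case False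
  then show ?thesis by (simp add: hconv_alt not_integrable_integral_eq)
qed

lemma hconv_kernel_L4:
  assumes [measurable]: "g \<in> borel_measurable borel" and e: "0 < e" "power_integral 2 g \<le> ennreal (e\<^sup>2)"
  shows "power_integral 4 (hconv g (Zbar_kernel 0)) \<le> 16 * (768 * 770 ^ 3 * ennreal (e ^ 4))"
proof -
  have "power_integral 4 (hconv g (Zbar_kernel 0)) \<le> (\<integral>\<^sup>+x. 16 * riesz_potential g x ^ 4 \<partial>lborel)"
    unfolding power_integral_4
  proof (rule nn_integral_mono)
    fix x
    have "ennreal (norm (hconv g (Zbar_kernel 0) x) ^ 4) \<le> (2 * riesz_potential g x) ^ 4"
      unfolding ennreal_power[OF norm_ge_zero, symmetric] by (intro power_mono norm_hconv_kernel_le) auto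
    then show "ennreal (norm (hconv g (Zbar_kernel 0) x) ^ 4) \<le> 16 * riesz_potential g x ^ 4"
      by (simp add: power_mult_distrib)
  qed
  also have "\<dots> = 16 * (\<integral>\<^sup>+x. riesz_potential g x ^ 4 \<partial>lborel)" by (rule nn_integral_cmult) measurable
  also have "\<dots> \<le> 16 * (768 * 770 ^ 3 * ennreal (e ^ 4))"
    using riesz_potential_L4[OF assms(1) e(1)] e(2) by (intro mult_left_mono) (auto simp: power_integral_2)
  finally show ?thesis .
qed

lemma L2_cases:
  assumes "power_integral 2 g < \<infinity>" obtains e where "0 < e" "power_integral 2 g \<le> ennreal (e\<^sup>2)"
proof -
  obtain r where r: "power_integral 2 g = ennreal r" "0 \<le> r" using assms by (cases "power_integral 2 g") auto
  have "r \<le> (r + 1)\<^sup>2" using r by (simp add: power2_eq_square algebra_simps)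
  with r show ?thesis by (intro that[of "r + 1"]) (auto intro: ennreal_leI)
qed

lemma hconv_kernel_finite:
  assumes "g \<in> borel_measurable borel" "power_integral 2 g < \<infinity>"
  shows "power_integral 4 (hconv g (Zbar_kernel 0)) < \<infinity>"
proof -
  obtain e where e: "0 < e" "power_integral 2 g \<le> ennreal (e\<^sup>2)" using L2_cases[OF assms(2)] .
  show ?thesis using hconv_kernel_L4[OF assms(1) e] by (rule le_less_trans) (simp add: ennreal_mult_less_top)
qed

lemma AE_integrable_kernel:
  assumes [measurable]: "g \<in> borel_measurable borel" and fin: "power_integral 2 g < \<infinity>"
  shows "AE x in lborel. integrable lborel (\<lambda>y. g y * Zbar_kernel 0 (hmul (- y) x))"
proof -
  obtain e where e: "0 < e" "power_integral 2 g \<le> ennreal (e\<^sup>2)" using L2_cases[OF fin] .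
  have "(\<integral>\<^sup>+x. riesz_potential g x ^ 4 \<partial>lborel) \<le> 768 * 770 ^ 3 * ennreal (e ^ 4)"
    using riesz_potential_L4[OF assms(1) e(1)] e(2) by (simp add: power_integral_2)
  also have "\<dots> < \<infinity>" by (simp add: ennreal_mult_less_top)
  finally have "AE x in lborel. riesz_potential g x ^ 4 \<noteq> \<infinity>"
    by (intro nn_integral_PInf_AE) auto
  then show ?thesis
  proof eventually_elim
    case (elim x)
    then have "riesz_potential g x < \<infinity>" by (auto simp: less_top power_eq_top_ennreal)
    then have "2 * riesz_potential g x < \<infinity>" by (simp add: ennreal_mult_less_top)
    with nn_integral_kernel_le_riesz[OF assms(1), of x] show ?case by (simp add: integrable_iff_bounded)
  qed
qed

text \<open>The convolution is linear almost everywhere: the defining integral converges absolutely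
  wherever the Riesz potential is finite. Elsewhere it may be the default value \<open>0\<close>.\<close>

lemma hconv_kernel_diff_L4:
  assumes [measurable]: "f \<in> borel_measurable borel" "g \<in> borel_measurable borel"
    and fin: "power_integral 2 f < \<infinity>" "power_integral 2 g < \<infinity>"
    and e: "0 < e" "power_integral 2 (\<lambda>x. f x - g x) \<le> ennreal (e\<^sup>2)"
  shows "power_integral 4 (\<lambda>x. hconv f (Zbar_kernel 0) x - hconv g (Zbar_kernel 0) x) \<le> 16 * (768 * 770 ^ 3 * ennreal (e ^ 4))"
proof -
  have "AE x in lborel. hconv f (Zbar_kernel 0) x - hconv g (Zbar_kernel 0) x = hconv (\<lambda>x. f x - g x) (Zbar_kernel 0) x"
    using AE_integrable_kernel[OF assms(1) fin(1)] AE_integrable_kernel[OF assms(2) fin(2)]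
    by eventually_elim (simp add: hconv_alt left_diff_distrib)
  then have "power_integral 4 (\<lambda>x. hconv f (Zbar_kernel 0) x - hconv g (Zbar_kernel 0) x)
      = power_integral 4 (hconv (\<lambda>x. f x - g x) (Zbar_kernel 0))"
    unfolding power_integral_def by (intro nn_integral_cong_AE) auto
  also have "\<dots> \<le> 16 * (768 * 770 ^ 3 * ennreal (e ^ 4))" by (intro hconv_kernel_L4 e) measurable
  finally show ?thesis .
qed

section \<open>Continuity of translation in L2\<close>

definition clamp_norm :: "real \<Rightarrow> complex \<Rightarrow> complex" where
  "clamp_norm k z = of_real (k / max k (norm z)) * z"

lemma continuous_clamp_norm: "0 < k \<Longrightarrow> continuous_on UNIV (clamp_norm k)"
  unfolding clamp_norm_def by (intro continuous_intros) (auto simp: max_def)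

lemma norm_clamp_norm: assumes "0 < k" shows "norm (clamp_norm k z) \<le> k" "norm (clamp_norm k z) \<le> norm z"
proof -
  have n: "norm (clamp_norm k z) = k / max k (norm z) * norm z"
    unfolding clamp_norm_def norm_mult norm_of_real using assms by (simp add: abs_divide)
  show "norm (clamp_norm k z) \<le> k" "norm (clamp_norm k z) \<le> norm z"
    unfolding n using assms by (auto simp: max_def field_simps mult_right_mono)
qed

lemma clamp_norm_eq: "0 < k \<Longrightarrow> norm z \<le> k \<Longrightarrow> clamp_norm k z = z"
  by (simp add: clamp_norm_def max_absorb1)

lemma power_integral_tendsto_0:
  assumes [measurable]: "\<And>n. F n \<in> borel_measurable borel" "w \<in> borel_measurable borel"
    and w: "(\<integral>\<^sup>+x. w x \<partial>lborel) < \<infinity>" and le: "\<And>n x. ennreal ((norm (F n x))\<^sup>2) \<le> w x"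
    and lim: "AE x in lborel. (\<lambda>n. F n x) \<longlonglongrightarrow> 0"
  shows "(\<lambda>n. power_integral 2 (F n)) \<longlonglongrightarrow> 0"
proof -
  have "(\<lambda>n. \<integral>\<^sup>+x. ennreal ((norm (F n x))\<^sup>2) \<partial>lborel) \<longlonglongrightarrow> (\<integral>\<^sup>+x. 0 \<partial>(lborel :: heis measure))"
  proof (rule nn_integral_dominated_convergence[where w=w])
    show "AE x in lborel. (\<lambda>n. ennreal ((norm (F n x))\<^sup>2)) \<longlonglongrightarrow> 0"
      using lim
    proof eventually_elim
      case (elim x)
      have "(\<lambda>n. ennreal ((norm (F n x))\<^sup>2)) \<longlonglongrightarrow> ennreal ((norm (0::complex))\<^sup>2)"
        by (intro tendsto_ennrealI tendsto_intros elim)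
      then show ?case by simp
    qed
  qed (use w le in auto)
  then show ?thesis by (simp add: power_integral_2)
qed

text \<open>Truncate \<open>v\<close> in height and in space; then replace \<open>v\<close> inside the truncation by continuous
  functions that converge to it almost everywhere, which exist for every measurable function.
  The truncation provides the dominating function.\<close>

lemma continuous_dense_L2:
  assumes v [measurable]: "v \<in> borel_measurable borel" and fin: "power_integral 2 v < \<infinity>" and e: "0 < e"
  shows "\<exists>c r. continuous_on UNIV c \<and> (\<forall>x. x \<notin> hbox r \<longrightarrow> c x = 0) \<and> power_integral 2 (\<lambda>x. c x - v x) \<le> ennreal e"
proof -
  have [measurable]: "clamp_norm (real (Suc k)) \<in> borel_measurable borel" "cutoff R \<in> borel_measurable borel" for k R
    by (intro borel_measurable_continuous_onI continuous_clamp_norm smooth_measurable smooth_cutoff; simp)+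
  \<comment> \<open>The truncation of \<open>v\<close> at level \<open>k + 1\<close>.\<close>
  define vk where "vk k x = cutoff (real (Suc k)) x * clamp_norm (real (Suc k)) (v x)" for k x
  have [measurable]: "vk k \<in> borel_measurable borel" for k unfolding vk_def by measurable
  have cl: "norm (cutoff R x * z) \<le> norm z" for R x z
    using mult_right_mono[OF norm_cutoff(1), of "norm z"] by (simp add: norm_mult)
  have "(\<lambda>k. power_integral 2 (\<lambda>x. vk k x - v x)) \<longlonglongrightarrow> 0"
  proof (rule power_integral_tendsto_0[where w="\<lambda>x. 4 * ennreal ((norm (v x))\<^sup>2)"])
    show "(\<integral>\<^sup>+x. 4 * ennreal ((norm (v x))\<^sup>2) \<partial>lborel) < \<infinity>"
      using fin by (simp add: nn_integral_cmult power_integral_2 ennreal_mult_less_top)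
    show "ennreal ((norm (vk k x - v x))\<^sup>2) \<le> 4 * ennreal ((norm (v x))\<^sup>2)" for k x
    proof -
      have "norm (vk k x) \<le> norm (v x)" unfolding vk_def using cl norm_clamp_norm(2) order_trans by (metis of_nat_0_less_iff zero_less_Suc)
      then have "norm (vk k x - v x) \<le> 2 * norm (v x)" using norm_triangle_ineq4[of "vk k x" "v x"] by linarith
      then have "(norm (vk k x - v x))\<^sup>2 \<le> (2 * norm (v x))\<^sup>2" by (intro power_mono) auto
      then have "ennreal ((norm (vk k x - v x))\<^sup>2) \<le> ennreal (4 * (norm (v x))\<^sup>2)" by (intro ennreal_leI) (simp add: power_mult_distrib)
      then show ?thesis by (simp add: ennreal_mult)
    qed
    show "AE x in lborel. (\<lambda>k. vk k x - v x) \<longlonglongrightarrow> 0"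
    proof (rule AE_I2)
      fix x
      obtain N :: nat where N: "max (hgauge x) (norm (v x)) < real N" using reals_Archimedean2 by blast
      have "vk k x - v x = 0" if "N \<le> k" for k
        using N that by (simp add: vk_def cutoff_eq_1 clamp_norm_eq)
      then show "(\<lambda>k. vk k x - v x) \<longlonglongrightarrow> 0"
        by (intro tendsto_eventually eventually_sequentiallyI[of N])
    qed
  qed measurable
  from ennreal_tendsto_0D[OF this, of "e / 8"] e
  obtain k where k: "power_integral 2 (\<lambda>x. vk k x - v x) \<le> ennreal (e / 8)"
    by (auto simp: eventually_sequentially)
  have "v \<in> borel_measurable lebesgue" by (rule measurable_completion) simp
  then have "v \<in> borel_measurable (lebesgue_on UNIV)" by (simp add: lebesgue_on_UNIV_eq)
  then have "v measurable_on UNIV" by (subst measurable_on_iff_borel_measurable) auto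
  then obtain N g where N: "negligible N" and g: "\<And>n::nat. continuous_on UNIV (g n)"
      and lim: "\<And>x. x \<notin> N \<Longrightarrow> (\<lambda>n. g n x) \<longlonglongrightarrow> v x"
    unfolding measurable_on_def by auto
  have "AE x in lebesgue. x \<notin> N" using N by (intro AE_not_in) (simp add: negligible_iff_null_sets)
  then have AEN: "AE x in lborel. x \<notin> N" by (simp add: AE_completion_iff)
  \<comment> \<open>The same truncation applied to the continuous approximations \<open>g n\<close> of \<open>v\<close>.\<close>
  define c where "c n x = cutoff (real (Suc k)) x * clamp_norm (real (Suc k)) (g n x)" for n x
  have c: "continuous_on UNIV (c n)" for n
    unfolding c_def
    by (intro continuous_on_mult smooth_cont smooth_cutoff continuous_on_compose2[OF continuous_clamp_norm g]) auto
  have [measurable]: "c n \<in> borel_measurable borel" for n by (rule borel_measurable_continuous_onI[OF c])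
  have cut0: "cutoff (real (Suc k)) x = 0" if "x \<notin> hbox (2 * real (Suc k))" for x
    using hgauge_large[of "real (Suc k)" x] that plateau_eq_0 less_imp_le
    by (auto simp: cutoff_def hbox_def not_le)
  have "(\<lambda>n. power_integral 2 (\<lambda>x. c n x - vk k x)) \<longlonglongrightarrow> 0"
  proof (rule power_integral_tendsto_0[where w="\<lambda>x. ennreal ((2 * real (Suc k))\<^sup>2) * indicator (hbox (2 * real (Suc k))) x"])
    show "(\<integral>\<^sup>+x. ennreal ((2 * real (Suc k))\<^sup>2) * indicator (hbox (2 * real (Suc k))) x \<partial>lborel) < \<infinity>"
      by (simp add: nn_integral_cmult_indicator emeasure_hbox ennreal_mult_less_top)
    show "ennreal ((norm (c n x - vk k x))\<^sup>2) \<le> ennreal ((2 * real (Suc k))\<^sup>2) * indicator (hbox (2 * real (Suc k))) x" for n x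
    proof (cases "x \<in> hbox (2 * real (Suc k))")
      case True
      have "norm (c n x) \<le> real (Suc k)" "norm (vk k x) \<le> real (Suc k)"
        unfolding c_def vk_def by (rule order_trans[OF cl norm_clamp_norm(1)]; simp)+
      then have "norm (c n x - vk k x) \<le> 2 * real (Suc k)"
        unfolding mult_2 by (rule order_trans[OF norm_triangle_ineq4 add_mono])
      then have "(norm (c n x - vk k x))\<^sup>2 \<le> (2 * real (Suc k))\<^sup>2" by (intro power_mono) auto
      from ennreal_leI[OF this] show ?thesis by (simp only: True indicator_simps mult_1_right)
    next
      case False
      then show ?thesis using cut0[OF False] by (simp add: c_def vk_def)
    qed
    show "AE x in lborel. (\<lambda>n. c n x - vk k x) \<longlonglongrightarrow> 0"
      using AEN
    proof eventually_elim
      case (elim x)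
      have "isCont (clamp_norm (real (Suc k))) (v x)"
        using continuous_clamp_norm[of "real (Suc k)"] by (metis UNIV_I continuous_on_eq_continuous_at open_UNIV of_nat_0_less_iff zero_less_Suc)
      from isCont_tendsto_compose[OF this lim[OF elim]]
      have "(\<lambda>n. c n x - vk k x) \<longlonglongrightarrow> vk k x - vk k x" unfolding c_def vk_def by (intro tendsto_intros)
      then show ?case by simp
    qed
  qed measurable
  from ennreal_tendsto_0D[OF this, of "e / 8"] e
  obtain n where n: "power_integral 2 (\<lambda>x. c n x - vk k x) \<le> ennreal (e / 8)"
    by (auto simp: eventually_sequentially)
  have "power_integral 2 (\<lambda>x. (c n x - vk k x) + (vk k x - v x)) \<le> ennreal (2 powr 2) * (power_integral 2 (\<lambda>x. c n x - vk k x) + power_integral 2 (\<lambda>x. vk k x - v x))"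
    by (rule power_integral_add) auto
  also have "\<dots> \<le> ennreal (2 powr 2) * (ennreal (e / 8) + ennreal (e / 8))" by (intro mult_left_mono add_mono n k) auto
  also have "\<dots> = ennreal (2 powr 2 * (e / 8 + e / 8))"
    using e by (subst ennreal_mult, simp, simp, subst ennreal_plus) simp_all
  also have "2 powr 2 * (e / 8 + e / 8) = e" by simp
  finally have "power_integral 2 (\<lambda>x. c n x - v x) \<le> ennreal e" by simp
  moreover have "c n x = 0" if "x \<notin> hbox (2 * real (Suc k))" for x using cut0[OF that] by (simp add: c_def)
  ultimately show ?thesis using c by blast
qed

text \<open>Translations are isometries, so it suffices to treat a continuous function of bounded support, by dominated convergence.\<close>

lemma translation_continuous:
  assumes v [measurable]: "v \<in> borel_measurable borel" and fin: "power_integral 2 v < \<infinity>"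
    and q: "\<And>n. q n \<in> hbox (inv_Suc n)"
  shows "(\<lambda>n. power_integral 2 (\<lambda>x. v (hmul (- q n) x) - v x)) \<longlonglongrightarrow> 0"
proof (rule ennreal_tendsto_0I)
  fix e :: real assume e: "0 < e"
  obtain c r where c: "continuous_on UNIV c" "\<And>x. x \<notin> hbox r \<Longrightarrow> c x = 0"
    and cv: "power_integral 2 (\<lambda>x. c x - v x) \<le> ennreal (e / 48)"
    using continuous_dense_L2[OF v fin, of "e / 48"] e by auto
  have [measurable]: "c \<in> borel_measurable borel" by (rule borel_measurable_continuous_onI[OF c(1)])
  have "compact (c ` closure (hbox r))"
    by (intro compact_continuous_image continuous_on_subset[OF c(1)]) (auto simp: compact_closure bounded_hbox)
  then obtain B where B0: "0 < B" "\<forall>x\<in>closure (hbox r). norm (c x) \<le> B" by (auto dest!: compact_imp_bounded simp: bounded_pos)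
  have B: "norm (c x) \<le> B" for x using B0 c(2)[of x] closure_subset[of "hbox r"] by (cases "x \<in> hbox r") auto
  have "compact ((\<lambda>p. hmul (fst p) (snd p)) ` (closure (hbox 1) \<times> closure (hbox r)))"
    by (intro compact_continuous_image compact_Times continuous_intros) (auto simp: compact_closure bounded_hbox)
  then obtain r' where r': "(\<lambda>p. hmul (fst p) (snd p)) ` (closure (hbox 1) \<times> closure (hbox r)) \<subseteq> hbox r'"
    using bounded_imp_hbox compact_imp_bounded by blast
  define R where "R = max r r'"
  have zero: "c (hmul (- q n) x) - c x = 0" if x: "x \<notin> hbox R" for n x
  proof -
    have "inv_Suc n \<le> 1" by (simp add: inv_Suc_def)
    then have q1: "q n \<in> closure (hbox 1)" using q[of n] closure_subset[of "hbox 1"] by (auto simp: hbox_def)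
    have "x \<notin> hbox r" using x by (auto simp: R_def hbox_def)
    moreover have "hmul (- q n) x \<notin> hbox r"
    proof
      assume "hmul (- q n) x \<in> hbox r"
      then have "(q n, hmul (- q n) x) \<in> closure (hbox 1) \<times> closure (hbox r)" using q1 closure_subset[of "hbox r"] by auto
      then have "hmul (q n) (hmul (- q n) x) \<in> hbox r'" using r' by force
      then show False using x by (auto simp: R_def hbox_def)
    qed
    ultimately show ?thesis using c(2) by simp
  qed
  have q0: "q \<longlonglongrightarrow> 0"
  proof -
    have g: "(\<lambda>n. hgauge (q n)) \<longlonglongrightarrow> 0"
      by (rule tendsto_sandwich[OF _ _ tendsto_const[of 0] inv_Suc(2)]) (use q in \<open>auto simp: hbox_def hgauge_nonneg\<close>)
    have g2: "(\<lambda>n. (hgauge (q n))\<^sup>2) \<longlonglongrightarrow> 0" using tendsto_power[OF g, of 2] by simp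
    have "(\<lambda>n. Re (fst (q n))) \<longlonglongrightarrow> 0" "(\<lambda>n. Im (fst (q n))) \<longlonglongrightarrow> 0" "(\<lambda>n. snd (q n)) \<longlonglongrightarrow> 0"
      by (rule Lim_null_comparison[OF _ g] Lim_null_comparison[OF _ g2], use hgauge_bounds in auto)+
    then have "(\<lambda>n. (Complex (Re (fst (q n))) (Im (fst (q n))), snd (q n))) \<longlonglongrightarrow> (Complex 0 0, 0)"
      by (intro tendsto_Pair tendsto_Complex)
    then show ?thesis by (simp add: zero_prod_def zero_complex.code)
  qed
  have "(\<lambda>n. power_integral 2 (\<lambda>x. c (hmul (- q n) x) - c x)) \<longlonglongrightarrow> 0"
  proof (rule power_integral_tendsto_0[where w="\<lambda>x. ennreal ((2 * B)\<^sup>2) * indicator (hbox R) x"])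
    have "emeasure lborel (hbox R) \<le> emeasure lborel (hbox \<bar>R\<bar>)" by (intro emeasure_mono) (auto simp: hbox_def)
    then have "emeasure lborel (hbox R) < \<infinity>" by (rule le_less_trans) (simp add: emeasure_hbox)
    then show "(\<integral>\<^sup>+x. ennreal ((2 * B)\<^sup>2) * indicator (hbox R) x \<partial>lborel) < \<infinity>"
      by (simp add: nn_integral_cmult_indicator ennreal_mult_less_top)
    show "ennreal ((norm (c (hmul (- q n) x) - c x))\<^sup>2) \<le> ennreal ((2 * B)\<^sup>2) * indicator (hbox R) x" for n x
    proof (cases "x \<in> hbox R")
      case True
      have "norm (c (hmul (- q n) x) - c x) \<le> 2 * B"
        using norm_triangle_ineq4[of "c (hmul (- q n) x)" "c x"] B[of "hmul (- q n) x"] B[of x] by linarith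
      then have "(norm (c (hmul (- q n) x) - c x))\<^sup>2 \<le> (2 * B)\<^sup>2" by (intro power_mono) auto
      from ennreal_leI[OF this] show ?thesis by (simp only: True indicator_simps mult_1_right)
    qed (simp add: zero)
    show "AE x in lborel. (\<lambda>n. c (hmul (- q n) x) - c x) \<longlonglongrightarrow> 0"
    proof (rule AE_I2)
      fix x
      have "(\<lambda>n. hmul (- q n) x) \<longlonglongrightarrow> hmul (- 0) x"
        unfolding hmul_def by (intro tendsto_intros q0)
      then have "(\<lambda>n. hmul (- q n) x) \<longlonglongrightarrow> x" by simp
      moreover have "isCont c x" using c(1) by (metis UNIV_I continuous_on_eq_continuous_at open_UNIV)
      ultimately have "(\<lambda>n. c (hmul (- q n) x)) \<longlonglongrightarrow> c x" by (rule isCont_tendsto_compose[rotated])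
      then show "(\<lambda>n. c (hmul (- q n) x) - c x) \<longlonglongrightarrow> 0" by (rule LIM_zero)
    qed
  qed measurable
  from ennreal_tendsto_0D[OF this, of "e / 48"] e
  have "\<forall>\<^sub>F n in sequentially. power_integral 2 (\<lambda>x. c (hmul (- q n) x) - c x) \<le> ennreal (e / 48)" by simp
  then show "\<forall>\<^sub>F n in sequentially. power_integral 2 (\<lambda>x. v (hmul (- q n) x) - v x) \<le> ennreal e"
  proof eventually_elim
    case (elim n)
    let ?T = "hmul (- q n)"
    have tr: "power_integral 2 (\<lambda>x. v (?T x) - c (?T x)) = power_integral 2 (\<lambda>x. v x - c x)"
      unfolding power_integral_def
      by (rule nn_integral_preserve[OF distr_hmul_left, where f="\<lambda>x. ennreal (norm (v x - c x) powr 2)"]) measurable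
    have "power_integral 2 (\<lambda>x. (v (?T x) - c (?T x)) + ((c (?T x) - c x) + (c x - v x)))
      \<le> ennreal (2 powr 2) * (power_integral 2 (\<lambda>x. v (?T x) - c (?T x)) + power_integral 2 (\<lambda>x. (c (?T x) - c x) + (c x - v x)))"
      by (rule power_integral_add) measurable
    also have "\<dots> \<le> ennreal (2 powr 2) * (ennreal (e / 48) + ennreal (2 powr 2) * (ennreal (e / 48) + ennreal (e / 48)))"
    proof (intro mult_left_mono add_mono)
      show "power_integral 2 (\<lambda>x. v (?T x) - c (?T x)) \<le> ennreal (e / 48)"
        unfolding tr using cv by (subst power_integral_diff_commute)
      have "power_integral 2 (\<lambda>x. (c (?T x) - c x) + (c x - v x))
         \<le> ennreal (2 powr 2) * (power_integral 2 (\<lambda>x. c (?T x) - c x) + power_integral 2 (\<lambda>x. c x - v x))"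
        by (rule power_integral_add) measurable
      also have "\<dots> \<le> ennreal (2 powr 2) * (ennreal (e / 48) + ennreal (e / 48))"
        by (intro mult_left_mono add_mono cv elim) auto
      finally show "power_integral 2 (\<lambda>x. (c (?T x) - c x) + (c x - v x)) \<le> \<dots>" .
    qed auto
    also have "\<dots> = ennreal (4 * (e / 48 + 4 * (e / 48 + e / 48)))"
      using e by (subst ennreal_mult, simp, simp, subst ennreal_plus, simp, simp, subst ennreal_mult, simp, simp,
        subst ennreal_plus) simp_all
    also have "\<dots> \<le> ennreal e" using e by (intro ennreal_leI) simp
    finally show ?case by simp
  qed
qed

section \<open>Mollification\<close>

lemma le_one_plus_square: "x \<le> 1 + x\<^sup>2" if "0 \<le> x" for x :: real
  using sum_squares_bound[of x 1] that by simp

text \<open>The variance of \<open>norm d\<close> for the density \<open>\<phi>\<close> is nonnegative.\<close>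

lemma jensen_square:
  fixes \<phi> :: "heis \<Rightarrow> real" and d :: "heis \<Rightarrow> complex"
  assumes \<phi> [measurable]: "integrable lborel \<phi>" "\<And>q. 0 \<le> \<phi> q" "(\<integral>q. \<phi> q \<partial>lborel) = 1"
    and d [measurable]: "d \<in> borel_measurable borel"
  shows "ennreal ((norm (\<integral>q. of_real (\<phi> q) * d q \<partial>lborel))\<^sup>2) \<le> (\<integral>\<^sup>+q. ennreal (\<phi> q * (norm (d q))\<^sup>2) \<partial>lborel)"
proof (cases "(\<integral>\<^sup>+q. ennreal (\<phi> q * (norm (d q))\<^sup>2) \<partial>lborel) < \<infinity>")
  case True
  have [measurable]: "\<phi> \<in> borel_measurable borel" using borel_measurable_integrable[OF \<phi>(1)] by simp
  have i2: "integrable lborel (\<lambda>q. \<phi> q * (norm (d q))\<^sup>2)"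
    using True \<phi>(2) by (intro integrableI_nonneg) auto
  have i1: "integrable lborel (\<lambda>q. \<phi> q * norm (d q))"
  proof (rule Bochner_Integration.integrable_bound[OF Bochner_Integration.integrable_add[OF \<phi>(1) i2]])
    show "AE q in lborel. norm (\<phi> q * norm (d q)) \<le> norm (\<phi> q + \<phi> q * (norm (d q))\<^sup>2)"
    proof (rule AE_I2)
      fix q
      have "norm (d q) \<le> 1 + (norm (d q))\<^sup>2" by (simp add: le_one_plus_square)
      from mult_left_mono[OF this \<phi>(2)] show "norm (\<phi> q * norm (d q)) \<le> norm (\<phi> q + \<phi> q * (norm (d q))\<^sup>2)"
        using \<phi>(2)[of q] by (simp add: algebra_simps)
    qed
  qed measurable
  define D where "D = (\<integral>q. \<phi> q * norm (d q) \<partial>lborel)"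
  have "norm (\<integral>q. of_real (\<phi> q) * d q \<partial>lborel) \<le> (\<integral>q. norm (of_real (\<phi> q) * d q) \<partial>lborel)" by (rule integral_norm_bound)
  also have "\<dots> = D" using \<phi>(2) by (simp add: D_def norm_mult)
  finally have nD: "norm (\<integral>q. of_real (\<phi> q) * d q \<partial>lborel) \<le> D" .
  have "0 \<le> (\<integral>q. \<phi> q * (norm (d q) - D)\<^sup>2 \<partial>lborel)" using \<phi>(2) by (intro integral_nonneg_AE) auto
  also have "\<dots> = (\<integral>q. \<phi> q * (norm (d q))\<^sup>2 - 2 * D * (\<phi> q * norm (d q)) + D\<^sup>2 * \<phi> q \<partial>lborel)"
    by (simp add: power2_eq_square algebra_simps)
  also have "\<dots> = (\<integral>q. \<phi> q * (norm (d q))\<^sup>2 \<partial>lborel) - 2 * D * D + D\<^sup>2 * 1"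
    using i1 i2 \<phi>(1) by (simp add: D_def[symmetric] \<phi>(3))
  finally have "D\<^sup>2 \<le> (\<integral>q. \<phi> q * (norm (d q))\<^sup>2 \<partial>lborel)" by (simp add: power2_eq_square)
  moreover have "(norm (\<integral>q. of_real (\<phi> q) * d q \<partial>lborel))\<^sup>2 \<le> D\<^sup>2" using nD by (intro power_mono) auto
  ultimately have "(norm (\<integral>q. of_real (\<phi> q) * d q \<partial>lborel))\<^sup>2 \<le> (\<integral>q. \<phi> q * (norm (d q))\<^sup>2 \<partial>lborel)" by linarith
  moreover have "(\<integral>\<^sup>+q. ennreal (\<phi> q * (norm (d q))\<^sup>2) \<partial>lborel) = ennreal (\<integral>q. \<phi> q * (norm (d q))\<^sup>2 \<partial>lborel)"
    using i2 \<phi>(2) by (intro nn_integral_eq_integral) auto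
  ultimately show ?thesis by (simp add: ennreal_leI)
qed (simp add: not_less top_unique)

definition cutoff_re :: "real \<Rightarrow> heis \<Rightarrow> real" where "cutoff_re R q = Re (cutoff R q)"

definition mollifier :: "nat \<Rightarrow> heis \<Rightarrow> real" where
  "mollifier n q = cutoff_re (inv_Suc n / 2) q / (\<integral>q. cutoff_re (inv_Suc n / 2) q \<partial>lborel)"

lemma cutoff_re: "cutoff R q = of_real (cutoff_re R q)" "0 \<le> cutoff_re R q" "cutoff_re R q \<le> 1"
  using cutoff_real[of R q] by (auto simp: cutoff_re_def)

lemma integrable_cutoff_re: "0 < R \<Longrightarrow> integrable lborel (cutoff_re R)"
  unfolding cutoff_re_def[abs_def] using test_integrable[OF test_cutoff] by simp

lemma integral_cutoff_re_pos: assumes "0 < R" shows "0 < (\<integral>q. cutoff_re R q \<partial>lborel)"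
proof -
  have fin: "emeasure lborel (hbox R) < \<infinity>" using assms by (simp add: emeasure_hbox)
  have "0 < 8 * R ^ 4" using assms by simp
  also have "8 * R ^ 4 = measure lborel (hbox R)" using assms by (simp add: measure_def emeasure_hbox)
  also have "\<dots> = (\<integral>q. indicator (hbox R) q \<partial>lborel)" by simp
  also have "\<dots> \<le> (\<integral>q. cutoff_re R q \<partial>lborel)"
  proof (rule integral_mono)
    show "integrable lborel (indicator (hbox R) :: heis \<Rightarrow> real)" using fin by simp
    show "indicator (hbox R) q \<le> cutoff_re R q" for q
      using assms cutoff_re(2)[of R q] cutoff_eq_1[of R q] by (auto simp: indicator_def hbox_def cutoff_re_def)
  qed (rule integrable_cutoff_re[OF assms])
  finally show ?thesis .
qed

lemma mollifier:
  shows "0 \<le> mollifier n q" "integrable lborel (mollifier n)" "(\<integral>q. mollifier n q \<partial>lborel) = 1"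
    "q \<notin> hbox (inv_Suc n) \<Longrightarrow> mollifier n q = 0" "(\<lambda>q. complex_of_real (mollifier n q)) \<in> test_functions"
proof -
  have R: "0 < inv_Suc n / 2" using inv_Suc(1)[of n] by simp
  note pos = integral_cutoff_re_pos[OF R]
  show "0 \<le> mollifier n q" using pos cutoff_re(2) by (simp add: mollifier_def)
  show "integrable lborel (mollifier n)" unfolding mollifier_def using integrable_cutoff_re[OF R] by simp
  show "(\<integral>q. mollifier n q \<partial>lborel) = 1" unfolding mollifier_def using pos by simp
  have "(\<lambda>q. complex_of_real (mollifier n q)) = (\<lambda>q. 1 / of_real (\<integral>q. cutoff_re (inv_Suc n / 2) q \<partial>lborel) * cutoff (inv_Suc n / 2) q)"
    by (simp add: mollifier_def cutoff_re(1))
  then show "(\<lambda>q. complex_of_real (mollifier n q)) \<in> test_functions"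
    by (simp only: test_cmult test_cutoff R)
  assume "q \<notin> hbox (inv_Suc n)"
  then have "2 * (inv_Suc n / 2) < hgauge q" by (simp add: hbox_def)
  from hgauge_large[OF R this] have "cutoff (inv_Suc n / 2) q = 0"
    using plateau_eq_0 less_imp_le by (auto simp: cutoff_def)
  then show "mollifier n q = 0" by (simp add: mollifier_def cutoff_re_def)
qed

lemma L2_locally_integrable:
  assumes [measurable]: "v \<in> borel_measurable borel" and fin: "power_integral 2 v < \<infinity>"
  shows "locally_integrable v"
proof -
  have "(\<integral>\<^sup>+y. ennreal (norm (v y)) * indicator (hbox r) y \<partial>lborel) < \<infinity>" for r
  proof -
    have "(\<integral>\<^sup>+y. ennreal (norm (v y)) * indicator (hbox r) y \<partial>lborel)
      \<le> (\<integral>\<^sup>+y. indicator (hbox \<bar>r\<bar>) y + ennreal ((norm (v y))\<^sup>2) \<partial>lborel)"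
    proof (rule nn_integral_mono)
      fix y
      have "norm (v y) \<le> 1 + (norm (v y))\<^sup>2" by (simp add: le_one_plus_square)
      then have "ennreal (norm (v y)) \<le> ennreal (1 + (norm (v y))\<^sup>2)" by (rule ennreal_leI)
      also have "\<dots> = 1 + ennreal ((norm (v y))\<^sup>2)" by (subst ennreal_plus) auto
      finally show "ennreal (norm (v y)) * indicator (hbox r) y \<le> indicator (hbox \<bar>r\<bar>) y + ennreal ((norm (v y))\<^sup>2)"
        by (auto simp: indicator_def hbox_def)
    qed
    also have "\<dots> = emeasure lborel (hbox \<bar>r\<bar>) + power_integral 2 v"
      by (subst nn_integral_add) (auto simp: power_integral_2)
    also have "\<dots> < \<infinity>" using fin by (simp add: emeasure_hbox)
    finally show ?thesis .
  qed
  then show ?thesis by (simp add: locally_integrable_def)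
qed

text \<open>By \<open>jensen_square\<close> and Fubini the error is an average, over \<open>q\<close> in the support of the mollifier, of the
  errors of translation by \<open>q\<close>.\<close>

lemma mollify_converges:
  assumes v [measurable]: "v \<in> borel_measurable borel" and fin: "power_integral 2 v < \<infinity>"
  shows "(\<lambda>n. power_integral 2 (\<lambda>x. hconv (\<lambda>q. of_real (mollifier n q)) v x - v x)) \<longlonglongrightarrow> 0"
proof (rule ennreal_tendsto_0I)
  fix e :: real assume e: "0 < e"
  have lv: "locally_integrable v" by (rule L2_locally_integrable[OF v fin])
  have [measurable]: "mollifier n \<in> borel_measurable borel" for n using borel_measurable_integrable[OF mollifier(2)] by simp
  define \<tau> where "\<tau> q = power_integral 2 (\<lambda>x. v (hmul (- q) x) - v x)" for q
  \<comment> \<open>A translation by an element of the \<open>n\<close>-th box with error above \<open>e\<close>, if there is one; this makes \<open>translation_continuous\<close> uniform over the boxes.\<close>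
  define q where "q n = (if \<exists>q\<in>hbox (inv_Suc n). \<not> \<tau> q \<le> ennreal e
      then (SOME q. q \<in> hbox (inv_Suc n) \<and> \<not> \<tau> q \<le> ennreal e) else 0)" for n
  have q: "q n \<in> hbox (inv_Suc n) \<and> ((\<exists>q\<in>hbox (inv_Suc n). \<not> \<tau> q \<le> ennreal e) \<longrightarrow> \<not> \<tau> (q n) \<le> ennreal e)" for n
  proof (cases "\<exists>q\<in>hbox (inv_Suc n). \<not> \<tau> q \<le> ennreal e")
    case True
    then have "\<exists>q. q \<in> hbox (inv_Suc n) \<and> \<not> \<tau> q \<le> ennreal e" by blast
    from someI_ex[OF this] show ?thesis using True by (simp add: q_def)
  next
    case False
    then have "q n = 0" unfolding q_def by (rule if_not_P)
    moreover have "0 \<in> hbox (inv_Suc n)" using inv_Suc(1)[of n] by (simp add: hbox_def hgauge_def)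
    ultimately show ?thesis using False by simp
  qed
  have "(\<lambda>n. \<tau> (q n)) \<longlonglongrightarrow> 0" unfolding \<tau>_def using translation_continuous[OF v fin] q by blast
  from ennreal_tendsto_0D[OF this e]
  show "\<forall>\<^sub>F n in sequentially. power_integral 2 (\<lambda>x. hconv (\<lambda>q. of_real (mollifier n q)) v x - v x) \<le> ennreal e"
  proof eventually_elim
    case (elim n)
    let ?\<phi> = "mollifier n"
    have \<tau>: "\<tau> p \<le> ennreal e" if "p \<in> hbox (inv_Suc n)" for p using q[of n] elim that by blast
    have conv: "hconv (\<lambda>q. of_real (?\<phi> q)) v x - v x = (\<integral>p. of_real (?\<phi> p) * (v (hmul (- p) x) - v x) \<partial>lborel)" for x
    proof -
      have "integrable lborel (\<lambda>p. (\<lambda>y. of_real (?\<phi> (hmul x (- y))) * v y) (hmul (- p) x))"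
        by (subst integral_preserve(2)[OF distr_inverse_hmul]) (auto intro: hconv_integrable[OF mollifier(5) lv])
      then have "integrable lborel (\<lambda>p. of_real (?\<phi> p) * v (hmul (- p) x))" by (simp add: minus_hmul)
      moreover have "integrable lborel (\<lambda>p. complex_of_real (?\<phi> p) * v x)"
        using test_integrable[OF mollifier(5)] by simp
      moreover have "(\<integral>p. complex_of_real (?\<phi> p) * v x \<partial>lborel) = v x"
        by (simp add: mollifier(3))
      ultimately show ?thesis by (simp add: hconv_alt right_diff_distrib)
    qed
    have "power_integral 2 (\<lambda>x. hconv (\<lambda>q. of_real (?\<phi> q)) v x - v x)
       \<le> (\<integral>\<^sup>+x. \<integral>\<^sup>+p. ennreal (?\<phi> p * (norm (v (hmul (- p) x) - v x))\<^sup>2) \<partial>lborel \<partial>lborel)"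
      unfolding power_integral_2 conv by (intro nn_integral_mono jensen_square mollifier) measurable
    also have "\<dots> = (\<integral>\<^sup>+p. \<integral>\<^sup>+x. ennreal (?\<phi> p * (norm (v (hmul (- p) x) - v x))\<^sup>2) \<partial>lborel \<partial>lborel)"
      by (rule lborel_pair.Fubini') measurable
    also have "\<dots> = (\<integral>\<^sup>+p. ennreal (?\<phi> p) * \<tau> p \<partial>lborel)"
      unfolding \<tau>_def power_integral_2
      by (subst nn_integral_cmult[symmetric]) (auto simp: ennreal_mult mollifier(1))
    also have "\<dots> \<le> (\<integral>\<^sup>+p. ennreal (?\<phi> p) * ennreal e \<partial>lborel)"
    proof (rule nn_integral_mono)
      fix p show "ennreal (?\<phi> p) * \<tau> p \<le> ennreal (?\<phi> p) * ennreal e"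
        using \<tau>[of p] mollifier(4)[of p n] by (cases "p \<in> hbox (inv_Suc n)") (auto intro: mult_left_mono)
    qed
    also have "\<dots> = (\<integral>\<^sup>+p. ennreal (?\<phi> p) \<partial>lborel) * ennreal e" by (rule nn_integral_multc) measurable
    also have "(\<integral>\<^sup>+p. ennreal (?\<phi> p) \<partial>lborel) = ennreal 1"
      using nn_integral_eq_integral[OF mollifier(2), of n] mollifier(1,3) by simp
    finally show ?case by simp
  qed
qed

text \<open>A superposition of left translates of a weak solution is a weak solution, and it is
  smooth, hence a solution.\<close>

lemma hconv_weak_Zbar:
  assumes \<phi>: "\<phi> \<in> test_functions" and v [measurable]: "v \<in> borel_measurable borel" and fin: "power_integral 2 v < \<infinity>"
    and weak: "\<And>w. w \<in> test_functions \<Longrightarrow> (\<integral>x. Zbar w x * v x \<partial>lborel) = 0"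
  shows "Zbar (hconv \<phi> v) p = 0"
proof -
  have s: "smooth (hconv \<phi> v)" by (rule smooth_hconv[OF \<phi> L2_locally_integrable[OF v fin]])
  have [measurable]: "\<phi> \<in> borel_measurable borel" by (rule test_measurable[OF \<phi>])
  have "(\<integral>x. Zbar (hconv \<phi> v) x * w x \<partial>lborel) = 0" if w: "w \<in> test_functions" for w
  proof -
    have Zw: "Zbar w \<in> test_functions" by (rule test_Zbar[OF w])
    have [measurable]: "Zbar w \<in> borel_measurable borel" by (rule test_measurable[OF Zw])
    define F where "F = (\<lambda>p. \<phi> (fst p) * v (hmul (- fst p) (snd p)) * Zbar w (snd p))"
    note measurable_fst_snd [measurable]
    have Fm [measurable]: "F \<in> borel_measurable borel" unfolding F_def by measurable
    define S where "S = power_integral 2 v + power_integral 2 (Zbar w)"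
    have S: "S < \<infinity>" using fin test_Lp[OF Zw, of 2] by (simp add: S_def Lp_heis_iff)
    have "(\<integral>\<^sup>+x. ennreal (norm (F (q, x))) \<partial>lborel) \<le> ennreal (norm (\<phi> q)) * S" for q
    proof -
      have "(\<integral>\<^sup>+x. ennreal (norm (F (q, x))) \<partial>lborel)
        \<le> (\<integral>\<^sup>+x. ennreal (norm (\<phi> q)) * (ennreal ((norm (v (hmul (- q) x)))\<^sup>2) + ennreal ((norm (Zbar w x))\<^sup>2)) \<partial>lborel)"
      proof (rule nn_integral_mono)
        fix x
        define a b where "a = norm (v (hmul (- q) x))" and "b = norm (Zbar w x)"
        have ab: "0 \<le> a" "0 \<le> b" by (simp_all add: a_def b_def)
        have "0 \<le> (a - b)\<^sup>2 + a * b + a * b" using ab by simp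
        then have "a * b \<le> a\<^sup>2 + b\<^sup>2" using ab mult_nonneg_nonneg[OF ab] sum_squares_bound[of a b] by linarith
        from mult_left_mono[OF this, of "norm (\<phi> q)"]
        have "norm (F (q, x)) \<le> norm (\<phi> q) * (a\<^sup>2 + b\<^sup>2)" by (simp add: F_def norm_mult a_def b_def mult_ac)
        then have "ennreal (norm (F (q, x))) \<le> ennreal (norm (\<phi> q) * (a\<^sup>2 + b\<^sup>2))" by (rule ennreal_leI)
        also have "\<dots> = ennreal (norm (\<phi> q)) * (ennreal (a\<^sup>2) + ennreal (b\<^sup>2))"
          by (subst ennreal_mult) (auto simp: ennreal_plus)
        finally show "ennreal (norm (F (q, x))) \<le> ennreal (norm (\<phi> q)) * (ennreal ((norm (v (hmul (- q) x)))\<^sup>2) + ennreal ((norm (Zbar w x))\<^sup>2))"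
          by (simp only: a_def b_def)
      qed
      also have "\<dots> = ennreal (norm (\<phi> q)) * ((\<integral>\<^sup>+x. ennreal ((norm (v (hmul (- q) x)))\<^sup>2) \<partial>lborel) + (\<integral>\<^sup>+x. ennreal ((norm (Zbar w x))\<^sup>2) \<partial>lborel))"
        by (simp add: nn_integral_cmult nn_integral_add)
      also have "(\<integral>\<^sup>+x. ennreal ((norm (v (hmul (- q) x)))\<^sup>2) \<partial>lborel) = power_integral 2 v"
        unfolding power_integral_2
        by (rule nn_integral_preserve[OF distr_hmul_left, where f="\<lambda>x. ennreal ((norm (v x))\<^sup>2)"]) measurable
      finally show ?thesis by (simp add: S_def power_integral_2)
    qed
    then have "(\<integral>\<^sup>+q. \<integral>\<^sup>+x. ennreal (norm (F (q, x))) \<partial>lborel \<partial>lborel) \<le> (\<integral>\<^sup>+q. ennreal (norm (\<phi> q)) * S \<partial>lborel)"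
      by (intro nn_integral_mono)
    also have "\<dots> < \<infinity>" using S test_norm_finite[OF \<phi>] by (simp add: nn_integral_multc ennreal_mult_less_top)
    finally have Fb: "(\<integral>\<^sup>+q. \<integral>\<^sup>+x. ennreal (norm (F (q, x))) \<partial>lborel \<partial>lborel) < \<infinity>" .
    have inner: "(\<integral>x. F (q, x) \<partial>lborel) = 0" for q
    proof -
      have "(\<integral>x. F (q, x) \<partial>lborel) = \<phi> q * (\<integral>x. (\<lambda>y. v y * Zbar w (hmul q y)) (hmul (- q) x) \<partial>lborel)"
        by (simp add: F_def mult.assoc)
      also have "(\<integral>x. (\<lambda>y. v y * Zbar w (hmul q y)) (hmul (- q) x) \<partial>lborel) = (\<integral>y. v y * Zbar w (hmul q y) \<partial>lborel)"
        by (rule integral_preserve(1)[OF distr_hmul_left]) measurable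
      also have "\<dots> = (\<integral>y. Zbar (\<lambda>y. w (hmul q y)) y * v y \<partial>lborel)"
        by (simp add: Zbar_translate[OF test_smooth[OF w]] mult.commute)
      also have "\<dots> = 0" by (rule weak[OF test_translate[OF w]])
      finally show ?thesis by simp
    qed
    have "(\<integral>x. Zbar w x * hconv \<phi> v x \<partial>lborel) = (\<integral>x. \<integral>q. F (q, x) \<partial>lborel \<partial>lborel)"
      by (rule Bochner_Integration.integral_cong) (simp_all add: hconv_alt F_def mult.commute)
    also have "\<dots> = 0" using fubini_swap[OF Fm Fb] by (simp add: inner)
    finally show ?thesis using Zbar_parts[OF w s] by (simp add: mult.commute)
  qed
  from smooth_weak_zero[OF smooth_Zbar[OF s] this] show ?thesis .
qed

section \<open>Weak solutions lie in the kernel\<close>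

text \<open>The left-hand side is the formula for \<open>Zbar_star\<close>: complex conjugation turns it into \<open>- Zbar\<close>.\<close>

lemma Zbar_cnj:
  assumes "smooth s"
  shows "- ((d_x (\<lambda>p. cnj (s p)) p - \<i> * d_y (\<lambda>p. cnj (s p)) p) / 2 + \<i> * cnj (fst p) * d_t (\<lambda>p. cnj (s p)) p) = - cnj (Zbar s p)"
proof -
  have "((\<lambda>p. cnj (s p)) has_derivative (\<lambda>v. cnj (frechet_derivative s (at p) v))) (at p)"
    by (intro has_derivative_cnj smooth_diff assms)
  from fd_eq[OF this] show ?thesis
    by (simp add: d_x_def d_y_def d_t_def Zbar_def d_zbar_def)
qed

lemma ex_both_small:
  assumes "(\<lambda>k. a k) \<longlonglongrightarrow> (0::ennreal)" "(\<lambda>k. b k) \<longlonglongrightarrow> (0::ennreal)" "0 < e"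
  shows "\<exists>k::nat. a k \<le> ennreal e \<and> b k \<le> ennreal e"
  using eventually_conj[OF ennreal_tendsto_0D[OF assms(1,3)] ennreal_tendsto_0D[OF assms(2,3)]]
  by (auto simp: eventually_sequentially)

lemma tendsto_inv_Suc: "(\<lambda>n. ennreal (inv_Suc n)) \<longlonglongrightarrow> 0"
  using tendsto_ennrealI[OF inv_Suc(2)] by simp

text \<open>Smooth approximate solutions may be replaced by compactly supported ones, by choosing the
  radius of the cutoff for each member of the sequence.\<close>

lemma cutoff_diagonal:
  fixes s :: "nat \<Rightarrow> heis \<Rightarrow> complex"
  assumes p: "0 < p" and q: "q = 4 * p / (p + 4)" and s: "\<And>n. smooth (s n)"
    and v [measurable]: "v \<in> borel_measurable borel" and vfin: "power_integral p v < \<infinity>"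
    and g [measurable]: "g \<in> borel_measurable borel" and gfin: "power_integral q g < \<infinity>"
    and sfin: "\<And>n. power_integral p (s n) < \<infinity>" "\<And>n. power_integral q (Zbar (s n)) < \<infinity>"
    and lim: "(\<lambda>n. power_integral p (\<lambda>x. s n x - v x)) \<longlonglongrightarrow> 0"
      "(\<lambda>n. power_integral q (\<lambda>x. Zbar (s n) x - g x)) \<longlonglongrightarrow> 0"
  shows "\<exists>us. (\<forall>n. us n \<in> test_functions) \<and> Lp_converges p heis_vol us v
    \<and> Lp_converges q heis_vol (\<lambda>n. Zbar (us n)) g"
proof -
  have q0: "0 < q" using p by (simp add: q)
  define A where "A n k = power_integral p (\<lambda>x. cutoff (real (Suc k)) x * s n x - s n x)" for n k
  define B where "B n k = power_integral q (\<lambda>x. Zbar (\<lambda>x. cutoff (real (Suc k)) x * s n x) x - Zbar (s n) x)" for n k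
  have "\<exists>k. A n k \<le> ennreal (inv_Suc n) \<and> B n k \<le> ennreal (inv_Suc n)" for n
    unfolding A_def B_def by (rule ex_both_small[OF cutoff_converges[OF p q s sfin] inv_Suc(1)])
  then obtain k where k: "\<And>n. A n (k n) \<le> ennreal (inv_Suc n)" "\<And>n. B n (k n) \<le> ennreal (inv_Suc n)"
    by metis
  define us where "us n = (\<lambda>x. cutoff (real (Suc (k n))) x * s n x)" for n
  have us: "us n \<in> test_functions" for n
    unfolding us_def using test_mult1[OF test_cutoff s, of "real (Suc (k n))" n] by (simp add: mult.commute)
  have comb: "(\<lambda>n. power_integral r (\<lambda>x. A n x - w x)) \<longlonglongrightarrow> 0"
    if r: "0 < r" and [measurable]: "\<And>n. A n \<in> borel_measurable borel" "\<And>n. B n \<in> borel_measurable borel" "w \<in> borel_measurable borel"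
      and AB: "\<And>n. power_integral r (\<lambda>x. A n x - B n x) \<le> ennreal (inv_Suc n)"
      and Bw: "(\<lambda>n. power_integral r (\<lambda>x. B n x - w x)) \<longlonglongrightarrow> 0" for r A B w
  proof (rule ennreal_tendsto_0_le)
    have "(\<lambda>n. ennreal (2 powr r) * (ennreal (inv_Suc n) + power_integral r (\<lambda>x. B n x - w x))) \<longlonglongrightarrow> ennreal (2 powr r) * (0 + 0)"
      by (intro ennreal_tendsto_cmult tendsto_add tendsto_inv_Suc Bw) simp
    then show "(\<lambda>n. ennreal (2 powr r) * (ennreal (inv_Suc n) + power_integral r (\<lambda>x. B n x - w x))) \<longlonglongrightarrow> 0" by simp
    fix n
    have "power_integral r (\<lambda>x. (A n x - B n x) + (B n x - w x))
        \<le> ennreal (2 powr r) * (power_integral r (\<lambda>x. A n x - B n x) + power_integral r (\<lambda>x. B n x - w x))"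
      by (rule power_integral_add[OF r]) measurable
    also have "\<dots> \<le> ennreal (2 powr r) * (ennreal (inv_Suc n) + power_integral r (\<lambda>x. B n x - w x))"
      by (intro mult_left_mono add_mono AB) auto
    finally show "power_integral r (\<lambda>x. A n x - w x) \<le> \<dots>" by simp
  qed
  have m: "s n \<in> borel_measurable borel" "Zbar (s n) \<in> borel_measurable borel" "us n \<in> borel_measurable borel" "Zbar (us n) \<in> borel_measurable borel" for n
    by (intro smooth_measurable smooth_Zbar s test_smooth us)+
  have "(\<lambda>n. power_integral p (\<lambda>x. us n x - v x)) \<longlonglongrightarrow> 0"
    by (rule comb[OF p m(3) m(1) v _ lim(1)]) (use k(1) in \<open>simp add: us_def A_def\<close>)
  then have 1: "Lp_converges p heis_vol us v"
    using vfin v by (intro Lp_convergesI[OF p test_Lp[OF us p]]) (simp_all add: Lp_heis_iff)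
  have "(\<lambda>n. power_integral q (\<lambda>x. Zbar (us n) x - g x)) \<longlonglongrightarrow> 0"
    by (rule comb[OF q0 m(4) m(2) g _ lim(2)]) (use k(2) in \<open>simp add: us_def B_def\<close>)
  then have 2: "Lp_converges q heis_vol (\<lambda>n. Zbar (us n)) g"
    using gfin g by (intro Lp_convergesI[OF q0 test_Lp[OF test_Zbar[OF us] q0]]) (simp_all add: Lp_heis_iff)
  show ?thesis using us 1 2 by blast
qed

lemma Lp_cnj: "f \<in> Lp p heis_vol \<Longrightarrow> (\<lambda>x. cnj (f x)) \<in> Lp p heis_vol"
proof -
  have "cnj \<in> borel_measurable borel" by (intro borel_measurable_continuous_onI continuous_intros)
  then show "f \<in> Lp p heis_vol \<Longrightarrow> (\<lambda>x. cnj (f x)) \<in> Lp p heis_vol"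
    using measurable_compose[of f borel borel cnj borel] by (auto simp: Lp_heis_iff power_integral_def)
qed

text \<open>Weak and strong solutions agree. The mollified functions solve the equation exactly, so only the
  cutoff contributes to \<open>Zbar\<close>, with exponents \<open>p = 2\<close> and \<open>q = 4/3\<close>.\<close>

lemma weak_kernel_imp_ker:
  assumes h: "h \<in> Lp 2 heis_vol"
    and weak: "\<And>w. w \<in> test_functions \<Longrightarrow> (\<integral>x. Zbar w x * cnj (h x) \<partial>lborel) = 0"
  shows "h \<in> ker_Zbar_star"
proof -
  define v where "v = (\<lambda>x. cnj (h x))"
  have "v \<in> Lp 2 heis_vol" unfolding v_def by (rule Lp_cnj[OF h])
  then have v [measurable]: "v \<in> borel_measurable borel" and fin: "power_integral 2 v < \<infinity>" by (auto simp: Lp_heis_iff)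
  have "\<forall>\<^sub>F n in sequentially. power_integral 2 (\<lambda>x. hconv (\<lambda>q. of_real (mollifier n q)) v x - v x) \<le> ennreal 1"
    by (rule ennreal_tendsto_0D[OF mollify_converges[OF v fin]]) simp
  \<comment> \<open>Square integrability of the mollified functions is read off from their convergence, hence the shift by \<open>N\<close>.\<close>
  then obtain N where N: "\<And>n. N \<le> n \<Longrightarrow> power_integral 2 (\<lambda>x. hconv (\<lambda>q. of_real (mollifier n q)) v x - v x) \<le> 1"
    by (auto simp: eventually_sequentially)
  define s where "s n = hconv (\<lambda>q. of_real (mollifier (n + N) q)) v" for n
  have s: "smooth (s n)" for n unfolding s_def by (rule smooth_hconv[OF mollifier(5) L2_locally_integrable[OF v fin]])
  have Zs: "Zbar (s n) = (\<lambda>_. 0)" for n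
    unfolding s_def by (rule ext, rule hconv_weak_Zbar[OF mollifier(5) v fin]) (simp add: weak v_def)
  have lim: "(\<lambda>n. power_integral 2 (\<lambda>x. s n x - v x)) \<longlonglongrightarrow> 0"
    unfolding s_def by (rule LIMSEQ_ignore_initial_segment[OF mollify_converges[OF v fin]])
  have sm [measurable]: "s n \<in> borel_measurable borel" for n by (rule smooth_measurable[OF s])
  have sfin: "power_integral 2 (s n) < \<infinity>" for n
  proof -
    have "power_integral 2 (\<lambda>x. (s n x - v x) + v x) \<le> ennreal (2 powr 2) * (power_integral 2 (\<lambda>x. s n x - v x) + power_integral 2 v)"
      by (rule power_integral_add) auto
    also have "\<dots> < \<infinity>"
      using N[of "n + N"] fin by (auto simp: s_def ennreal_mult_less_top intro: le_less_trans)
    finally show ?thesis by simp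
  qed
  have "\<exists>us. (\<forall>n. us n \<in> test_functions) \<and> Lp_converges 2 heis_vol us v
    \<and> Lp_converges (4 / 3) heis_vol (\<lambda>n. Zbar (us n)) (\<lambda>_. 0)"
    by (rule cutoff_diagonal[OF _ _ s v fin _ _ sfin _ lim]) (auto simp: Zs power_integral_def)
  then obtain us where us: "\<And>n. us n \<in> test_functions" "Lp_converges 2 heis_vol us v"
    "Lp_converges (4 / 3) heis_vol (\<lambda>n. Zbar (us n)) (\<lambda>_. 0)" by blast
  define vs where "vs n = (\<lambda>x. cnj (us n x))" for n
  have vs: "vs n \<in> test_functions" for n unfolding vs_def by (rule test_cnj[OF us(1)])
  have star: "Zbar_star (vs n) = (\<lambda>p. - cnj (Zbar (us n) p))" for n
    unfolding Zbar_star_eq[OF vs] unfolding vs_def by (intro ext Zbar_cnj test_smooth us)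
  have "Lp_converges 2 heis_vol vs h"
  proof -
    have "norm (cnj (us n x) - h x) = norm (us n x - v x)" for n x
      unfolding v_def by (metis complex_cnj_cnj complex_cnj_diff complex_mod_cnj)
    then show ?thesis
      using us(2) h test_Lp[OF vs, of 2] by (simp add: Lp_converges_def Lp_norm_def vs_def)
  qed
  moreover have "Lp_converges (4 / 3) heis_vol (\<lambda>n. Zbar_star (vs n)) (\<lambda>_. 0)"
    using us(3) Lp_cnj[of "Zbar (us _)" "4 / 3"] unfolding star Lp_converges_def Lp_norm_def
    by (simp add: Lp_heis_iff power_integral_def)
  ultimately show ?thesis using h vs by (auto simp: ker_Zbar_star_def)
qed

section \<open>Square integrable functions\<close>

definition in_L2 :: "(heis \<Rightarrow> complex) \<Rightarrow> bool" where
  "in_L2 f \<longleftrightarrow> f \<in> borel_measurable borel \<and> power_integral 2 f < \<infinity>"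

definition sq_norm :: "(heis \<Rightarrow> complex) \<Rightarrow> real" where
  "sq_norm f = (\<integral>x. (norm (f x))\<^sup>2 \<partial>lborel)"

definition L2_inner :: "(heis \<Rightarrow> complex) \<Rightarrow> (heis \<Rightarrow> complex) \<Rightarrow> complex" where
  "L2_inner a b = (\<integral>x. a x * cnj (b x) \<partial>lborel)"

lemma in_L2_measurable: "in_L2 f \<Longrightarrow> f \<in> borel_measurable borel" by (simp add: in_L2_def)

lemma in_L2_integrable: assumes "in_L2 f" shows "integrable lborel (\<lambda>x. (norm (f x))\<^sup>2)"
proof -
  have [measurable]: "f \<in> borel_measurable borel" using assms by (simp add: in_L2_def)
  show ?thesis using assms by (intro integrableI_nonneg) (auto simp: in_L2_def power_integral_2)
qed

lemma power_integral_sq_norm: "in_L2 f \<Longrightarrow> power_integral 2 f = ennreal (sq_norm f)"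
  unfolding power_integral_2 sq_norm_def by (intro nn_integral_eq_integral in_L2_integrable) auto

lemma sq_norm_nonneg: "0 \<le> sq_norm f" by (simp add: sq_norm_def)

lemma in_L2_add: assumes "in_L2 f" "in_L2 g" shows "in_L2 (\<lambda>x. f x + g x)"
proof -
  have [measurable]: "f \<in> borel_measurable borel" "g \<in> borel_measurable borel" using assms by (auto simp: in_L2_def)
  have "power_integral 2 (\<lambda>x. f x + g x) \<le> ennreal (2 powr 2) * (power_integral 2 f + power_integral 2 g)"
    by (rule power_integral_add) auto
  also have "\<dots> < \<infinity>" using assms by (auto simp: in_L2_def ennreal_mult_less_top)
  finally show ?thesis by (simp add: in_L2_def)
qed

lemma in_L2_cmult: assumes "in_L2 f" shows "in_L2 (\<lambda>x. c * f x)"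
proof -
  have [measurable]: "f \<in> borel_measurable borel" using assms by (auto simp: in_L2_def)
  have "power_integral 2 (\<lambda>x. c * f x) = ennreal ((norm c)\<^sup>2) * power_integral 2 f"
    unfolding power_integral_2 by (subst nn_integral_cmult[symmetric]) (auto simp: norm_mult power_mult_distrib ennreal_mult)
  then show ?thesis using assms by (simp add: in_L2_def ennreal_mult_less_top)
qed

lemma in_L2_diff: "in_L2 f \<Longrightarrow> in_L2 g \<Longrightarrow> in_L2 (\<lambda>x. f x - g x)"
  using in_L2_add[of f "\<lambda>x. (-1) * g x"] in_L2_cmult[of g "-1"] by simp

lemma in_L2_test: "w \<in> test_functions \<Longrightarrow> in_L2 w"
  using test_Lp[of w 2] by (simp add: in_L2_def Lp_heis_iff)

lemma L2_inner_integrable: assumes "in_L2 a" "in_L2 b" shows "integrable lborel (\<lambda>x. a x * cnj (b x))"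
proof (rule Bochner_Integration.integrable_bound)
  have m: "a \<in> borel_measurable borel" "b \<in> borel_measurable borel" using assms by (auto simp: in_L2_def)
  have "cnj \<in> borel_measurable borel" by (intro borel_measurable_continuous_onI continuous_intros)
  from measurable_compose[OF m(2) this] m(1) show "(\<lambda>x. a x * cnj (b x)) \<in> borel_measurable lborel" by simp
  show "integrable lborel (\<lambda>x. (norm (a x))\<^sup>2 + (norm (b x))\<^sup>2)"
    using assms by (intro Bochner_Integration.integrable_add in_L2_integrable)
  show "AE x in lborel. norm (a x * cnj (b x)) \<le> norm ((norm (a x))\<^sup>2 + (norm (b x))\<^sup>2)"
  proof (rule AE_I2)
    fix x
    have "norm (a x) * norm (b x) \<le> (norm (a x))\<^sup>2 + (norm (b x))\<^sup>2"
      using sum_squares_bound[of "norm (a x)" "norm (b x)"] mult_nonneg_nonneg[OF norm_ge_zero[of "a x"] norm_ge_zero[of "b x"]]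
      by linarith
    then show "norm (a x * cnj (b x)) \<le> norm ((norm (a x))\<^sup>2 + (norm (b x))\<^sup>2)" by (simp add: norm_mult)
  qed
qed

lemma L2_inner_self: "L2_inner a a = of_real (sq_norm a)"
  unfolding L2_inner_def sq_norm_def complex_norm_square[symmetric] by (rule integral_complex_of_real)

lemma L2_inner_diff_left: "in_L2 a \<Longrightarrow> in_L2 b \<Longrightarrow> in_L2 c \<Longrightarrow> L2_inner (\<lambda>x. a x - b x) c = L2_inner a c - L2_inner b c"
  by (simp add: L2_inner_def left_diff_distrib L2_inner_integrable)

lemma L2_inner_cnj: "cnj (L2_inner a b) = L2_inner b a"
  unfolding L2_inner_def Bochner_Integration.integral_cnj[symmetric] by (simp add: mult.commute)

lemma sq_norm_diff_cmult:
  assumes "in_L2 a" "in_L2 b"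
  shows "sq_norm (\<lambda>x. a x - t * b x) = sq_norm a - 2 * Re (cnj t * L2_inner a b) + (norm t)\<^sup>2 * sq_norm b"
proof -
  have pt: "(norm (z - t * y))\<^sup>2 = (norm z)\<^sup>2 - 2 * Re (cnj t * (z * cnj y)) + (norm t)\<^sup>2 * (norm y)\<^sup>2" for z y :: complex
    unfolding cmod_power2 by (simp add: power2_eq_square algebra_simps)
  have i: "integrable lborel (\<lambda>x. cnj t * (a x * cnj (b x)))" using L2_inner_integrable[OF assms] by simp
  define r where "r x = Re (cnj t * (a x * cnj (b x)))" for x
  have r: "integrable lborel r" unfolding r_def using i by (rule integrable_Re)
  have "sq_norm (\<lambda>x. a x - t * b x) = (\<integral>x. (norm (a x))\<^sup>2 - 2 * r x + (norm t)\<^sup>2 * (norm (b x))\<^sup>2 \<partial>lborel)"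
    unfolding sq_norm_def pt r_def ..
  also have "\<dots> = sq_norm a - 2 * (\<integral>x. r x \<partial>lborel) + (norm t)\<^sup>2 * sq_norm b"
    using in_L2_integrable[OF assms(1)] in_L2_integrable[OF assms(2)] r by (simp add: sq_norm_def)
  also have "(\<integral>x. r x \<partial>lborel) = Re (\<integral>x. cnj t * (a x * cnj (b x)) \<partial>lborel)"
    unfolding r_def by (rule integral_Re[OF i])
  also have "(\<integral>x. cnj t * (a x * cnj (b x)) \<partial>lborel) = cnj t * L2_inner a b" by (simp add: L2_inner_def)
  finally show ?thesis .
qed

text \<open>Optimality of the projection in quantitative form: the choice \<open>t = \<langle>a, b\<rangle> / (\<parallel>b\<parallel>\<^sup>2 + 1)\<close> is nearly the best
  and is meaningful for \<open>b = 0\<close> too. For \<open>E = 0\<close> this is a form of the Cauchy-Schwarz inequality.\<close>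

lemma L2_inner_variational:
  assumes ab: "in_L2 a" "in_L2 b" and min: "\<And>t. E \<le> sq_norm (\<lambda>x. a x - t * b x)"
  shows "(norm (L2_inner a b))\<^sup>2 \<le> (sq_norm b + 1) * (sq_norm a - E)"
proof -
  define c B where "c = L2_inner a b" and "B = sq_norm b"
  have B: "0 \<le> B" by (simp add: B_def sq_norm_nonneg)
  define s where "s = 1 / (B + 1)"
  have s: "0 < s" "s * (B + 1) = 1" using B by (auto simp: s_def)
  have "Re (cnj (of_real s * c) * c) = s * (norm c)\<^sup>2"
    unfolding cmod_power2 by (simp add: power2_eq_square algebra_simps)
  then have "E \<le> sq_norm a - 2 * (s * (norm c)\<^sup>2) + (s * norm c)\<^sup>2 * B"
    using min[of "of_real s * c"] s(1) unfolding sq_norm_diff_cmult[OF ab] by (simp add: c_def B_def norm_mult)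
  then have "(2 * s - s\<^sup>2 * B) * (norm c)\<^sup>2 \<le> sq_norm a - E" by (simp add: power_mult_distrib algebra_simps)
  moreover have sB: "s \<le> 2 * s - s\<^sup>2 * B"
  proof -
    have "s * (s * B) \<le> s * 1" using s by (intro mult_left_mono) (auto simp: algebra_simps)
    then show ?thesis by (simp add: power2_eq_square)
  qed
  ultimately have le: "s * (norm c)\<^sup>2 \<le> sq_norm a - E"
    using mult_right_mono[OF sB zero_le_power2[of "norm c"]] by linarith
  have "(norm c)\<^sup>2 = s * (B + 1) * (norm c)\<^sup>2" unfolding s(2) by simp
  also have "\<dots> = (B + 1) * (s * (norm c)\<^sup>2)" by (simp only: mult_ac)
  also have "\<dots> \<le> (B + 1) * (sq_norm a - E)" using B by (intro mult_left_mono le) simp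
  finally show ?thesis unfolding c_def B_def .
qed

lemma tendsto_0_norm_square:
  fixes c :: "nat \<Rightarrow> complex"
  assumes "(\<lambda>n. (norm (c n))\<^sup>2) \<longlonglongrightarrow> 0" shows "c \<longlonglongrightarrow> 0"
  using tendsto_real_sqrt[OF assms] by (simp add: tendsto_norm_zero_iff)

lemma L2_inner_tendsto:
  assumes "\<And>n. in_L2 (a n)" "in_L2 h" "in_L2 b" and lim: "(\<lambda>n. sq_norm (\<lambda>x. a n x - h x)) \<longlonglongrightarrow> 0"
  shows "(\<lambda>n. L2_inner (a n) b) \<longlonglongrightarrow> L2_inner h b"
proof -
  have le: "(norm (L2_inner (a n) b - L2_inner h b))\<^sup>2 \<le> (sq_norm b + 1) * sq_norm (\<lambda>x. a n x - h x)" for n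
    using L2_inner_variational[OF in_L2_diff[OF assms(1)[of n] assms(2)] assms(3), of 0]
    unfolding L2_inner_diff_left[OF assms(1)[of n] assms(2,3)] diff_zero by (blast intro: sq_norm_nonneg)
  have "(\<lambda>n. (sq_norm b + 1) * sq_norm (\<lambda>x. a n x - h x)) \<longlonglongrightarrow> (sq_norm b + 1) * 0"
    by (intro tendsto_intros lim)
  then have L: "(\<lambda>n. (sq_norm b + 1) * sq_norm (\<lambda>x. a n x - h x)) \<longlonglongrightarrow> 0" by simp
  have "(\<lambda>n. (norm (L2_inner (a n) b - L2_inner h b))\<^sup>2) \<longlonglongrightarrow> 0"
    by (rule tendsto_sandwich[OF always_eventually always_eventually tendsto_const[of 0] L]; intro allI le zero_le_power2)
  then have "(\<lambda>n. L2_inner (a n) b - L2_inner h b) \<longlonglongrightarrow> 0" by (rule tendsto_0_norm_square)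
  then show ?thesis by (rule LIM_zero_cancel)
qed

lemma sq_norm_parallelogram:
  assumes "in_L2 a" "in_L2 b"
  shows "sq_norm (\<lambda>x. a x - b x) = 2 * sq_norm a + 2 * sq_norm b - sq_norm (\<lambda>x. a x + b x)"
  using sq_norm_diff_cmult[OF assms, of 1] sq_norm_diff_cmult[OF assms, of "-1"] by simp

section \<open>Completeness of L2\<close>

text \<open>The rate makes the weighted sum \<open>S = \<Sum>k. 4\<^sup>k \<bar>F (k+1) - F k\<bar>\<^sup>2\<close> integrable. Where \<open>S\<close> is finite
  the increments are at most \<open>sqrt S * 2\<^sup>-\<^sup>k\<close>, so the sequence converges to some \<open>G\<close> with
  \<open>\<bar>F n - G\<bar>\<^sup>2 \<le> 4 * 4\<^sup>-\<^sup>n * S\<close>.\<close>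

lemma L2_fast_Cauchy_converges:
  fixes F :: "nat \<Rightarrow> heis \<Rightarrow> complex"
  assumes [measurable]: "\<And>n. F n \<in> borel_measurable borel"
    and fast: "\<And>n. power_integral 2 (\<lambda>x. F (Suc n) x - F n x) \<le> ennreal (4 * (1/8) ^ n)"
  shows "\<exists>G. G \<in> borel_measurable borel \<and> (\<lambda>n. power_integral 2 (\<lambda>x. F n x - G x)) \<longlonglongrightarrow> 0"
proof -
  define S where "S x = (\<Sum>k. ennreal (4 ^ k * (norm (F (Suc k) x - F k x))\<^sup>2))" for x
  have [measurable]: "S \<in> borel_measurable borel" unfolding S_def by measurable
  have "(\<integral>\<^sup>+x. S x \<partial>lborel) = (\<Sum>k. \<integral>\<^sup>+x. ennreal (4 ^ k * (norm (F (Suc k) x - F k x))\<^sup>2) \<partial>lborel)"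
    unfolding S_def by (rule nn_integral_suminf) measurable
  also have "\<dots> \<le> (\<Sum>k. ennreal (4 * (1/2) ^ k))"
  proof (rule suminf_le)
    fix k
    have "(\<integral>\<^sup>+x. ennreal (4 ^ k * (norm (F (Suc k) x - F k x))\<^sup>2) \<partial>lborel) = ennreal (4 ^ k) * power_integral 2 (\<lambda>x. F (Suc k) x - F k x)"
      unfolding power_integral_2 by (subst nn_integral_cmult[symmetric]) (auto simp: ennreal_mult)
    also have "\<dots> \<le> ennreal (4 ^ k) * ennreal (4 * (1/8) ^ k)" by (intro mult_left_mono fast) auto
    also have "\<dots> = ennreal (4 ^ k * (4 * (1/8) ^ k))" by (subst ennreal_mult) auto
    also have "(4::real) ^ k * (4 * (1/8) ^ k) = 4 * (1/2) ^ k" by (simp flip: power_mult_distrib)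
    finally show "(\<integral>\<^sup>+x. ennreal (4 ^ k * (norm (F (Suc k) x - F k x))\<^sup>2) \<partial>lborel) \<le> ennreal (4 * (1/2) ^ k)" .
  qed auto
  also have "\<dots> = ennreal (4 * (1 / (1 - 1/2)))"
  proof (rule suminf_ennreal_eq)
    show "(\<lambda>k. 4 * (1/2 :: real) ^ k) sums (4 * (1 / (1 - 1/2)))" by (intro sums_mult geometric_sums) simp
  qed simp
  finally have S8: "(\<integral>\<^sup>+x. S x \<partial>lborel) \<le> 8" by simp
  define G where "G x = lim (\<lambda>n. F n x)" for x
  have Gm [measurable]: "G \<in> borel_measurable borel" unfolding G_def by (rule borel_measurable_lim_metric) auto
  have pt: "ennreal ((norm (F n x - G x))\<^sup>2) \<le> ennreal (4 * (1/4) ^ n) * S x" if fin: "S x < \<infinity>" for n x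
  proof -
    obtain s where s: "S x = ennreal s" "0 \<le> s" using fin by (cases "S x") auto
    have d: "norm (F (Suc k) x - F k x) \<le> sqrt s * (1/2) ^ k" for k
    proof -
      have "ennreal (4 ^ k * (norm (F (Suc k) x - F k x))\<^sup>2) = (\<Sum>i\<in>{k}. ennreal (4 ^ i * (norm (F (Suc i) x - F i x))\<^sup>2))" by simp
      also have "\<dots> \<le> S x" unfolding S_def by (rule sum_le_suminf) auto
      finally have "4 ^ k * (norm (F (Suc k) x - F k x))\<^sup>2 \<le> s" using s by simp
      moreover have "(4::real) ^ k = (2 ^ k)\<^sup>2" by (simp add: power2_eq_square flip: power_mult_distrib)
      ultimately have "(2 ^ k * norm (F (Suc k) x - F k x))\<^sup>2 \<le> s" by (simp add: power_mult_distrib)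
      then have "2 ^ k * norm (F (Suc k) x - F k x) \<le> sqrt s" by (rule real_le_rsqrt)
      then show ?thesis by (simp add: power_one_over field_simps)
    qed
    have tel: "norm (F (n + j) x - F n x) \<le> sqrt s * (2 * (1/2) ^ n - 2 * (1/2) ^ (n + j))" for n j
    proof (induction j)
      case (Suc j)
      have "norm (F (n + Suc j) x - F n x) \<le> norm (F (Suc (n + j)) x - F (n + j) x) + norm (F (n + j) x - F n x)"
        using norm_triangle_ineq[of "F (Suc (n + j)) x - F (n + j) x" "F (n + j) x - F n x"] by simp
      also have "\<dots> \<le> sqrt s * (1/2) ^ (n + j) + sqrt s * (2 * (1/2) ^ n - 2 * (1/2) ^ (n + j))"
        by (intro add_mono d Suc.IH)
      also have "\<dots> = sqrt s * (2 * (1/2) ^ n - 2 * (1/2) ^ (n + Suc j))" by (simp add: algebra_simps)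
      finally show ?case .
    qed simp
    have bd: "norm (F m x - F n x) \<le> 2 * sqrt s * (1/2) ^ n" if nm: "n \<le> m" for m n
    proof -
      obtain j where j: "m = n + j" using le_Suc_ex[OF nm] by blast
      have "norm (F m x - F n x) \<le> sqrt s * (2 * (1/2) ^ n - 2 * (1/2) ^ (n + j))" unfolding j by (rule tel)
      also have "\<dots> \<le> sqrt s * (2 * (1/2) ^ n)" using s by (intro mult_left_mono) auto
      finally show ?thesis by simp
    qed
    have "Cauchy (\<lambda>n. F n x)"
    proof (rule CauchyI')
      fix e :: real assume e: "0 < e"
      have "(\<lambda>n. 2 * sqrt s * (1/2) ^ n) \<longlonglongrightarrow> 2 * sqrt s * 0" by (intro tendsto_intros LIMSEQ_realpow_zero) auto
      then have "(\<lambda>n. 2 * sqrt s * (1/2) ^ n) \<longlonglongrightarrow> 0" by simp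
      from order_tendstoD(2)[OF this e] obtain N where N: "\<And>n. N \<le> n \<Longrightarrow> 2 * sqrt s * (1/2) ^ n < e"
        by (auto simp: eventually_sequentially)
      show "\<exists>M. \<forall>m\<ge>M. \<forall>n>m. dist (F m x) (F n x) < e"
      proof (intro exI[of _ N] allI impI)
        fix m n :: nat assume "N \<le> m" "m < n"
        then show "dist (F m x) (F n x) < e" using bd[of m n] N[of m] by (simp add: dist_norm norm_minus_commute)
      qed
    qed
    then have "(\<lambda>n. F n x) \<longlonglongrightarrow> G x" unfolding G_def by (intro convergent_LIMSEQ_iff[THEN iffD1] Cauchy_convergent)
    then have "(\<lambda>m. norm (F m x - F n x)) \<longlonglongrightarrow> norm (G x - F n x)" by (intro tendsto_intros)
    then have "norm (G x - F n x) \<le> 2 * sqrt s * (1/2) ^ n"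
      by (rule Lim_bounded[where M=n]) (use bd in auto)
    then have "(norm (F n x - G x))\<^sup>2 \<le> (2 * sqrt s * (1/2) ^ n)\<^sup>2" by (intro power_mono) (auto simp: norm_minus_commute)
    also have "\<dots> = 4 * (1/4) ^ n * s"
    proof -
      have "(((1/2) ^ n)\<^sup>2 :: real) = (1/4) ^ n" by (simp add: power2_eq_square flip: power_mult_distrib)
      then show ?thesis using s by (simp add: power_mult_distrib)
    qed
    finally have "ennreal ((norm (F n x - G x))\<^sup>2) \<le> ennreal (4 * (1/4) ^ n * s)" by (rule ennreal_leI)
    then show ?thesis using s by (simp add: ennreal_mult)
  qed
  have "AE x in lborel. S x \<noteq> \<infinity>" by (rule nn_integral_PInf_AE) (use S8 in \<open>auto simp: top_unique\<close>)
  then have AES: "AE x in lborel. S x < \<infinity>" by eventually_elim (simp add: less_top)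
  have "power_integral 2 (\<lambda>x. F n x - G x) \<le> ennreal (4 * (1/4) ^ n * 8)" for n
  proof -
    have "power_integral 2 (\<lambda>x. F n x - G x) \<le> (\<integral>\<^sup>+x. ennreal (4 * (1/4) ^ n) * S x \<partial>lborel)"
      unfolding power_integral_2 by (rule nn_integral_mono_AE, rule eventually_mono[OF AES], rule pt)
    also have "\<dots> = ennreal (4 * (1/4) ^ n) * (\<integral>\<^sup>+x. S x \<partial>lborel)" by (rule nn_integral_cmult) measurable
    also have "\<dots> \<le> ennreal (4 * (1/4) ^ n) * ennreal 8" by (intro mult_left_mono) (use S8 in auto)
    also have "\<dots> = ennreal (4 * (1/4) ^ n * 8)" by (rule ennreal_mult[symmetric]) auto
    finally show ?thesis .
  qed
  note bound = this
  have lim: "(\<lambda>n. ennreal (4 * (1/4) ^ n * 8)) \<longlonglongrightarrow> 0"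
  proof -
    have "(\<lambda>n. ennreal (4 * (1/4) ^ n * 8)) \<longlonglongrightarrow> ennreal (4 * 0 * 8)" by (intro tendsto_intros tendsto_ennrealI LIMSEQ_realpow_zero) auto
    then show ?thesis by simp
  qed
  from ennreal_tendsto_0_le[OF lim bound] Gm show ?thesis by blast
qed

section \<open>Solvability\<close>

text \<open>The projection theorem for the closure of the range of \<open>Zbar\<close> on test functions, by a
  minimising sequence. The error \<open>h\<close> is orthogonal to the range, hence belongs to the kernel, hence is
  orthogonal to \<open>f\<close>; being orthogonal to the limit \<open>G\<close> as well, it vanishes.\<close>

lemma orthogonal_imp_range_closure:
  assumes f: "in_L2 f" and orth: "\<And>v. v \<in> ker_Zbar_star \<Longrightarrow> L2_inner f v = 0"
  shows "\<exists>w. (\<forall>n. w n \<in> test_functions) \<and> (\<lambda>n. power_integral 2 (\<lambda>x. Zbar (w n) x - f x)) \<longlonglongrightarrow> 0"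
proof -
  define Q where "Q w = sq_norm (\<lambda>x. f x - Zbar w x)" for w
  define E where "E = (INF w\<in>test_functions. Q w)"
  have bdd: "bdd_below (Q ` test_functions)" by (rule bdd_belowI[of _ 0]) (auto simp: Q_def sq_norm_nonneg)
  have E: "E \<le> Q w" if "w \<in> test_functions" for w unfolding E_def by (rule cINF_lower[OF bdd that])
  have zero: "(\<lambda>_. 0) \<in> test_functions" by (simp add: test_iff smooth_const)
  have "\<exists>w\<in>test_functions. Q w < E + (1/8) ^ n" for n :: nat
  proof -
    have "Inf (Q ` test_functions) < E + (1/8) ^ n" by (simp add: E_def)
    from cInf_lessD[OF _ this] zero show ?thesis by blast
  qed
  then obtain w where w: "\<And>n. w n \<in> test_functions" "\<And>n. Q (w n) < E + (1/8) ^ n" by metis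
  have Zw: "Zbar (w n) \<in> test_functions" "in_L2 (Zbar (w n))" for n
    by (intro test_Zbar in_L2_test w)+
  have dQ: "in_L2 (\<lambda>x. f x - Zbar u x)" if "u \<in> test_functions" for u
    by (intro in_L2_diff f in_L2_test test_Zbar that)
  have fast: "power_integral 2 (\<lambda>x. Zbar (w (Suc n)) x - Zbar (w n) x) \<le> ennreal (4 * (1/8) ^ n)" for n
  proof -
    \<comment> \<open>Parallelogram law: the midpoint is a competitor, so two nearly minimal functions are close.\<close>
    define u where "u = (\<lambda>x. (1/2) * (w n x + w (Suc n) x))"
    have u: "u \<in> test_functions" unfolding u_def by (intro test_cmult test_add w)
    have Zu: "Zbar u x = (1/2) * (Zbar (w n) x + Zbar (w (Suc n)) x)" for x
      unfolding u_def using w(1)[THEN test_smooth] by (subst Zbar_cmult) (auto intro: smooth_add simp: Zbar_add)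
    have mid: "sq_norm (\<lambda>x. (f x - Zbar (w n) x) + (f x - Zbar (w (Suc n)) x)) = 4 * Q u"
    proof -
      have "(norm ((f x - Zbar (w n) x) + (f x - Zbar (w (Suc n)) x)))\<^sup>2 = 4 * (norm (f x - Zbar u x))\<^sup>2" for x
      proof -
        have "(f x - Zbar (w n) x) + (f x - Zbar (w (Suc n)) x) = 2 * (f x - Zbar u x)" by (simp add: Zu algebra_simps)
        then show ?thesis by (simp only: norm_mult power_mult_distrib) simp
      qed
      then show ?thesis by (simp add: sq_norm_def Q_def)
    qed
    have "sq_norm (\<lambda>x. (f x - Zbar (w n) x) - (f x - Zbar (w (Suc n)) x)) = 2 * Q (w n) + 2 * Q (w (Suc n)) - 4 * Q u"
      using sq_norm_parallelogram[OF dQ[OF w(1)[of n]] dQ[OF w(1)[of "Suc n"]]] by (simp only: mid) (simp add: Q_def)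
    then have "sq_norm (\<lambda>x. Zbar (w (Suc n)) x - Zbar (w n) x) = 2 * Q (w n) + 2 * Q (w (Suc n)) - 4 * Q u" by simp
    also have "\<dots> \<le> 4 * (1/8) ^ n"
    proof -
      have "(1/8::real) ^ Suc n \<le> (1/8) ^ n" by (intro power_decreasing) auto
      then show ?thesis using w(2)[of n] w(2)[of "Suc n"] E[OF u] by linarith
    qed
    finally show ?thesis by (simp add: power_integral_sq_norm in_L2_diff Zw ennreal_leI)
  qed
  obtain G where G: "G \<in> borel_measurable borel" "(\<lambda>n. power_integral 2 (\<lambda>x. Zbar (w n) x - G x)) \<longlonglongrightarrow> 0"
    using L2_fast_Cauchy_converges[OF in_L2_measurable[OF Zw(2)] fast] by blast
  have Gsq: "in_L2 G"
  proof -
    obtain n where n: "power_integral 2 (\<lambda>x. Zbar (w n) x - G x) \<le> ennreal 1"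
      using ennreal_tendsto_0D[OF G(2), of 1] by (auto simp: eventually_sequentially)
    have [measurable]: "Zbar (w n) \<in> borel_measurable borel" by (rule in_L2_measurable[OF Zw(2)])
    have "in_L2 (\<lambda>x. Zbar (w n) x - G x)"
      using n G(1) by (auto simp: in_L2_def intro: le_less_trans)
    from in_L2_diff[OF Zw(2)[of n] this] show ?thesis by simp
  qed
  have limG: "(\<lambda>n. sq_norm (\<lambda>x. Zbar (w n) x - G x)) \<longlonglongrightarrow> 0"
  proof -
    have "(\<lambda>n. enn2real (power_integral 2 (\<lambda>x. Zbar (w n) x - G x))) \<longlonglongrightarrow> enn2real 0"
      by (intro tendsto_enn2real) (use G(2) in simp_all)
    then show ?thesis by (simp add: power_integral_sq_norm in_L2_diff Zw Gsq sq_norm_nonneg)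
  qed
  define h where "h = (\<lambda>x. f x - G x)"
  have h: "in_L2 h" unfolding h_def by (intro in_L2_diff f Gsq)
  have h_orth: "L2_inner h (Zbar u) = 0" if u: "u \<in> test_functions" for u
  proof -
    have Zu: "in_L2 (Zbar u)" by (intro in_L2_test test_Zbar u)
    have b: "(norm (L2_inner (\<lambda>x. f x - Zbar (w n) x) (Zbar u)))\<^sup>2 \<le> (sq_norm (Zbar u) + 1) * (Q (w n) - E)" for n
      unfolding Q_def
    proof (rule L2_inner_variational[OF dQ[OF w(1)] Zu])
      fix t
      have "(\<lambda>x. w n x + t * u x) \<in> test_functions" by (intro test_add test_cmult w u)
      from E[OF this] show "E \<le> sq_norm (\<lambda>x. f x - Zbar (w n) x - t * Zbar u x)"
        unfolding Q_def using test_smooth[OF w(1)[of n]] test_smooth[OF u]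
        by (simp add: Zbar_add Zbar_cmult smooth_cmult diff_diff_eq)
    qed
    have "(\<lambda>n. (sq_norm (Zbar u) + 1) * (Q (w n) - E)) \<longlonglongrightarrow> (sq_norm (Zbar u) + 1) * 0"
    proof (intro tendsto_intros)
      have L: "(\<lambda>n. (1/8::real) ^ n) \<longlonglongrightarrow> 0" by (intro LIMSEQ_realpow_zero) auto
      have QE: "0 \<le> Q (w n) - E" "Q (w n) - E \<le> (1/8) ^ n" for n
        using E[OF w(1)[of n]] w(2)[of n] by linarith+
      show "(\<lambda>n. Q (w n) - E) \<longlonglongrightarrow> 0"
        by (rule tendsto_sandwich[OF always_eventually always_eventually tendsto_const[of 0] L]; intro allI QE)
    qed
    then have L: "(\<lambda>n. (sq_norm (Zbar u) + 1) * (Q (w n) - E)) \<longlonglongrightarrow> 0" by simp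
    have "(\<lambda>n. (norm (L2_inner (\<lambda>x. f x - Zbar (w n) x) (Zbar u)))\<^sup>2) \<longlonglongrightarrow> 0"
      by (rule tendsto_sandwich[OF always_eventually always_eventually tendsto_const[of 0] L]; intro allI b zero_le_power2)
    then have 1: "(\<lambda>n. L2_inner (\<lambda>x. f x - Zbar (w n) x) (Zbar u)) \<longlonglongrightarrow> 0" by (rule tendsto_0_norm_square)
    have "(\<lambda>n. sq_norm (\<lambda>x. (f x - Zbar (w n) x) - h x)) \<longlonglongrightarrow> 0"
      using limG unfolding h_def sq_norm_def by (simp add: norm_minus_commute)
    from L2_inner_tendsto[OF dQ[OF w(1)] h Zu this] 1 show ?thesis by (rule LIMSEQ_unique)
  qed
  have "h \<in> ker_Zbar_star"
  proof (rule weak_kernel_imp_ker)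
    show "h \<in> Lp 2 heis_vol" using h by (simp add: Lp_heis_iff in_L2_def)
    show "(\<integral>x. Zbar u x * cnj (h x) \<partial>lborel) = 0" if "u \<in> test_functions" for u
    proof -
      have "L2_inner (Zbar u) h = cnj (L2_inner h (Zbar u))" by (simp add: L2_inner_cnj)
      then show ?thesis by (simp add: h_orth[OF that]) (simp add: L2_inner_def)
    qed
  qed
  then have fh: "L2_inner f h = 0" by (rule orth)
  have Gh: "L2_inner G h = 0"
  proof -
    have "(\<lambda>n. L2_inner (Zbar (w n)) h) \<longlonglongrightarrow> L2_inner G h" by (rule L2_inner_tendsto[OF Zw(2) Gsq h limG])
    moreover have "L2_inner (Zbar (w n)) h = 0" for n
      using h_orth[OF w(1)[of n]] L2_inner_cnj[of h "Zbar (w n)"] by simp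
    ultimately show ?thesis by (simp add: LIMSEQ_const_iff)
  qed
  have "L2_inner h h = L2_inner f h - L2_inner G h" using L2_inner_diff_left[OF f Gsq h] by (simp add: h_def)
  then have "sq_norm h = 0" using fh Gh by (simp add: L2_inner_self)
  then have "power_integral 2 h = 0" by (simp add: power_integral_sq_norm[OF h])
  then have h0: "power_integral 2 (\<lambda>x. G x - f x) = 0" by (subst power_integral_diff_commute) (simp add: h_def)
  have "(\<lambda>n. power_integral 2 (\<lambda>x. Zbar (w n) x - f x)) \<longlonglongrightarrow> 0"
  proof (rule ennreal_tendsto_0_le)
    have "(\<lambda>n. ennreal (2 powr 2) * power_integral 2 (\<lambda>x. Zbar (w n) x - G x)) \<longlonglongrightarrow> ennreal (2 powr 2) * 0"
      by (intro ennreal_tendsto_cmult G) simp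
    then show "(\<lambda>n. ennreal (2 powr 2) * power_integral 2 (\<lambda>x. Zbar (w n) x - G x)) \<longlonglongrightarrow> 0" by simp
    fix n
    have [measurable]: "Zbar (w n) \<in> borel_measurable borel" "G \<in> borel_measurable borel" "f \<in> borel_measurable borel"
      by (intro in_L2_measurable Zw Gsq f)+
    have "power_integral 2 (\<lambda>x. (Zbar (w n) x - G x) + (G x - f x)) \<le> ennreal (2 powr 2) * (power_integral 2 (\<lambda>x. Zbar (w n) x - G x) + power_integral 2 (\<lambda>x. G x - f x))"
      by (rule power_integral_add) auto
    then show "power_integral 2 (\<lambda>x. Zbar (w n) x - f x) \<le> ennreal (2 powr 2) * power_integral 2 (\<lambda>x. Zbar (w n) x - G x)"
      by (simp add: h0)
  qed
  then show ?thesis using w(1) by blast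
qed

theorem theorem1:
  fixes f :: "heis \<Rightarrow> complex"
  assumes "f \<in> Lp 2 heis_vol"
    and "\<forall>v\<in>ker_Zbar_star. heis_inner f v = 0"
  shows "\<exists>u\<in>Lp 4 heis_vol. \<exists>us :: nat \<Rightarrow> heis \<Rightarrow> complex.
           (\<forall>j. us j \<in> test_functions) \<and>
           Lp_converges 4 heis_vol us u \<and>
           Lp_converges 2 heis_vol (\<lambda>j. Zbar (us j)) f"
proof -
  have f: "in_L2 f" using assms(1) by (simp add: Lp_heis_iff in_L2_def)
  then have fm [measurable]: "f \<in> borel_measurable borel" and ffin: "power_integral 2 f < \<infinity>" by (auto simp: in_L2_def)
  have "L2_inner f v = 0" if v: "v \<in> ker_Zbar_star" for v
  proof -
    have "v \<in> borel_measurable borel" using v by (auto simp: ker_Zbar_star_def Lp_heis_iff)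
    from inner_lborel[OF fm this] show ?thesis using assms(2) v by (simp add: L2_inner_def)
  qed
  from orthogonal_imp_range_closure[OF f this] obtain w where w: "\<And>n. w n \<in> test_functions"
    and lim: "(\<lambda>n. power_integral 2 (\<lambda>x. Zbar (w n) x - f x)) \<longlonglongrightarrow> 0" by blast
  define K where "K g = hconv g (Zbar_kernel 0)" for g
  define c where "c = 1 / delta_mass"
  have Zw: "Zbar (w n) \<in> test_functions" for n by (rule test_Zbar[OF w])
  then have Zwm [measurable]: "Zbar (w n) \<in> borel_measurable borel" and Zwfin: "power_integral 2 (Zbar (w n)) < \<infinity>" for n
    using in_L2_test[OF Zw] by (auto simp: in_L2_def)
  have Km [measurable]: "K g \<in> borel_measurable borel" if [measurable]: "g \<in> borel_measurable borel" for g
    unfolding K_def by measurable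
  define s where "s n = (\<lambda>x. c * K (Zbar (w n)) x)" for n
  define u where "u = (\<lambda>x. c * K f x)"
  have Ks: "smooth (K (Zbar (w n)))" for n unfolding K_def by (rule smooth_hconv_kernel[OF Zw])
  have s: "smooth (s n)" for n unfolding s_def by (rule smooth_cmult[OF Ks])
  have Zs: "Zbar (s n) = Zbar (w n)" for n
    unfolding s_def using delta_mass_nonzero
    unfolding Zbar_cmult[OF Ks] fun_eq_iff unfolding K_def Zbar_hconv_kernel[OF w] c_def by simp
  have cm: "power_integral 4 (\<lambda>x. c * g x) = ennreal (norm c ^ 4) * power_integral 4 g"
    if [measurable]: "g \<in> borel_measurable borel" for g
    unfolding power_integral_4 by (subst nn_integral_cmult[symmetric]) (auto simp: norm_mult power_mult_distrib ennreal_mult)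
  have um: "u \<in> borel_measurable borel" unfolding u_def by measurable
  have ufin: "power_integral 4 u < \<infinity>"
    unfolding u_def using hconv_kernel_finite[OF fm ffin] by (subst cm) (auto simp: ennreal_mult_less_top K_def)
  have sfin: "power_integral 4 (s n) < \<infinity>" for n
    unfolding s_def using hconv_kernel_finite[OF Zwm Zwfin, of n] by (subst cm) (auto simp: ennreal_mult_less_top K_def)
  have "(\<lambda>n. power_integral 4 (\<lambda>x. K (Zbar (w n)) x - K f x)) \<longlonglongrightarrow> 0"
  proof (rule ennreal_tendsto_0I)
    fix e :: real assume e: "0 < e"
    define C :: real where "C = 16 * (768 * 770 ^ 3)"
    define d where "d = (e / C) powr (1/4)"
    have C: "0 < C" by (simp add: C_def)
    have d: "0 < d" "d ^ 4 = e / C" using e C by (auto simp: d_def powr_powr simp flip: powr_numeral)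
    have "\<forall>\<^sub>F n in sequentially. power_integral 2 (\<lambda>x. Zbar (w n) x - f x) \<le> ennreal (d\<^sup>2)"
      by (rule ennreal_tendsto_0D[OF lim]) (use d in simp)
    then show "\<forall>\<^sub>F n in sequentially. power_integral 4 (\<lambda>x. K (Zbar (w n)) x - K f x) \<le> ennreal e"
    proof eventually_elim
      case (elim n)
      have "power_integral 4 (\<lambda>x. K (Zbar (w n)) x - K f x) \<le> 16 * (768 * 770 ^ 3 * ennreal (d ^ 4))"
        unfolding K_def by (rule hconv_kernel_diff_L4[OF Zwm fm Zwfin ffin d(1) elim])
      also have "\<dots> = ennreal C * ennreal (d ^ 4)" by (simp add: C_def)
      also have "\<dots> = ennreal (C * d ^ 4)" using C by (subst ennreal_mult) auto
      also have "C * d ^ 4 = e" using C d(2) by simp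
      finally show ?case .
    qed
  qed
  then have "(\<lambda>n. ennreal (norm c ^ 4) * power_integral 4 (\<lambda>x. K (Zbar (w n)) x - K f x)) \<longlonglongrightarrow> ennreal (norm c ^ 4) * 0"
    by (intro ennreal_tendsto_cmult) simp
  moreover have "power_integral 4 (\<lambda>x. s n x - u x) = ennreal (norm c ^ 4) * power_integral 4 (\<lambda>x. K (Zbar (w n)) x - K f x)" for n
    unfolding s_def u_def right_diff_distrib[symmetric] by (rule cm) measurable
  ultimately have slim: "(\<lambda>n. power_integral 4 (\<lambda>x. s n x - u x)) \<longlonglongrightarrow> 0" by simp
  have "\<exists>us. (\<forall>n. us n \<in> test_functions) \<and> Lp_converges 4 heis_vol us u \<and> Lp_converges 2 heis_vol (\<lambda>n. Zbar (us n)) f"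
    by (rule cutoff_diagonal[OF _ _ s um ufin fm ffin sfin _ slim]) (use Zwfin in \<open>auto simp: Zs lim\<close>)
  then show ?thesis using um ufin by (intro bexI[of _ u]) (simp_all add: Lp_heis_iff)
qed

end
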